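(* Let $a,b\in\{e^{i\phi}:\phi\in[0,\pi)\}$ with $a\neq b$, and let $u=u(a)$, $v=u(b)$, where $$u(z)=\frac12\begin{bmatrix}1&1&1&1\\1&iz&-1&-iz\\1&-1&1&-1\\1&-iz&-1&iz\end{bmatrix}.$$ Then the Pimsner-Popa constant of the pair of spin model subfactors $R_u,R_v$ of the hyperfinite $II_1$ factor $R$ is $\lambda(R_u,R_v)=\frac12$.
   Context: The matrices $u(z)$, $z=e^{i\phi}$, $\phi\in[0,\pi)$, form the one-parameter family of pairwise Hadamard inequivalent $4\times4$ complex Hadamard matrices. Spin model subfactors (for $n=4$). $M_n$ is the algebra of complex $n\times n$ matrices, $\Delta_n\subset M_n$ the diagonal subalgebra, $E_{ij}$ the matrix units, $J_n=\frac1n\sum_{i,j}E_{ij}$. A complex Hadamard matrix means here a unitary $u\in M_n$ all of whose entries have modulus $1/\sqrt n$. Consider the tower $A_{-1}=\Delta_n\subset A_0=M_n\subset A_1=\Delta_n\otimes M_n\subset A_2=M_n\otimes M_n\subset\cdots$, i.e. $A_{2k}=M_n^{\otimes (k+1)}$, $A_{2k+1}=\Delta_n\otimes M_n^{\otimes(k+1)}$, where $A_{2k}\subset A_{2k+1}$ via $x\mapsto I_n\otimes x$ and $A_{2k+1}\subset A_{2k+2}$ is induced by $\Delta_n\subset M_n$. This is a tower of Jones basic constructions with Jones projections $e_{2k+1}=\sum_i E_{ii}\otimes E_{ii}\otimes I_n^{\otimes k}\in A_{2k+1}$ ($k\ge0$) and $e_{2k}=J_n\otimes I_n^{\otimes k}\in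 A_{2k}$ ($k\ge 1$). $R$ is the hyperfinite $II_1$ factor obtained as the SOT-closure of $\bigcup_k A_k$ in the GNS representation of the normalized trace. The spin model subfactor $R_u\subset R$ is the von Neumann subalgebra generated by $u\Delta_nu^*\subset A_0$ and all $e_j$, $j\ge1$. The same $R$ and $e_j$ are used for $u$ and $v$. Pimsner-Popa constant. For von Neumann subalgebras $\mathcal P,\mathcal Q$ of a finite von Neumann algebra $\mathcal M$ with fixed faithful normal trace and trace-preserving conditional expectation $E^{\mathcal M}_{\mathcal Q}$, $\lambda(\mathcal P,\mathcal Q)=\sup\{t\ge0: E^{\mathcal M}_{\mathcal Q}(x)\ge tx\ \ \forall x\in\mathcal P_+\}$. *)

theory Defs
  imports "HOL-Analysis.Bounded_Linear_Function" "HOL-Analysis.Convex" "Jordan_Normal_Form.Schur_Decomposition"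
begin

section \<open>Complex Hilbert spaces\<close>

text \<open>
  The complex inner product is linear in its first argument. Its real part is the
  library's real inner product, so norm, topology and bounded operators are those of
  the underlying real Hilbert space.
\<close>

class complex_inner = real_inner +
  fixes scaleC :: "complex \<Rightarrow> 'a \<Rightarrow> 'a"
    and cinner :: "'a \<Rightarrow> 'a \<Rightarrow> complex"
  assumes scaleC_add_right: "scaleC c (x + y) = scaleC c x + scaleC c y"
    and scaleC_add_left: "scaleC (c + d) x = scaleC c x + scaleC d x"
    and scaleC_scaleC: "scaleC c (scaleC d x) = scaleC (c * d) x"
    and scaleC_of_real: "scaleC (complex_of_real r) x = scaleR r x"
    and cinner_commute: "cinner x y = cnj (cinner y x)"
    and cinner_add_left: "cinner (x + y) z = cinner x z + cinner y z"
    and cinner_scaleC_left: "cinner (scaleC c x) y = c * cinner x y"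
    and Re_cinner: "Re (cinner x y) = inner x y"

class complex_hilbert = complex_inner + complete_space

lemma scaleC_one: "scaleC 1 (x :: 'a :: complex_inner) = x"
  using scaleC_of_real[of 1 x] by simp

lemma cinner_self: "cinner (x :: 'a :: complex_inner) x = complex_of_real ((norm x)\<^sup>2)"
proof (rule complex_eqI)
  show "Re (cinner x x) = Re (complex_of_real ((norm x)\<^sup>2))"
    by (simp add: Re_cinner power2_norm_eq_inner)
  have "cinner x x = cnj (cinner x x)" by (rule cinner_commute)
  then show "Im (cinner x x) = Im (complex_of_real ((norm x)\<^sup>2))"
    by (metis Im_complex_of_real Reals_cnj_iff complex_is_Real_iff)
qed

lemma norm_scaleC: "norm (scaleC c (x :: 'a :: complex_inner)) = cmod c * norm x"
proof -
  have "cinner (scaleC c x) (scaleC c x) = c * cnj c * cinner x x"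
    by (metis cinner_commute cinner_scaleC_left complex_cnj_mult mult.assoc mult.commute)
  then have "complex_of_real ((norm (scaleC c x))\<^sup>2) = complex_of_real ((cmod c * norm x)\<^sup>2)"
    unfolding cinner_self by (simp add: complex_norm_square power_mult_distrib del: of_real_power flip: complex_norm_square)
  then have "(norm (scaleC c x))\<^sup>2 = (cmod c * norm x)\<^sup>2"
    by (simp only: of_real_eq_iff)
  then show ?thesis by (simp add: power2_eq_iff_nonneg)
qed

lemma cinner_eq: "cinner x y = Complex (inner x y) (- inner (scaleC \<i> x) y)"
  for x y :: "'a :: complex_inner"
  by (rule complex_eqI) (simp_all add: Re_cinner cinner_scaleC_left flip: Re_cinner)

lemma bounded_linear_scaleC: "bounded_linear (scaleC c :: 'a :: complex_inner \<Rightarrow> 'a)"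
proof (rule bounded_linear_intro)
  fix r and x y :: 'a
  show "scaleC c (x + y) = scaleC c x + scaleC c y" by (rule scaleC_add_right)
  show "scaleC c (scaleR r x) = scaleR r (scaleC c x)"
    by (simp add: scaleC_scaleC mult.commute flip: scaleC_of_real)
  show "norm (scaleC c x) \<le> norm x * cmod c" by (simp add: norm_scaleC mult.commute)
qed

lift_definition scaleC_op :: "complex \<Rightarrow> 'a :: complex_inner \<Rightarrow>\<^sub>L 'a" is scaleC
  by (rule bounded_linear_scaleC)


section \<open>Hilbert space completion\<close>

quotient_type (overloaded) 'a completion = "nat \<Rightarrow> 'a :: complex_inner" /
  partial: "\<lambda>X Y. Cauchy X \<and> Cauchy Y \<and> (\<lambda>n. X n - Y n) \<longlonglongrightarrow> 0"
proof (rule part_equivpI)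
  show "\<exists>X :: nat \<Rightarrow> 'a. Cauchy X \<and> Cauchy X \<and> (\<lambda>n. X n - X n) \<longlonglongrightarrow> 0"
    by (rule exI[of _ "\<lambda>_. 0"]) (simp add: convergent_Cauchy convergent_const)
  show "symp (\<lambda>X Y :: nat \<Rightarrow> 'a. Cauchy X \<and> Cauchy Y \<and> (\<lambda>n. X n - Y n) \<longlonglongrightarrow> 0)"
  proof (rule sympI, elim conjE, intro conjI)
    fix X Y :: "nat \<Rightarrow> 'a" assume "(\<lambda>n. X n - Y n) \<longlonglongrightarrow> 0"
    from tendsto_minus[OF this] show "(\<lambda>n. Y n - X n) \<longlonglongrightarrow> 0" by simp
  qed
  show "transp (\<lambda>X Y :: nat \<Rightarrow> 'a. Cauchy X \<and> Cauchy Y \<and> (\<lambda>n. X n - Y n) \<longlonglongrightarrow> 0)"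
  proof (rule transpI, elim conjE, intro conjI)
    fix X Y Z :: "nat \<Rightarrow> 'a"
    assume "(\<lambda>n. X n - Y n) \<longlonglongrightarrow> 0" "(\<lambda>n. Y n - Z n) \<longlonglongrightarrow> 0"
    from tendsto_add[OF this] show "(\<lambda>n. X n - Z n) \<longlonglongrightarrow> 0" by simp
  qed
qed

lemma Cauchy_add': "Cauchy X \<Longrightarrow> Cauchy Y \<Longrightarrow> Cauchy (\<lambda>n. X n + Y n)"
  for X Y :: "nat \<Rightarrow> 'a :: real_normed_vector"
  unfolding Cauchy_iff
proof (intro allI impI)
  fix e :: real
  assume X: "\<forall>e>0. \<exists>M. \<forall>m\<ge>M. \<forall>n\<ge>M. norm (X m - X n) < e"
    and Y: "\<forall>e>0. \<exists>M. \<forall>m\<ge>M. \<forall>n\<ge>M. norm (Y m - Y n) < e" and "0 < e"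
  then obtain M N where M: "\<And>m n. m \<ge> M \<Longrightarrow> n \<ge> M \<Longrightarrow> norm (X m - X n) < e/2"
    and N: "\<And>m n. m \<ge> N \<Longrightarrow> n \<ge> N \<Longrightarrow> norm (Y m - Y n) < e/2"
    by (meson half_gt_zero)
  have "norm (X m + Y m - (X n + Y n)) < e" if "m \<ge> max M N" "n \<ge> max M N" for m n
    using M[of m n] N[of m n] that norm_diff_triangle_ineq[of "X m" "Y m" "X n" "Y n"] by simp
  then show "\<exists>M. \<forall>m\<ge>M. \<forall>n\<ge>M. norm (X m + Y m - (X n + Y n)) < e" by blast
qed

lemma Cauchy_bounded_linear: "bounded_linear f \<Longrightarrow> Cauchy X \<Longrightarrow> Cauchy (\<lambda>n. f (X n))"
  by (rule bounded_linear.Cauchy)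

lemma Cauchy_uminus: "Cauchy X \<Longrightarrow> Cauchy (\<lambda>n. - X n)"
  for X :: "nat \<Rightarrow> 'a :: real_normed_vector"
  by (rule Cauchy_bounded_linear[OF bounded_linear_minus[OF bounded_linear_ident]])

lemma Cauchy_diff': "Cauchy X \<Longrightarrow> Cauchy Y \<Longrightarrow> Cauchy (\<lambda>n. X n - Y n)"
  for X Y :: "nat \<Rightarrow> 'a :: real_normed_vector"
  using Cauchy_add'[OF _ Cauchy_uminus, of X Y] by simp

lemma convergent_inner:
  fixes X Y :: "nat \<Rightarrow> 'a :: real_inner"
  assumes X: "Cauchy X" and Y: "Cauchy Y"
  shows "convergent (\<lambda>n. inner (X n) (Y n))"
proof -
  obtain K where K: "K > 0" "\<And>n. norm (X n) \<le> K"
    using Cauchy_Bseq[OF X] by (auto elim: BseqE)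
  obtain L where L: "L > 0" "\<And>n. norm (Y n) \<le> L"
    using Cauchy_Bseq[OF Y] by (auto elim: BseqE)
  have "Cauchy (\<lambda>n. inner (X n) (Y n))" unfolding Cauchy_iff
  proof (intro allI impI)
    fix e :: real assume e: "0 < e"
    from e L K obtain M N where M: "\<And>m n. m \<ge> M \<Longrightarrow> n \<ge> M \<Longrightarrow> norm (X m - X n) < e/2/L"
      and N: "\<And>m n. m \<ge> N \<Longrightarrow> n \<ge> N \<Longrightarrow> norm (Y m - Y n) < e/2/K"
      using X Y unfolding Cauchy_iff by (meson divide_pos_pos half_gt_zero)
    have "norm (inner (X m) (Y m) - inner (X n) (Y n)) < e"
      if "m \<ge> max M N" "n \<ge> max M N" for m n
    proof -
      have "inner (X m) (Y m) - inner (X n) (Y n)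
          = inner (X m - X n) (Y m) + inner (X n) (Y m - Y n)"
        by (simp add: inner_diff_left inner_diff_right)
      also have "norm \<dots> \<le> norm (X m - X n) * norm (Y m) + norm (X n) * norm (Y m - Y n)"
        unfolding real_norm_def
        by (rule order_trans[OF abs_triangle_ineq add_mono]) (rule Cauchy_Schwarz_ineq2)+
      also have "\<dots> \<le> norm (X m - X n) * L + K * norm (Y m - Y n)"
        using K L by (intro add_mono mult_left_mono mult_right_mono) auto
      also have "\<dots> < e/2 + e/2"
        using M[of m n] N[of m n] that K(1) L(1)
        by (intro add_strict_mono) (simp_all add: field_simps)
      finally show ?thesis by simp
    qed
    then show "\<exists>M. \<forall>m\<ge>M. \<forall>n\<ge>M. norm (inner (X m) (Y m) - inner (X n) (Y n)) < e" by blast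
  qed
  then show ?thesis by (simp add: Cauchy_convergent_iff)
qed

lemma convergent_cinner:
  fixes X Y :: "nat \<Rightarrow> 'a :: complex_inner"
  assumes X: "Cauchy X" and Y: "Cauchy Y"
  shows "convergent (\<lambda>n. cinner (X n) (Y n))"
proof -
  obtain r where r: "(\<lambda>n. inner (X n) (Y n)) \<longlonglongrightarrow> r"
    using convergent_inner[OF X Y] by (auto simp: convergent_def)
  obtain s where s: "(\<lambda>n. inner (scaleC \<i> (X n)) (Y n)) \<longlonglongrightarrow> s"
    using convergent_inner[OF Cauchy_bounded_linear[OF bounded_linear_scaleC X] Y]
    by (auto simp: convergent_def)
  show ?thesis unfolding cinner_eq
    by (rule convergentI[OF tendsto_Complex[OF r tendsto_minus[OF s]]])
qed

lemma tendsto_inner_zero: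
  fixes X Y :: "nat \<Rightarrow> 'a :: real_inner"
  assumes X: "X \<longlonglongrightarrow> 0" and Y: "Cauchy Y"
  shows "(\<lambda>n. inner (X n) (Y n)) \<longlonglongrightarrow> 0"
proof -
  obtain L where L: "L > 0" "\<And>n. norm (Y n) \<le> L"
    using Cauchy_Bseq[OF Y] by (auto elim: BseqE)
  have "(\<lambda>n. norm (X n) * L) \<longlonglongrightarrow> 0"
    using tendsto_mult_right_zero[OF tendsto_norm_zero[OF X], of L] by (simp add: mult.commute)
  then show ?thesis
  proof (rule Lim_null_comparison[rotated], intro always_eventually allI)
    fix n show "norm (inner (X n) (Y n)) \<le> norm (X n) * L"
      using order_trans[OF Cauchy_Schwarz_ineq2 mult_left_mono[OF L(2)]] by simp
  qed
qed

lemma tendsto_cinner_zero: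
  fixes X Y :: "nat \<Rightarrow> 'a :: complex_inner"
  assumes X: "X \<longlonglongrightarrow> 0" and Y: "Cauchy Y"
  shows "(\<lambda>n. cinner (X n) (Y n)) \<longlonglongrightarrow> 0"
proof -
  have "(\<lambda>n. scaleC \<i> (X n)) \<longlonglongrightarrow> 0"
    using bounded_linear.tendsto_zero[OF bounded_linear_scaleC X] .
  from tendsto_Complex[OF tendsto_inner_zero[OF X Y]
      tendsto_minus[OF tendsto_inner_zero[OF this Y]]]
  show ?thesis unfolding cinner_eq by (simp add: zero_complex.code)
qed

lemma cinner_add_right: "cinner x (y + z) = cinner x y + cinner x z"
  for x y z :: "'a :: complex_inner"
  by (metis cinner_add_left cinner_commute complex_cnj_add)

lemma cinner_minus_left: "cinner (- x) y = - cinner x y" for x y :: "'a :: complex_inner"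
proof -
  have "cinner (x + - x) y = cinner x y + cinner (- x) y" by (rule cinner_add_left)
  moreover have "cinner (0 :: 'a) y = 0"
    using cinner_add_left[of "0 :: 'a" 0 y] by simp
  ultimately show ?thesis by (simp add: eq_neg_iff_add_eq_0 add.commute)
qed

lemma cinner_diff_left: "cinner (x - y) z = cinner x z - cinner y z"
  for x y z :: "'a :: complex_inner"
  using cinner_add_left[of x "- y" z] by (simp add: cinner_minus_left)

lemma cinner_diff_right: "cinner x (y - z) = cinner x y - cinner x z"
  for x y z :: "'a :: complex_inner"
  by (metis cinner_commute cinner_diff_left complex_cnj_diff)

instantiation completion :: (complex_inner) complex_inner
begin

lift_definition zero_completion :: "'a completion" is "\<lambda>_. 0"
  by (simp add: convergent_Cauchy convergent_const)

lift_definition plus_completion :: "'a completion \<Rightarrow> 'a completion \<Rightarrow> 'a completion"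
  is "\<lambda>X Y n. X n + Y n"
proof (elim conjE, intro conjI Cauchy_add')
  fix X X' Y Y' :: "nat \<Rightarrow> 'a"
  assume "(\<lambda>n. X n - X' n) \<longlonglongrightarrow> 0" "(\<lambda>n. Y n - Y' n) \<longlonglongrightarrow> 0"
  from tendsto_add[OF this] show "(\<lambda>n. X n + Y n - (X' n + Y' n)) \<longlonglongrightarrow> 0"
    by (simp add: algebra_simps)
qed

lift_definition uminus_completion :: "'a completion \<Rightarrow> 'a completion" is "\<lambda>X n. - X n"
proof (elim conjE, intro conjI Cauchy_uminus)
  fix X Y :: "nat \<Rightarrow> 'a" assume "(\<lambda>n. X n - Y n) \<longlonglongrightarrow> 0"
  from tendsto_minus[OF this] show "(\<lambda>n. - X n - - Y n) \<longlonglongrightarrow> 0" by simp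
qed

definition minus_completion :: "'a completion \<Rightarrow> 'a completion \<Rightarrow> 'a completion"
  where "minus_completion x y = x + - y"

lift_definition scaleC_completion :: "complex \<Rightarrow> 'a completion \<Rightarrow> 'a completion"
  is "\<lambda>c X n. scaleC c (X n)"
proof (elim conjE, intro conjI Cauchy_bounded_linear[OF bounded_linear_scaleC])
  fix c and X Y :: "nat \<Rightarrow> 'a" assume "(\<lambda>n. X n - Y n) \<longlonglongrightarrow> 0"
  from bounded_linear.tendsto_zero[OF bounded_linear_scaleC this]
  show "(\<lambda>n. scaleC c (X n) - scaleC c (Y n)) \<longlonglongrightarrow> 0"
    by (simp add: linear_diff[OF bounded_linear.linear[OF bounded_linear_scaleC]])
qed

definition scaleR_completion :: "real \<Rightarrow> 'a completion \<Rightarrow> 'a completion"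
  where "scaleR_completion r x = scaleC (complex_of_real r) x"

lift_definition cinner_completion :: "'a completion \<Rightarrow> 'a completion \<Rightarrow> complex"
  is "\<lambda>X Y. lim (\<lambda>n. cinner (X n) (Y n))"
proof (elim conjE)
  fix X X' Y Y' :: "nat \<Rightarrow> 'a"
  assume C: "Cauchy X" "Cauchy X'" "Cauchy Y" "Cauchy Y'"
    and X: "(\<lambda>n. X n - X' n) \<longlonglongrightarrow> 0" and Y: "(\<lambda>n. Y n - Y' n) \<longlonglongrightarrow> 0"
  have 1: "(\<lambda>n. cinner (X n - X' n) (Y n)) \<longlonglongrightarrow> 0"
    by (rule tendsto_cinner_zero[OF X C(3)])
  have "(\<lambda>n. cnj (cinner (Y n - Y' n) (X' n))) \<longlonglongrightarrow> 0"
    using tendsto_cnj[OF tendsto_cinner_zero[OF Y C(2)]] by simp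
  then have 2: "(\<lambda>n. cinner (X' n) (Y n - Y' n)) \<longlonglongrightarrow> 0"
    by (simp flip: cinner_commute)
  obtain l where l: "(\<lambda>n. cinner (X n) (Y n)) \<longlonglongrightarrow> l"
    using convergent_cinner[OF C(1,3)] by (auto simp: convergent_def)
  from tendsto_diff[OF l tendsto_add[OF 1 2]]
  have "(\<lambda>n. cinner (X' n) (Y' n)) \<longlonglongrightarrow> l"
    by (simp add: cinner_diff_left cinner_diff_right)
  with l show "lim (\<lambda>n. cinner (X n) (Y n)) = lim (\<lambda>n. cinner (X' n) (Y' n))"
    by (simp add: limI)
qed

definition inner_completion :: "'a completion \<Rightarrow> 'a completion \<Rightarrow> real"
  where "inner_completion x y = Re (cinner x y)"

definition norm_completion :: "'a completion \<Rightarrow> real"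
  where "norm_completion x = sqrt (inner x x)"

definition dist_completion :: "'a completion \<Rightarrow> 'a completion \<Rightarrow> real"
  where "dist_completion x y = norm (x - y)"

definition sgn_completion :: "'a completion \<Rightarrow> 'a completion"
  where "sgn_completion x = scaleR (inverse (norm x)) x"

definition uniformity_completion :: "('a completion \<times> 'a completion) filter"
  where "uniformity_completion = (INF e\<in>{0<..}. principal {(x, y). dist x y < e})"

definition open_completion :: "'a completion set \<Rightarrow> bool"
  where "open_completion U \<longleftrightarrow>
    (\<forall>x\<in>U. eventually (\<lambda>(x', y). x' = x \<longrightarrow> y \<in> U) uniformity)"

instance
proof
  fix x y z :: "'a completion" and c d :: complex and r s :: real
  show add_assoc: "x + y + z = x + (y + z)" for x y z :: "'a completion"
    by transfer (simp add: Cauchy_add' add.assoc)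
  show add_comm: "x + y = y + x" for x y :: "'a completion"
    by transfer (simp add: Cauchy_add' add.commute)
  show "0 + x = x" by transfer simp
  show neg: "- x + x = 0" for x :: "'a completion"
    by transfer (simp add: convergent_Cauchy convergent_const)
  show "x - y = x + - y" by (rule minus_completion_def)
  show scaleC_add_right: "scaleC c (x + y) = scaleC c x + scaleC c y" for c and x y :: "'a completion"
    by transfer (simp add: complex_inner_class.scaleC_add_right Cauchy_add'
        Cauchy_bounded_linear[OF bounded_linear_scaleC])
  show scaleC_add_left: "scaleC (c + d) x = scaleC c x + scaleC d x" for c d and x :: "'a completion"
    by transfer (simp add: complex_inner_class.scaleC_add_left Cauchy_add'
        Cauchy_bounded_linear[OF bounded_linear_scaleC])
  show scaleC_scaleC: "scaleC c (scaleC d x) = scaleC (c * d) x" for c d and x :: "'a completion"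
    by transfer (simp add: complex_inner_class.scaleC_scaleC
        Cauchy_bounded_linear[OF bounded_linear_scaleC])
  show "scaleC (complex_of_real r) x = scaleR r x" by (simp add: scaleR_completion_def)
  show "scaleR r (x + y) = scaleR r x + scaleR r y"
    by (simp add: scaleR_completion_def scaleC_add_right)
  show "scaleR (r + s) x = scaleR r x + scaleR s x"
    by (simp add: scaleR_completion_def scaleC_add_left)
  show "scaleR r (scaleR s x) = scaleR (r * s) x"
    by (simp add: scaleR_completion_def scaleC_scaleC)
  show "scaleR 1 x = x"
    unfolding scaleR_completion_def of_real_1
    by transfer (simp add: scaleC_one)
  show comm: "cinner x y = cnj (cinner y x)" for x y :: "'a completion"
  proof (transfer, elim conjE)
    fix X Y :: "nat \<Rightarrow> 'a" assume "Cauchy X" "Cauchy Y"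
    then obtain l where l: "(\<lambda>n. cinner (Y n) (X n)) \<longlonglongrightarrow> l"
      using convergent_cinner by (auto simp: convergent_def)
    from tendsto_cnj[OF this] have "(\<lambda>n. cinner (X n) (Y n)) \<longlonglongrightarrow> cnj l"
      by (simp flip: cinner_commute)
    with l show "lim (\<lambda>n. cinner (X n) (Y n)) = cnj (lim (\<lambda>n. cinner (Y n) (X n)))"
      by (simp add: limI)
  qed
  show cadd: "cinner (x + y) z = cinner x z + cinner y z" for x y z :: "'a completion"
  proof (transfer, elim conjE)
    fix X Y Z :: "nat \<Rightarrow> 'a" assume C: "Cauchy X" "Cauchy Y" "Cauchy Z"
    obtain l where l: "(\<lambda>n. cinner (X n) (Z n)) \<longlonglongrightarrow> l"
      using convergent_cinner[OF C(1,3)] by (auto simp: convergent_def)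
    obtain m where m: "(\<lambda>n. cinner (Y n) (Z n)) \<longlonglongrightarrow> m"
      using convergent_cinner[OF C(2,3)] by (auto simp: convergent_def)
    from tendsto_add[OF l m] have "(\<lambda>n. cinner (X n + Y n) (Z n)) \<longlonglongrightarrow> l + m"
      by (simp add: cinner_add_left)
    with l m show "lim (\<lambda>n. cinner (X n + Y n) (Z n))
        = lim (\<lambda>n. cinner (X n) (Z n)) + lim (\<lambda>n. cinner (Y n) (Z n))"
      by (simp add: limI)
  qed
  show cscale: "cinner (scaleC c x) y = c * cinner x y" for c and x y :: "'a completion"
  proof (transfer, elim conjE)
    fix c and X Y :: "nat \<Rightarrow> 'a" assume "Cauchy X" "Cauchy Y"
    then obtain l where l: "(\<lambda>n. cinner (X n) (Y n)) \<longlonglongrightarrow> l"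
      using convergent_cinner by (auto simp: convergent_def)
    from tendsto_mult_left[OF this, of c]
    have "(\<lambda>n. cinner (scaleC c (X n)) (Y n)) \<longlonglongrightarrow> c * l"
      by (simp add: cinner_scaleC_left)
    with l show "lim (\<lambda>n. cinner (scaleC c (X n)) (Y n)) = c * lim (\<lambda>n. cinner (X n) (Y n))"
      by (simp add: limI)
  qed
  show "Re (cinner x y) = inner x y" by (simp add: inner_completion_def)
  show "inner x y = inner y x"
    using comm[of x y] by (simp add: inner_completion_def)
  show "inner (x + y) z = inner x z + inner y z"
    by (simp add: inner_completion_def cadd)
  show "inner (scaleR r x) y = r * inner x y"
    by (simp add: inner_completion_def scaleR_completion_def cscale)
  have pos: "\<exists>r\<ge>0. cinner x x = complex_of_real r \<and> (r = 0 \<longrightarrow> x = 0)"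
  proof (transfer, elim conjE)
    fix X :: "nat \<Rightarrow> 'a" assume C: "Cauchy X"
    then obtain l where l: "(\<lambda>n. inner (X n) (X n)) \<longlonglongrightarrow> l"
      using convergent_inner by (auto simp: convergent_def)
    from tendsto_of_real[OF l] have "(\<lambda>n. cinner (X n) (X n)) \<longlonglongrightarrow> complex_of_real l"
      by (simp add: cinner_self power2_norm_eq_inner)
    then have "lim (\<lambda>n. cinner (X n) (X n)) = complex_of_real l" by (rule limI)
    moreover have "l \<ge> 0" by (rule LIMSEQ_le_const[OF l]) simp
    moreover have "X \<longlonglongrightarrow> 0" if "l = 0"
      using tendsto_real_sqrt[OF l] that
      by (simp add: tendsto_norm_zero_iff flip: norm_eq_sqrt_inner)
    ultimately show "\<exists>r\<ge>0. lim (\<lambda>n. cinner (X n) (X n)) = complex_of_real r \<and>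
        (r = 0 \<longrightarrow> Cauchy X \<and> Cauchy (\<lambda>_. 0 :: 'a) \<and> (\<lambda>n. X n - 0) \<longlonglongrightarrow> 0)"
      using C by (intro exI[of _ l]) (simp add: convergent_Cauchy convergent_const)
  qed
  then show "0 \<le> inner x x" by (auto simp: inner_completion_def)
  have "(0 :: 'a completion) + 0 = 0"
    by transfer (simp add: convergent_Cauchy convergent_const)
  with cadd[of 0 0 0] have "cinner (0 :: 'a completion) 0 = 0" by simp
  with pos show "inner x x = 0 \<longleftrightarrow> x = 0"
    by (auto simp: inner_completion_def)
qed (fact norm_completion_def dist_completion_def sgn_completion_def
    uniformity_completion_def open_completion_def)+

end

lift_definition to_completion :: "'a :: complex_inner \<Rightarrow> 'a completion" is "\<lambda>x _. x"
  by (simp add: convergent_Cauchy convergent_const)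

lemma Cauchy_self: "Cauchy X \<Longrightarrow> Cauchy X \<and> Cauchy X \<and> (\<lambda>n. X n - X n) \<longlonglongrightarrow> 0"
  for X :: "nat \<Rightarrow> 'a :: real_normed_vector"
  by simp

lemma norm_abs_completion:
  assumes "Cauchy X"
  shows "(\<lambda>n. norm (X n)) \<longlonglongrightarrow> norm (abs_completion X)"
proof -
  obtain l where l: "(\<lambda>n. inner (X n) (X n)) \<longlonglongrightarrow> l"
    using convergent_inner[OF assms assms] by (auto simp: convergent_def)
  from tendsto_of_real[OF l] have "(\<lambda>n. cinner (X n) (X n)) \<longlonglongrightarrow> complex_of_real l"
    by (simp add: cinner_self power2_norm_eq_inner)
  then have "lim (\<lambda>n. cinner (X n) (X n)) = complex_of_real l" by (rule limI)
  then have "inner (abs_completion X) (abs_completion X) = l"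
    using assms by (simp add: inner_completion_def cinner_completion.abs_eq)
  with tendsto_real_sqrt[OF l] show ?thesis by (simp add: norm_eq_sqrt_inner)
qed

lemma abs_completion_diff:
  assumes "Cauchy X" "Cauchy Y"
  shows "abs_completion X - abs_completion Y = abs_completion (\<lambda>n. X n - Y n)"
  using assms
  by (simp add: minus_completion_def uminus_completion.abs_eq plus_completion.abs_eq Cauchy_uminus)

lemma obtain_Cauchy:
  obtains X where "Cauchy X" "z = abs_completion X"
  by (induction z rule: completion.abs_induct) auto

lemma to_completion_LIMSEQ:
  assumes X: "Cauchy X"
  shows "(\<lambda>n. to_completion (X n)) \<longlonglongrightarrow> abs_completion X"
proof (rule LIMSEQ_I)
  fix e :: real assume "0 < e"
  then obtain M where M: "\<And>m n. m \<ge> M \<Longrightarrow> n \<ge> M \<Longrightarrow> norm (X m - X n) < e/2"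
    using X unfolding Cauchy_iff by (meson half_gt_zero)
  have "norm (to_completion (X n) - abs_completion X) < e" if n: "n \<ge> M" for n
  proof -
    have C: "Cauchy (\<lambda>_. X n)" by (simp add: convergent_Cauchy convergent_const)
    have "norm (abs_completion (\<lambda>m. X n - X m)) \<le> e/2"
      by (rule LIMSEQ_le_const2[OF norm_abs_completion[OF Cauchy_diff'[OF C X]]])
        (use M[OF n] in \<open>auto intro!: exI[of _ M] less_imp_le\<close>)
    with \<open>0 < e\<close> show ?thesis
      by (simp add: to_completion.abs_eq abs_completion_diff[OF C X])
  qed
  then show "\<exists>M. \<forall>n\<ge>M. norm (to_completion (X n) - abs_completion X) < e" by blast
qed

lemma norm_to_completion_diff: "norm (to_completion x - to_completion y) = norm (x - y)"
proof -
  have C: "Cauchy (\<lambda>_. z)" for z :: 'a by (simp add: convergent_Cauchy convergent_const)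
  have "(\<lambda>_. norm (x - y)) \<longlonglongrightarrow> norm (to_completion x - to_completion y)"
    using norm_abs_completion[OF C, of "x - y"]
    by (simp add: to_completion.abs_eq abs_completion_diff[OF C C])
  from LIMSEQ_unique[OF this tendsto_const] show ?thesis .
qed

lemma to_completion_dense: "\<exists>x. norm (z - to_completion x) < e" if "0 < e"
proof -
  obtain X where X: "Cauchy X" "z = abs_completion X" by (rule obtain_Cauchy)
  from LIMSEQ_D[OF to_completion_LIMSEQ[OF X(1)] that] show ?thesis
    unfolding X(2) by (metis norm_minus_commute order_refl)
qed

instance completion :: (complex_inner) complex_hilbert
proof
  fix Z :: "nat \<Rightarrow> 'a completion" assume Z: "Cauchy Z"
  have "\<forall>n. \<exists>x. norm (Z n - to_completion x) < inverse (real (Suc n))"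
    by (intro allI to_completion_dense) simp
  then obtain x where x: "\<And>n. norm (Z n - to_completion (x n)) < inverse (real (Suc n))"
    by metis
  have lim: "(\<lambda>n. Z n - to_completion (x n)) \<longlonglongrightarrow> 0"
    by (rule Lim_null_comparison[OF always_eventually LIMSEQ_inverse_real_of_nat])
      (use x less_imp_le in blast)
  have "Cauchy (\<lambda>n. Z n - (Z n - to_completion (x n)))"
    by (rule Cauchy_diff'[OF Z convergent_Cauchy[OF convergentI[OF lim]]])
  then have "Cauchy x"
    by (simp add: Cauchy_iff norm_to_completion_diff)
  from tendsto_add[OF lim to_completion_LIMSEQ[OF this]]
  show "convergent Z" by (simp add: convergent_def) blast
qed


text \<open>The continuous extension of a bounded operator to the completion.\<close>

definition completion_map :: "('a \<Rightarrow> 'a) \<Rightarrow> 'a :: complex_inner completion \<Rightarrow> 'a completion"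
  where "completion_map f z = abs_completion (\<lambda>n. f (rep_completion z n))"

lemma completion_map_abs:
  assumes f: "bounded_linear f" and X: "Cauchy X"
  shows "completion_map f (abs_completion X) = abs_completion (\<lambda>n. f (X n))"
proof -
  define Y where "Y = rep_completion (abs_completion X)"
  have Y: "Cauchy Y" "(\<lambda>n. Y n - X n) \<longlonglongrightarrow> 0"
    using Quotient3_rep_abs[OF Quotient3_completion, of X] X by (simp_all add: Y_def)
  have "(\<lambda>n. f (Y n) - f (X n)) \<longlonglongrightarrow> 0"
    using bounded_linear.tendsto_zero[OF f Y(2)]
    by (simp add: linear_diff[OF bounded_linear.linear[OF f]])
  then have "abs_completion (\<lambda>n. f (Y n)) = abs_completion (\<lambda>n. f (X n))"
    by (intro Quotient3_rel_abs[OF Quotient3_completion] conjI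
        Cauchy_bounded_linear[OF f Y(1)] Cauchy_bounded_linear[OF f X])
  then show ?thesis by (simp add: completion_map_def Y_def)
qed

lemma completion_map_to_completion:
  "bounded_linear f \<Longrightarrow> completion_map f (to_completion x) = to_completion (f x)"
  by (simp add: to_completion.abs_eq completion_map_abs convergent_Cauchy convergent_const)

lemma completion_map_scaleC:
  assumes f: "bounded_linear f" and fc: "\<And>c x. f (scaleC c x) = scaleC c (f x)"
  shows "completion_map f (scaleC c z) = scaleC c (completion_map f z)"
proof -
  obtain X where X: "Cauchy X" "z = abs_completion X" by (rule obtain_Cauchy)
  show ?thesis
    unfolding X(2) scaleC_completion.abs_eq[OF Cauchy_self[OF X(1)]]
      completion_map_abs[OF f X(1)]
      completion_map_abs[OF f Cauchy_bounded_linear[OF bounded_linear_scaleC X(1)]]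
      scaleC_completion.abs_eq[OF Cauchy_self[OF Cauchy_bounded_linear[OF f X(1)]]] fc
    by (rule refl)
qed

lemma bounded_linear_completion_map:
  fixes f :: "'a :: complex_inner \<Rightarrow> 'a"
  assumes f: "bounded_linear f" and fc: "\<And>c x. f (scaleC c x) = scaleC c (f x)"
  shows "bounded_linear (completion_map f)"
proof -
  obtain K where K: "\<And>x. norm (f x) \<le> norm x * K"
    using bounded_linear.bounded[OF f] by blast
  show ?thesis
  proof (rule bounded_linear_intro)
    fix r and y z :: "'a completion"
    obtain X where X: "Cauchy X" "z = abs_completion X" by (rule obtain_Cauchy)
    obtain Y where Y: "Cauchy Y" "y = abs_completion Y" by (rule obtain_Cauchy)
    note fX = Cauchy_bounded_linear[OF f X(1)] and fY = Cauchy_bounded_linear[OF f Y(1)]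
    show "completion_map f (y + z) = completion_map f y + completion_map f z"
      unfolding X(2) Y(2) plus_completion.abs_eq[OF Cauchy_self[OF Y(1)] Cauchy_self[OF X(1)]]
        completion_map_abs[OF f X(1)] completion_map_abs[OF f Y(1)]
        completion_map_abs[OF f Cauchy_add'[OF Y(1) X(1)]]
        plus_completion.abs_eq[OF Cauchy_self[OF fY] Cauchy_self[OF fX]]
        linear_add[OF bounded_linear.linear[OF f]]
      by (rule refl)
    show "completion_map f (scaleR r z) = scaleR r (completion_map f z)"
      unfolding scaleC_of_real[symmetric] by (rule completion_map_scaleC[OF f fc])
    show "norm (completion_map f z) \<le> norm z * K"
      unfolding X(2) completion_map_abs[OF f X(1)]
    proof (rule LIMSEQ_le[OF norm_abs_completion[OF fX]])
      show "(\<lambda>n. norm (X n) * K) \<longlonglongrightarrow> norm (abs_completion X) * K"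
        by (rule tendsto_mult_right[OF norm_abs_completion[OF X(1)]])
    qed (use K in blast)
  qed
qed


section \<open>The algebraic inductive limit of the matrix algebras\<close>

text \<open>
  An element \<open>x\<close> of the \<open>k\<close>-fold tensor power of the 4x4 matrices is a matrix of size
  \<open>4 ^ k\<close>, with row index \<open>i\<close> read in base 4: the rightmost tensor factor corresponds to the
  least significant digit. Identifying \<open>x\<close> with \<open>I \<otimes> x\<close> for every number of additional
  factors on the left turns \<open>x\<close> into the block diagonal matrix
  \<open>diag (x, x, x, \<dots>)\<close> with index set \<open>nat\<close>. All inclusions of the tower thus become set
  inclusions between sets of such matrices.
\<close>

definition at_level :: "nat \<Rightarrow> (nat \<Rightarrow> nat \<Rightarrow> complex) \<Rightarrow> bool" where
  "at_level k X \<longleftrightarrow> (\<forall>i j. X i j =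
     (if i div 4 ^ k = j div 4 ^ k then X (i mod 4 ^ k) (j mod 4 ^ k) else 0))"

lemma at_levelD: "at_level k X \<Longrightarrow> X i j =
     (if i div 4 ^ k = j div 4 ^ k then X (i mod 4 ^ k) (j mod 4 ^ k) else 0)"
  unfolding at_level_def by blast

lemma at_level_mono:
  assumes X: "at_level k X" and kl: "k \<le> l" shows "at_level l X"
  unfolding at_level_def
proof (intro allI)
  fix i j :: nat
  define n m :: nat where "n = 4 ^ k" and "m = 4 ^ (l - k)"
  have l: "4 ^ l = n * m" using kl by (simp add: n_def m_def flip: power_add)
  have n: "n > 0" by (simp add: n_def)
  have r: "i mod (n * m) div n = i div n mod m" "i mod (n * m) mod n = i mod n" for i
    using n by (simp_all add: mod_mult2_eq)
  have X: "X i j = (if i div n = j div n then X (i mod n) (j mod n) else 0)" for i j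
    unfolding n_def by (rule at_levelD[OF X])
  show "X i j = (if i div 4 ^ l = j div 4 ^ l then X (i mod 4 ^ l) (j mod 4 ^ l) else 0)"
  proof (cases "i div n = j div n")
    case True
    then show ?thesis
      unfolding l X[of "i mod (n * m)" "j mod (n * m)"] X[of i j] r
      by (simp add: div_mult2_eq)
  next
    case False
    then have "i div n mod m \<noteq> j div n mod m" if "i div n div m = j div n div m"
      using that by (metis div_mult_mod_eq)
    with False show ?thesis
      unfolding l X[of "i mod (n * m)" "j mod (n * m)"] X[of i j] r
      by (simp add: div_mult2_eq)
  qed
qed

lemma at_level_ext:
  assumes "at_level k X" "at_level k Y"
    and "\<And>i j. i < 4 ^ k \<Longrightarrow> j < 4 ^ k \<Longrightarrow> X i j = Y i j"
  shows "X = Y"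
proof (intro ext)
  fix i j
  show "X i j = Y i j"
    unfolding at_levelD[OF assms(1), of i j] at_levelD[OF assms(2), of i j]
    by (simp add: assms(3))
qed

typedef local_alg = "{X. \<exists>k. at_level k X}" morphisms entry Abs_local_alg
  by (rule exI[of _ "\<lambda>_ _. 0"]) (simp add: at_level_def)

setup_lifting type_definition_local_alg

lemma at_level2:
  assumes "\<exists>k. at_level k X" "\<exists>k. at_level k Y"
  obtains k where "at_level k X" "at_level k Y"
proof -
  obtain k l where "at_level k X" "at_level l Y" using assms by blast
  then show ?thesis
    by (intro that[of "max k l"]; elim at_level_mono) simp_all
qed

lemma at_level3:
  assumes "\<exists>k. at_level k X" "\<exists>k. at_level k Y" "\<exists>k. at_level k Z"
  obtains k where "at_level k X" "at_level k Y" "at_level k Z"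
proof -
  obtain k l where "at_level k X" "at_level k Y" "at_level l Z"
    using at_level2[OF assms(1,2)] assms(3) by blast
  then show ?thesis
    by (intro that[of "max k l"]; elim at_level_mono) simp_all
qed

(* For X at some level, the index set of the sum is finite. *)
definition matmul :: "(nat \<Rightarrow> nat \<Rightarrow> complex) \<Rightarrow> (nat \<Rightarrow> nat \<Rightarrow> complex) \<Rightarrow> nat \<Rightarrow> nat \<Rightarrow> complex"
  where "matmul X Y i j = (\<Sum>l | X i l \<noteq> 0. X i l * Y l j)"

lemma matmul_eq:
  assumes X: "at_level k X" and Y: "at_level k Y"
  shows "matmul X Y i j = (if i div 4 ^ k = j div 4 ^ k
    then \<Sum>r<4 ^ k. X (i mod 4 ^ k) r * Y r (j mod 4 ^ k) else 0)"
proof -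
  define n :: nat where "n = 4 ^ k"
  have n: "n > 0" by (simp add: n_def)
  have X: "X i j = (if i div n = j div n then X (i mod n) (j mod n) else 0)" for i j
    unfolding n_def by (rule at_levelD[OF X])
  have Y: "Y i j = (if i div n = j div n then Y (i mod n) (j mod n) else 0)" for i j
    unfolding n_def by (rule at_levelD[OF Y])
  define S where "S = (\<lambda>r. n * (i div n) + r) ` {..<n}"
  have sub: "{l. X i l \<noteq> 0} \<subseteq> S"
  proof
    fix l assume "l \<in> {l. X i l \<noteq> 0}"
    then have "i div n = l div n" using X[of i l] by (auto split: if_splits)
    then have "l = n * (i div n) + l mod n" by simp
    then show "l \<in> S" unfolding S_def using n by (metis imageI lessThan_iff mod_less_divisor)
  qed
  have "matmul X Y i j = (\<Sum>l\<in>S. X i l * Y l j)"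
    unfolding matmul_def by (rule sum.mono_neutral_left) (use sub in \<open>auto simp: S_def\<close>)
  also have "\<dots> = (\<Sum>r<n. X i (n * (i div n) + r) * Y (n * (i div n) + r) j)"
    unfolding S_def by (subst sum.reindex) (auto simp: inj_on_def)
  also have "\<dots> = (\<Sum>r<n. if i div n = j div n then X (i mod n) r * Y r (j mod n) else 0)"
  proof (rule sum.cong[OF refl])
    fix r assume "r \<in> {..<n}"
    then have "(n * (i div n) + r) div n = i div n" "(n * (i div n) + r) mod n = r"
      using n by simp_all
    then show "X i (n * (i div n) + r) * Y (n * (i div n) + r) j
        = (if i div n = j div n then X (i mod n) r * Y r (j mod n) else 0)"
      using X[of i "n * (i div n) + r"] Y[of "n * (i div n) + r" j] by simp
  qed
  finally show ?thesis by (simp add: n_def)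
qed

lemma matmul_less:
  "at_level k X \<Longrightarrow> at_level k Y \<Longrightarrow> i < 4 ^ k \<Longrightarrow> j < 4 ^ k \<Longrightarrow>
   matmul X Y i j = (\<Sum>r<4 ^ k. X i r * Y r j)"
  by (simp add: matmul_eq)

lemma at_level_matmul: "at_level k X \<Longrightarrow> at_level k Y \<Longrightarrow> at_level k (matmul X Y)"
  unfolding at_level_def[of k "matmul X Y"] by (simp add: matmul_eq)

lemma at_level_lin:
  shows "at_level k X \<Longrightarrow> at_level k Y \<Longrightarrow> at_level k (\<lambda>i j. X i j + Y i j)"
    and "at_level k X \<Longrightarrow> at_level k (\<lambda>i j. - X i j)"
    and "at_level k X \<Longrightarrow> at_level k (\<lambda>i j. c * X i j)"
    and "at_level k X \<Longrightarrow> at_level k (\<lambda>i j. cnj (X j i))"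
    and "at_level k (\<lambda>i j. 0)"
proof -
  assume X: "at_level k X"
  show "at_level k (\<lambda>i j. - X i j)" "at_level k (\<lambda>i j. c * X i j)"
    unfolding at_level_def by (intro allI, subst at_levelD[OF X], simp)+
  show "at_level k (\<lambda>i j. cnj (X j i))"
    unfolding at_level_def by (intro allI, subst at_levelD[OF X], simp)
  assume Y: "at_level k Y"
  show "at_level k (\<lambda>i j. X i j + Y i j)"
    unfolding at_level_def
    by (intro allI, subst at_levelD[OF X], subst at_levelD[OF Y], simp)
qed (simp add: at_level_def)

lemma at_level_one: "at_level k (\<lambda>i j. if i = j then 1 else 0)"
  unfolding at_level_def
proof (intro allI)
  fix i j :: nat
  have "i = j \<longleftrightarrow> i div 4 ^ k = j div 4 ^ k \<and> i mod 4 ^ k = j mod 4 ^ k"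
    by (metis div_mult_mod_eq)
  then show "(if i = j then 1 else 0) = (if i div 4 ^ k = j div 4 ^ k
      then if i mod 4 ^ k = j mod 4 ^ k then 1 else 0 else (0 :: complex))"
    by simp
qed

instantiation local_alg :: ring_1
begin

lift_definition zero_local_alg :: local_alg is "\<lambda>_ _. 0"
  by (rule exI[of _ 0], rule at_level_lin(5))

lift_definition one_local_alg :: local_alg is "\<lambda>i j. if i = j then 1 else 0"
  by (rule exI[of _ 0], rule at_level_one)

lift_definition plus_local_alg :: "local_alg \<Rightarrow> local_alg \<Rightarrow> local_alg"
  is "\<lambda>X Y i j. X i j + Y i j"
  by (erule at_level2, assumption, rule exI, rule at_level_lin(1))

lift_definition uminus_local_alg :: "local_alg \<Rightarrow> local_alg" is "\<lambda>X i j. - X i j"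
  by (elim exE, rule exI, rule at_level_lin(2))

definition minus_local_alg :: "local_alg \<Rightarrow> local_alg \<Rightarrow> local_alg"
  where "minus_local_alg x y = x + - y"

lift_definition times_local_alg :: "local_alg \<Rightarrow> local_alg \<Rightarrow> local_alg" is matmul
  by (erule at_level2, assumption, rule exI, rule at_level_matmul)

instance
proof
  fix x y z :: local_alg
  show "x + y + z = x + (y + z)" by transfer (simp add: add.assoc)
  show "x + y = y + x" by transfer (simp add: add.commute)
  show "0 + x = x" by transfer simp
  show "- x + x = 0" by transfer simp
  show "x - y = x + - y" by (rule minus_local_alg_def)
  show "(0 :: local_alg) \<noteq> 1" by transfer (auto simp: fun_eq_iff)
  show "x * y * z = x * (y * z)"
  proof transfer
    fix X Y Z assume "\<exists>k. at_level k X" "\<exists>k. at_level k Y" "\<exists>k. at_level k Z"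
    then obtain k where k: "at_level k X" "at_level k Y" "at_level k Z" by (rule at_level3)
    note XY = at_level_matmul[OF k(1,2)] and YZ = at_level_matmul[OF k(2,3)]
    show "matmul (matmul X Y) Z = matmul X (matmul Y Z)"
    proof (rule at_level_ext)
      show "at_level k (matmul (matmul X Y) Z)" by (rule at_level_matmul[OF XY k(3)])
      show "at_level k (matmul X (matmul Y Z))" by (rule at_level_matmul[OF k(1) YZ])
      fix i j :: nat assume ij: "i < 4 ^ k" "j < 4 ^ k"
      have "matmul (matmul X Y) Z i j = (\<Sum>s<4 ^ k. \<Sum>r<4 ^ k. X i r * Y r s * Z s j)"
        unfolding matmul_less[OF XY k(3) ij]
        by (intro sum.cong refl) (simp add: matmul_less[OF k(1,2)] ij sum_distrib_right)
      also have "\<dots> = (\<Sum>r<4 ^ k. \<Sum>s<4 ^ k. X i r * Y r s * Z s j)" by (rule sum.swap)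
      also have "\<dots> = matmul X (matmul Y Z) i j"
        unfolding matmul_less[OF k(1) YZ ij]
        by (intro sum.cong refl)
          (simp add: matmul_less[OF k(2,3)] ij sum_distrib_left mult.assoc)
      finally show "matmul (matmul X Y) Z i j = matmul X (matmul Y Z) i j" .
    qed
  qed
  show "1 * x = x"
  proof transfer
    fix X assume "\<exists>k. at_level k X"
    then obtain k where k: "at_level k X" by blast
    show "matmul (\<lambda>i j. if i = j then 1 else 0) X = X"
      by (rule at_level_ext[OF at_level_matmul[OF at_level_one k] k])
        (simp add: matmul_less[OF at_level_one k] mult_if_delta)
  qed
  show "x * 1 = x"
  proof transfer
    fix X assume "\<exists>k. at_level k X"
    then obtain k where k: "at_level k X" by blast
    have d: "(a :: complex) * (if P then 1 else 0) = (if P then a else 0)" for a P by simp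
    show "matmul X (\<lambda>i j. if i = j then 1 else 0) = X"
      by (rule at_level_ext[OF at_level_matmul[OF k at_level_one] k])
        (simp add: matmul_less[OF k at_level_one] d)
  qed
  show "(x + y) * z = x * z + y * z"
  proof transfer
    fix X Y Z assume "\<exists>k. at_level k X" "\<exists>k. at_level k Y" "\<exists>k. at_level k Z"
    then obtain k where k: "at_level k X" "at_level k Y" "at_level k Z" by (rule at_level3)
    note XY = at_level_lin(1)[OF k(1,2)]
    show "matmul (\<lambda>i j. X i j + Y i j) Z = (\<lambda>i j. matmul X Z i j + matmul Y Z i j)"
      by (rule at_level_ext[OF at_level_matmul[OF XY k(3)]
            at_level_lin(1)[OF at_level_matmul[OF k(1,3)] at_level_matmul[OF k(2,3)]]])
        (simp add: matmul_less[OF XY k(3)] matmul_less[OF k(1,3)] matmul_less[OF k(2,3)]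
          distrib_right sum.distrib)
  qed
  show "x * (y + z) = x * y + x * z"
  proof transfer
    fix X Y Z assume "\<exists>k. at_level k X" "\<exists>k. at_level k Y" "\<exists>k. at_level k Z"
    then obtain k where k: "at_level k X" "at_level k Y" "at_level k Z" by (rule at_level3)
    note YZ = at_level_lin(1)[OF k(2,3)]
    show "matmul X (\<lambda>i j. Y i j + Z i j) = (\<lambda>i j. matmul X Y i j + matmul X Z i j)"
      by (rule at_level_ext[OF at_level_matmul[OF k(1) YZ]
            at_level_lin(1)[OF at_level_matmul[OF k(1,2)] at_level_matmul[OF k(1,3)]]])
        (simp add: matmul_less[OF k(1) YZ] matmul_less[OF k(1,2)] matmul_less[OF k(1,3)]
          distrib_left sum.distrib)
  qed
qed

end

lift_definition star :: "local_alg \<Rightarrow> local_alg" is "\<lambda>X i j. cnj (X j i)"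
  by (elim exE, rule exI, rule at_level_lin(4))

definition level_trace :: "nat \<Rightarrow> (nat \<Rightarrow> nat \<Rightarrow> complex) \<Rightarrow> complex"
  where "level_trace k X = (\<Sum>i<4 ^ k. X i i) / 4 ^ k"

text \<open>The normalized trace, computed at any level of the tower that contains the element.\<close>

lift_definition ntrace :: "local_alg \<Rightarrow> complex"
  is "\<lambda>X. level_trace (LEAST k. at_level k X) X" .

lemma level_trace_mono:
  assumes X: "at_level k X" and kl: "k \<le> l"
  shows "level_trace l X = level_trace k X"
proof -
  define n m :: nat where "n = 4 ^ k" and "m = 4 ^ (l - k)"
  have l: "4 ^ l = m * n" using kl by (simp add: n_def m_def flip: power_add)
  have n: "n > 0" "m > 0" by (simp_all add: n_def m_def)
  have "(\<Sum>i<m * n. X i i) = (\<Sum>q<m. \<Sum>i = q * n..<q * n + n. X i i)"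
    by (rule sum.nat_group[symmetric])
  also have "\<dots> = (\<Sum>q<m. \<Sum>i<n. X i i)"
  proof (rule sum.cong[OF refl])
    fix q
    have "(\<Sum>i = q * n..<q * n + n. X i i) = (\<Sum>i = 0..<n. X (i + q * n) (i + q * n))"
      using sum.shift_bounds_nat_ivl[of "\<lambda>i. X i i" 0 "q * n" n] by (simp add: add.commute)
    also have "\<dots> = (\<Sum>i<n. X i i)"
      unfolding lessThan_atLeast0
      by (rule sum.cong[OF refl], subst at_levelD[OF X]) (simp add: n_def)
    finally show "(\<Sum>i = q * n..<q * n + n. X i i) = (\<Sum>i<n. X i i)" .
  qed
  finally have "(\<Sum>i<4 ^ l. X i i) = of_nat m * (\<Sum>i<n. X i i)" by (simp add: l)
  moreover have "(4 :: complex) ^ l = of_nat m * of_nat n"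
    using l by (metis of_nat_mult of_nat_numeral of_nat_power)
  moreover have "(4 :: complex) ^ k = of_nat n" by (simp add: n_def)
  ultimately show ?thesis using n by (simp add: level_trace_def n_def[symmetric])
qed

lemma ntrace_eq: "at_level k (entry x) \<Longrightarrow> ntrace x = level_trace k (entry x)"
  unfolding ntrace.rep_eq by (rule level_trace_mono[symmetric]) (rule LeastI, assumption, rule Least_le)

lemma entry_level: "\<exists>k. at_level k (entry x)"
  using entry by simp

lemma ntrace_star_times:
  assumes "at_level k (entry x)" "at_level k (entry y)"
  shows "ntrace (star y * x) = (\<Sum>i<4 ^ k. \<Sum>r<4 ^ k. entry x r i * cnj (entry y r i)) / 4 ^ k"
proof -
  have y: "at_level k (entry (star y))"
    using at_level_lin(4)[OF assms(2)] by (simp add: star.rep_eq)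
  have "at_level k (entry (star y * x))"
    by (simp add: times_local_alg.rep_eq at_level_matmul y assms)
  then show ?thesis
    unfolding ntrace_eq[OF \<open>at_level k (entry (star y * x))\<close>] level_trace_def times_local_alg.rep_eq
    by (simp add: matmul_less[OF y assms(1)]) (simp add: star.rep_eq mult.commute)
qed
instantiation local_alg :: complex_inner
begin

lift_definition scaleC_local_alg :: "complex \<Rightarrow> local_alg \<Rightarrow> local_alg" is "\<lambda>c X i j. c * X i j"
  by (elim exE, rule exI, rule at_level_lin(3))

definition scaleR_local_alg :: "real \<Rightarrow> local_alg \<Rightarrow> local_alg"
  where "scaleR_local_alg r x = scaleC (complex_of_real r) x"

definition cinner_local_alg :: "local_alg \<Rightarrow> local_alg \<Rightarrow> complex"
  where "cinner_local_alg x y = ntrace (star y * x)"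

definition inner_local_alg :: "local_alg \<Rightarrow> local_alg \<Rightarrow> real"
  where "inner_local_alg x y = Re (cinner x y)"

definition norm_local_alg :: "local_alg \<Rightarrow> real"
  where "norm_local_alg x = sqrt (inner x x)"

definition dist_local_alg :: "local_alg \<Rightarrow> local_alg \<Rightarrow> real"
  where "dist_local_alg x y = norm (x - y)"

definition sgn_local_alg :: "local_alg \<Rightarrow> local_alg"
  where "sgn_local_alg x = scaleR (inverse (norm x)) x"

definition uniformity_local_alg :: "(local_alg \<times> local_alg) filter"
  where "uniformity_local_alg = (INF e\<in>{0<..}. principal {(x, y). dist x y < e})"

definition open_local_alg :: "local_alg set \<Rightarrow> bool"
  where "open_local_alg U \<longleftrightarrow>
    (\<forall>x\<in>U. eventually (\<lambda>(x', y). x' = x \<longrightarrow> y \<in> U) uniformity)"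

instance
proof
  fix x y z :: local_alg and c d :: complex and r s :: real
  show 1: "scaleC c (x + y) = scaleC c x + scaleC c y" for c and x y :: local_alg
    by transfer (simp add: distrib_left)
  show 2: "scaleC (c + d) x = scaleC c x + scaleC d x" for c d and x :: local_alg
    by transfer (simp add: distrib_right)
  show 3: "scaleC c (scaleC d x) = scaleC (c * d) x" for c d and x :: local_alg
    by transfer (simp add: mult.assoc)
  show "scaleC (complex_of_real r) x = scaleR r x" by (simp add: scaleR_local_alg_def)
  show "scaleR r (x + y) = scaleR r x + scaleR r y" by (simp add: scaleR_local_alg_def 1)
  show "scaleR (r + s) x = scaleR r x + scaleR s x" by (simp add: scaleR_local_alg_def 2)
  show "scaleR r (scaleR s x) = scaleR (r * s) x" by (simp add: scaleR_local_alg_def 3)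
  show "scaleR 1 x = x" unfolding scaleR_local_alg_def of_real_1 by transfer simp
  have cinner: "cinner x y = (\<Sum>i<4 ^ k. \<Sum>r<4 ^ k. entry x r i * cnj (entry y r i)) / 4 ^ k"
    if "at_level k (entry x)" "at_level k (entry y)" for k and x y :: local_alg
    using ntrace_star_times[OF that] by (simp add: cinner_local_alg_def)
  show comm: "cinner x y = cnj (cinner y x)" for x y :: local_alg
  proof -
    obtain k where k: "at_level k (entry x)" "at_level k (entry y)"
      by (rule at_level2[OF entry_level entry_level])
    show ?thesis unfolding cinner[OF k] cinner[OF k(2,1)] by (simp add: mult.commute)
  qed
  show cadd: "cinner (x + y) z = cinner x z + cinner y z" for x y z :: local_alg
  proof -
    obtain k where k: "at_level k (entry x)" "at_level k (entry y)" "at_level k (entry z)"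
      by (rule at_level3[OF entry_level entry_level entry_level])
    have k': "at_level k (entry (x + y))"
      using k(1,2) by (simp add: plus_local_alg.rep_eq at_level_lin(1))
    show ?thesis
      unfolding cinner[OF k' k(3)] cinner[OF k(1,3)] cinner[OF k(2,3)]
      by (simp add: plus_local_alg.rep_eq distrib_right sum.distrib add_divide_distrib)
  qed
  show cscale: "cinner (scaleC c x) y = c * cinner x y" for c and x y :: local_alg
  proof -
    obtain k where k: "at_level k (entry x)" "at_level k (entry y)"
      by (rule at_level2[OF entry_level entry_level])
    have k': "at_level k (entry (scaleC c x))"
      using k(1) by (simp add: scaleC_local_alg.rep_eq at_level_lin(3))
    show ?thesis
      unfolding cinner[OF k' k(2)] cinner[OF k]
      by (simp add: scaleC_local_alg.rep_eq mult.assoc sum_distrib_left)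
  qed
  show "Re (cinner x y) = inner x y" by (simp add: inner_local_alg_def)
  show "inner x y = inner y x" using comm[of x y] by (simp add: inner_local_alg_def)
  show "inner (x + y) z = inner x z + inner y z" by (simp add: inner_local_alg_def cadd)
  show "inner (scaleR r x) y = r * inner x y"
    by (simp add: inner_local_alg_def scaleR_local_alg_def cscale)
  obtain k where k: "at_level k (entry x)" using entry_level by blast
  have "cinner x x
      = complex_of_real ((\<Sum>i<4 ^ k. \<Sum>r<4 ^ k. (cmod (entry x r i))\<^sup>2) / 4 ^ k)"
    unfolding cinner[OF k k] by (simp add: complex_norm_square del: of_real_power) simp
  then have inner: "inner x x = (\<Sum>i<4 ^ k. \<Sum>r<4 ^ k. (cmod (entry x r i))\<^sup>2) / 4 ^ k"
    unfolding inner_local_alg_def by (metis Re_complex_of_real)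
  then show "0 \<le> inner x x" by (simp add: sum_nonneg)
  show "inner x x = 0 \<longleftrightarrow> x = 0"
  proof
    assume "x = 0"
    then show "inner x x = 0" unfolding inner by (simp add: zero_local_alg.rep_eq)
  next
    assume "inner x x = 0"
    then have "entry x r i = 0" if "r < 4 ^ k" "i < 4 ^ k" for r i
      using that by (simp add: inner sum_nonneg_eq_0_iff sum_nonneg)
    then have "entry x = (\<lambda>_ _. 0)"
      by (intro at_level_ext[OF k at_level_lin(5)]) simp
    then show "x = 0" by (simp add: entry_inject[symmetric] zero_local_alg.rep_eq)
  qed
qed (fact norm_local_alg_def dist_local_alg_def sgn_local_alg_def
    uniformity_local_alg_def open_local_alg_def)+

end


lemma norm_local_alg_eq:
  assumes "at_level k (entry x)"
  shows "(norm x)\<^sup>2 = (\<Sum>i<4 ^ k. \<Sum>r<4 ^ k. (cmod (entry x r i))\<^sup>2) / 4 ^ k"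
proof -
  have "complex_of_real ((norm x)\<^sup>2)
      = complex_of_real ((\<Sum>i<4 ^ k. \<Sum>r<4 ^ k. (cmod (entry x r i))\<^sup>2) / 4 ^ k)"
    unfolding cinner_self[symmetric] cinner_local_alg_def ntrace_star_times[OF assms assms]
    by (simp add: complex_norm_square del: of_real_power) simp
  then show ?thesis by (simp only: of_real_eq_iff)
qed

lemma row_sum_le:
  assumes X: "at_level k X"
  shows "(\<Sum>r<N. cmod (X i r)) \<le> (\<Sum>p<4 ^ k. \<Sum>q<4 ^ k. cmod (X p q))"
proof -
  define n :: nat where "n = 4 ^ k"
  have n: "n > 0" by (simp add: n_def)
  have X: "X i j = (if i div n = j div n then X (i mod n) (j mod n) else 0)" for i j
    unfolding n_def by (rule at_levelD[OF X])
  define S where "S = {r. r < N \<and> i div n = r div n}"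
  have "(\<Sum>r<N. cmod (X i r)) = (\<Sum>r\<in>S. cmod (X i r))"
  proof (rule sum.mono_neutral_right)
    show "\<forall>r\<in>{..<N} - S. cmod (X i r) = 0" using X[of i] by (auto simp: S_def)
  qed (auto simp: S_def)
  also have "\<dots> = (\<Sum>r\<in>S. cmod (X (i mod n) (r mod n)))"
    by (rule sum.cong[OF refl], subst X) (simp add: S_def)
  also have "\<dots> = (\<Sum>q\<in>(\<lambda>r. r mod n) ` S. cmod (X (i mod n) q))"
  proof -
    have "inj_on (\<lambda>r. r mod n) S"
      by (rule inj_onI) (metis (mono_tags, lifting) S_def div_mult_mod_eq mem_Collect_eq)
    then show ?thesis by (simp add: sum.reindex)
  qed
  also have "\<dots> \<le> (\<Sum>q<n. cmod (X (i mod n) q))"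
    by (rule sum_mono2) (use n in auto)
  also have "\<dots> \<le> (\<Sum>p<n. \<Sum>q<n. cmod (X p q))"
    by (rule member_le_sum[of "i mod n" "{..<n}" "\<lambda>p. \<Sum>q<n. cmod (X p q)"])
      (use n in \<open>auto intro: sum_nonneg\<close>)
  finally show ?thesis by (simp add: n_def)
qed

lemma col_sum_le:
  assumes X: "at_level k X"
  shows "(\<Sum>i<N. cmod (X i r)) \<le> (\<Sum>p<4 ^ k. \<Sum>q<4 ^ k. cmod (X p q))"
proof -
  have "(\<Sum>i<N. cmod (X i r)) \<le> (\<Sum>p<4 ^ k. \<Sum>q<4 ^ k. cmod (X q p))"
    using row_sum_le[OF at_level_lin(4)[OF X], where N = N and i = r] by simp
  also have "\<dots> = (\<Sum>q<4 ^ k. \<Sum>p<4 ^ k. cmod (X q p))" by (rule sum.swap)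
  finally show ?thesis .
qed

lemma norm_mult_local_alg: "\<exists>K. \<forall>x. norm (a * x) \<le> norm x * K" for a :: local_alg
proof -
  obtain k\<^sub>0 where k\<^sub>0: "at_level k\<^sub>0 (entry a)" using entry_level by blast
  define C where "C = (\<Sum>p<4 ^ k\<^sub>0. \<Sum>q<4 ^ k\<^sub>0. cmod (entry a p q))"
  have C: "C \<ge> 0" unfolding C_def by (intro sum_nonneg) simp
  have "norm (a * x) \<le> norm x * C" for x
  proof -
    obtain k where k: "at_level k (entry a)" "at_level k (entry x)"
      by (rule at_level2[OF entry_level entry_level])
    define N :: nat where "N = 4 ^ k"
    have ax: "at_level k (entry (a * x))"
      using at_level_matmul[OF k] by (simp add: times_local_alg.rep_eq)
    have entry_le: "(cmod (entry (a * x) i j))\<^sup>2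
        \<le> C * (\<Sum>r<N. cmod (entry a i r) * (cmod (entry x r j))\<^sup>2)" if "i < N" "j < N" for i j
    proof -
      let ?a = "\<lambda>r. cmod (entry a i r)" and ?x = "\<lambda>r. cmod (entry x r j)"
      have "cmod (entry (a * x) i j) = cmod (\<Sum>r<N. entry a i r * entry x r j)"
        using that matmul_less[OF k] by (simp add: times_local_alg.rep_eq N_def)
      also have "\<dots> \<le> (\<Sum>r<N. sqrt (?a r) * (sqrt (?a r) * ?x r))"
        by (rule sum_norm_le) (simp add: norm_mult flip: mult.assoc)
      finally have "(cmod (entry (a * x) i j))\<^sup>2
          \<le> (\<Sum>r<N. sqrt (?a r) * (sqrt (?a r) * ?x r))\<^sup>2"
        by (rule power_mono) simp
      also have "\<dots> \<le> (\<Sum>r<N. (sqrt (?a r))\<^sup>2) * (\<Sum>r<N. (sqrt (?a r) * ?x r)\<^sup>2)"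
        by (rule Cauchy_Schwarz_ineq_sum)
      also have "\<dots> = (\<Sum>r<N. ?a r) * (\<Sum>r<N. ?a r * (?x r)\<^sup>2)"
        by (simp add: power_mult_distrib)
      also have "\<dots> \<le> C * (\<Sum>r<N. ?a r * (?x r)\<^sup>2)"
        unfolding C_def
        by (intro mult_right_mono row_sum_le[OF k\<^sub>0] sum_nonneg) simp
      finally show ?thesis .
    qed
    have "(\<Sum>j<N. \<Sum>i<N. (cmod (entry (a * x) i j))\<^sup>2)
        \<le> (\<Sum>j<N. \<Sum>i<N. C * (\<Sum>r<N. cmod (entry a i r) * (cmod (entry x r j))\<^sup>2))"
      by (intro sum_mono entry_le) auto
    also have "\<dots> = (\<Sum>j<N. C * (\<Sum>r<N. (\<Sum>i<N. cmod (entry a i r)) * (cmod (entry x r j))\<^sup>2))"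
    proof (rule sum.cong[OF refl])
      fix j
      have "(\<Sum>i<N. \<Sum>r<N. cmod (entry a i r) * (cmod (entry x r j))\<^sup>2)
          = (\<Sum>r<N. \<Sum>i<N. cmod (entry a i r) * (cmod (entry x r j))\<^sup>2)" by (rule sum.swap)
      then show "(\<Sum>i<N. C * (\<Sum>r<N. cmod (entry a i r) * (cmod (entry x r j))\<^sup>2))
          = C * (\<Sum>r<N. (\<Sum>i<N. cmod (entry a i r)) * (cmod (entry x r j))\<^sup>2)"
        by (simp add: sum_distrib_right flip: sum_distrib_left)
    qed
    also have "\<dots> \<le> (\<Sum>j<N. C * (\<Sum>r<N. C * (cmod (entry x r j))\<^sup>2))"
      unfolding C_def
      by (intro sum_mono mult_left_mono mult_right_mono col_sum_le[OF k\<^sub>0]) (auto intro!: sum_nonneg)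
    also have "\<dots> = C\<^sup>2 * (\<Sum>j<N. \<Sum>r<N. (cmod (entry x r j))\<^sup>2)"
      by (simp add: power2_eq_square mult.assoc flip: sum_distrib_left)
    finally have "(norm (a * x))\<^sup>2 \<le> C\<^sup>2 * (norm x)\<^sup>2"
      unfolding norm_local_alg_eq[OF ax] norm_local_alg_eq[OF k(2)] N_def
      by (simp add: divide_right_mono)
    then have "(norm (a * x))\<^sup>2 \<le> (norm x * C)\<^sup>2" by (simp add: power_mult_distrib mult.commute)
    then show ?thesis by (rule power2_le_imp_le) (simp add: C)
  qed
  then show ?thesis by blast
qed

lemma mult_scaleC_right: "a * scaleC c x = scaleC c (a * x)" for a x :: local_alg
proof transfer
  fix A X c assume "\<exists>k. at_level k A" "\<exists>k. at_level k X"
  then obtain k where k: "at_level k A" "at_level k X" by (rule at_level2)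
  note cX = at_level_lin(3)[OF k(2), of c]
  show "matmul A (\<lambda>i j. c * X i j) = (\<lambda>i j. c * matmul A X i j)"
    by (rule at_level_ext[OF at_level_matmul[OF k(1) cX] at_level_lin(3)[OF at_level_matmul[OF k]]])
      (simp add: matmul_less[OF k(1) cX] matmul_less[OF k] sum_distrib_left mult.left_commute)
qed

lemma bounded_linear_mult_local_alg: "bounded_linear (\<lambda>x. a * x)" for a :: local_alg
proof -
  obtain K where "\<And>x. norm (a * x) \<le> norm x * K" using norm_mult_local_alg by blast
  then show ?thesis
    by (rule bounded_linear_intro[rotated 2])
      (simp_all add: distrib_left mult_scaleC_right flip: scaleC_of_real)
qed


lemma star_one: "star 1 = 1" by transfer (auto simp: fun_eq_iff)


section \<open>The GNS representation of the normalized trace\<close>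

text \<open>
  The inner product of \<open>local_alg\<close> is \<open>ntrace (star y * x)\<close>, so the GNS Hilbert space of the
  normalized trace is its completion; \<open>gns_rep a\<close> extends left multiplication by \<open>a\<close>.
\<close>

type_synonym gns = "local_alg completion"
type_synonym gns_op = "gns \<Rightarrow>\<^sub>L gns"

definition gns_rep :: "local_alg \<Rightarrow> gns_op"
  where "gns_rep a = Blinfun (completion_map (\<lambda>x. a * x))"

lemma gns_rep_apply: "blinfun_apply (gns_rep a) = completion_map (\<lambda>x. a * x)"
  unfolding gns_rep_def
  by (rule bounded_linear_Blinfun_apply)
    (rule bounded_linear_completion_map[OF bounded_linear_mult_local_alg mult_scaleC_right])

lemma gns_rep_to_completion: "gns_rep a (to_completion x) = to_completion (a * x)"
  unfolding gns_rep_apply by (rule completion_map_to_completion[OF bounded_linear_mult_local_alg])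

lemma gns_rep_scaleC: "gns_rep a (scaleC c z) = scaleC c (gns_rep a z)"
  unfolding gns_rep_apply
  by (rule completion_map_scaleC[OF bounded_linear_mult_local_alg mult_scaleC_right])

abbreviation gns_vacuum :: gns where "gns_vacuum \<equiv> to_completion 1"

definition gns_trace :: "gns_op \<Rightarrow> complex"
  where "gns_trace T = cinner (T gns_vacuum) gns_vacuum"

lemma gns_trace_gns_rep: "gns_trace (gns_rep a) = ntrace a"
  unfolding gns_trace_def gns_rep_to_completion
  by (simp add: star_one to_completion.abs_eq cinner_completion.abs_eq convergent_Cauchy
      convergent_const cinner_local_alg_def)


section \<open>Von Neumann algebras and the Pimsner-Popa constant\<close>

text \<open>
  Elements of the type \<open>'h \<Rightarrow>\<^sub>L 'h\<close> are only real linear, hence the explicit requirement of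
  complex linearity. For a bounded complex linear operator on a Hilbert space the adjoint exists
  and is unique.
\<close>

definition complex_linear_op :: "('h :: complex_inner \<Rightarrow>\<^sub>L 'h) \<Rightarrow> bool"
  where "complex_linear_op T \<longleftrightarrow> (\<forall>c x. T (scaleC c x) = scaleC c (T x))"

definition op_adjoint :: "('h :: complex_hilbert \<Rightarrow>\<^sub>L 'h) \<Rightarrow> ('h \<Rightarrow>\<^sub>L 'h)"
  where "op_adjoint T = (THE S :: 'h \<Rightarrow>\<^sub>L 'h. \<forall>x y. cinner (T x) y = cinner x (S y))"

definition op_scale :: "complex \<Rightarrow> ('h :: complex_inner \<Rightarrow>\<^sub>L 'h) \<Rightarrow> ('h \<Rightarrow>\<^sub>L 'h)"
  where "op_scale c T = scaleC_op c o\<^sub>L T"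

definition positive_op :: "('h :: complex_inner \<Rightarrow>\<^sub>L 'h) \<Rightarrow> bool"
  where "positive_op T \<longleftrightarrow> (\<forall>x. cinner (T x) x \<in> \<real> \<and> 0 \<le> Re (cinner (T x) x))"

definition von_neumann_algebra :: "('h :: complex_hilbert \<Rightarrow>\<^sub>L 'h) set \<Rightarrow> bool"
  where "von_neumann_algebra N \<longleftrightarrow>
    (\<forall>S\<in>N. complex_linear_op S) \<and>
    id_blinfun \<in> N \<and>
    (\<forall>S\<in>N. \<forall>T\<in>N. S + T \<in> N) \<and>
    (\<forall>c. \<forall>S\<in>N. op_scale c S \<in> N) \<and>
    (\<forall>S\<in>N. \<forall>T\<in>N. S o\<^sub>L T \<in> N) \<and>
    (\<forall>S\<in>N. op_adjoint S \<in> N) \<and>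
    closedin strong_operator_topology N"

definition vn_generated :: "('h :: complex_hilbert \<Rightarrow>\<^sub>L 'h) set \<Rightarrow> ('h \<Rightarrow>\<^sub>L 'h) set"
  where "vn_generated G = \<Inter> {N. von_neumann_algebra N \<and> G \<subseteq> N}"

definition is_cond_exp ::
    "('h :: complex_hilbert \<Rightarrow>\<^sub>L 'h) set \<Rightarrow> (('h \<Rightarrow>\<^sub>L 'h) \<Rightarrow> complex) \<Rightarrow> ('h \<Rightarrow>\<^sub>L 'h) set \<Rightarrow>
      (('h \<Rightarrow>\<^sub>L 'h) \<Rightarrow> ('h \<Rightarrow>\<^sub>L 'h)) \<Rightarrow> bool"
  where "is_cond_exp M \<tau> Q E \<longleftrightarrow>
    (\<forall>x\<in>M. E x \<in> Q) \<and>
    (\<forall>x\<in>M. \<forall>y\<in>M. E (x + y) = E x + E y) \<and>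
    (\<forall>c. \<forall>x\<in>M. E (op_scale c x) = op_scale c (E x)) \<and>
    (\<forall>x\<in>M. positive_op x \<longrightarrow> positive_op (E x)) \<and>
    (\<forall>q\<in>Q. E q = q) \<and>
    (\<forall>p\<in>Q. \<forall>x\<in>M. \<forall>q\<in>Q. E (p o\<^sub>L x o\<^sub>L q) = p o\<^sub>L E x o\<^sub>L q) \<and>
    (\<forall>x\<in>M. \<tau> (E x) = \<tau> x)"

text \<open>
  For a faithful normal trace \<open>\<tau>\<close> on the von Neumann algebra \<open>M\<close> the conditional expectation
  onto a von Neumann subalgebra exists, and its restriction to \<open>M\<close> is unique.
\<close>

definition cond_exp ::
    "('h :: complex_hilbert \<Rightarrow>\<^sub>L 'h) set \<Rightarrow> (('h \<Rightarrow>\<^sub>L 'h) \<Rightarrow> complex) \<Rightarrow> ('h \<Rightarrow>\<^sub>L 'h) set \<Rightarrow>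
      ('h \<Rightarrow>\<^sub>L 'h) \<Rightarrow> ('h \<Rightarrow>\<^sub>L 'h)"
  where "cond_exp M \<tau> Q = (SOME E. is_cond_exp M \<tau> Q E)"

definition pimsner_popa ::
    "('h :: complex_hilbert \<Rightarrow>\<^sub>L 'h) set \<Rightarrow> (('h \<Rightarrow>\<^sub>L 'h) \<Rightarrow> complex) \<Rightarrow>
      ('h \<Rightarrow>\<^sub>L 'h) set \<Rightarrow> ('h \<Rightarrow>\<^sub>L 'h) set \<Rightarrow> real"
  where "pimsner_popa M \<tau> P Q =
    Sup {t. 0 \<le> t \<and> (\<forall>x\<in>P. positive_op x \<longrightarrow> positive_op (cond_exp M \<tau> Q x - t *\<^sub>R x))}"


section \<open>The tower of matrix algebras and its Jones projections\<close>

lift_definition embed :: "nat \<Rightarrow> complex mat \<Rightarrow> local_alg"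
  is "\<lambda>k A i j. if i div 4 ^ k = j div 4 ^ k then A $$ (i mod 4 ^ k, j mod 4 ^ k) else 0"
  subgoal for k A by (rule exI[of _ k]) (simp add: at_level_def)
  done

definition kronecker :: "complex mat \<Rightarrow> complex mat \<Rightarrow> complex mat"
  where "kronecker A B = mat (dim_row A * dim_row B) (dim_col A * dim_col B)
    (\<lambda>(i, j). A $$ (i div dim_row B, j div dim_col B) * B $$ (i mod dim_row B, j mod dim_col B))"

definition matrix_unit :: "nat \<Rightarrow> nat \<Rightarrow> complex mat"
  where "matrix_unit p q = mat 4 4 (\<lambda>(i, j). if i = p \<and> j = q then 1 else 0)"

definition J_mat :: "complex mat"
  where "J_mat = mat 4 4 (\<lambda>_. 1 / 4)"

text \<open>\<open>tower_even k\<close> is \<open>A\<^bsub>2k\<^esub>\<close> and \<open>tower_odd k\<close> is \<open>A\<^bsub>2k-1\<^esub>\<close>, starting with \<open>A\<^bsub>-1\<^esub>\<close>.\<close>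

definition tower_even :: "nat \<Rightarrow> local_alg set"
  where "tower_even k = embed (k + 1) ` carrier_mat (4 ^ (k + 1)) (4 ^ (k + 1))"

definition tower_odd :: "nat \<Rightarrow> local_alg set"
  where "tower_odd k = {(\<Sum>i<4. embed (k + 1) (kronecker (matrix_unit i i) (X i))) | X.
    \<forall>i<4. X i \<in> carrier_mat (4 ^ k) (4 ^ k)}"

definition jones_proj :: "nat \<Rightarrow> local_alg"
  where "jones_proj j = (let k = j div 2 in
    if even j then embed (k + 1) (kronecker J_mat (1\<^sub>m (4 ^ k)))
    else \<Sum>i<4. embed (k + 2) (kronecker (matrix_unit i i) (kronecker (matrix_unit i i) (1\<^sub>m (4 ^ k)))))"

definition hyperfinite_factor :: "gns_op set"
  where "hyperfinite_factor =
    strong_operator_topology closure_of (gns_rep ` (\<Union>k. tower_odd k \<union> tower_even k))"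


section \<open>Spin model subfactors\<close>

definition spin_subfactor :: "complex mat \<Rightarrow> gns_op set"
  where "spin_subfactor u = vn_generated (gns_rep `
    ({embed 1 (u * d * mat_adjoint u) | d. d \<in> carrier_mat 4 4 \<and> diagonal_mat d} \<union>
     {jones_proj j | j. j \<ge> 1}))"

definition hadamard4 :: "complex \<Rightarrow> complex mat"
  where "hadamard4 z = (1 / 2) \<cdot>\<^sub>m mat_of_rows_list 4
    [[1,       1,  1,       1],
     [1,   \<i> * z, -1, - \<i> * z],
     [1,      -1,  1,      -1],
     [1, - \<i> * z, -1,   \<i> * z]]"

end

theory Submission
  imports Defs
begin

text \<open>
  Write \<open>A\<^bsub>2m\<^esub>\<close> for the \<open>m + 1\<close>-fold tensor power of the 4x4 matrices. For a Hadamard matrix \<open>u\<close> with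
  \<open>u (i + 2) j = (-1)^j u i j\<close> the intersection of \<open>A\<^bsub>2m\<^esub>\<close> with the spin model subfactor is \<open>W (\<Delta> \<otimes> M \<otimes> \<dots> \<otimes> M) W\<^sup>*\<close> for an
  explicit unitary \<open>W\<close>. Since \<open>\<Delta>\<close> is the commutant of the diagonal sign matrices
  \<open>(1, -1, 1, -1)\<close> and \<open>(1, 1, -1, -1)\<close>, this is the commutant of two commuting involutions \<open>s\<close>, \<open>g\<close>,
  and its conditional expectation is \<open>x \<mapsto> (x + s x s + g x g + s g x g s) / 4\<close>. These expectations are
  consistent for growing \<open>m\<close> (commuting squares) and converge strongly on the factor.

  The point is that \<open>s\<close> is the tensor power of the shift by 2, hence independent of \<open>u\<close>: for positive
  \<open>x\<close> in \<open>R\<^bsub>u\<^esub>\<close> we have \<open>s x s \<rightarrow> x\<close>, so the expectation onto \<open>R\<^bsub>v\<^esub>\<close> is at least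
  \<open>(x + x) / 4\<close>. Equality of the constant is witnessed by \<open>p = u E\<^bsub>11\<^esub> u\<^sup>*\<close>, whose expectation is
  \<open>(p + g p g) / 2\<close> with \<open>g p g \<noteq> p\<close>.
\<close>

section \<open>Matrices acting on one base-4 digit\<close>

text \<open>The obstacle is that \<open>s\<close> and \<open>g\<close> change with the level, so an
  element of the subfactor commutes with them only asymptotically. All limits are therefore taken at
  the vacuum vector: the factor is realised as the commutant of the right multiplications, an
  element of it is determined by its value at the vacuum, and a norm-bounded sequence in it
  converges strongly as soon as the vacuum vectors converge. The generated subfactor itself is only
  sandwiched: it lies in the commutant of a limit projection and it contains the range of the
  expectation. This is enough to identify the conditional expectation. The strictness of the bound
  is a fact about columns, counted from 0. Column 1 of u(a) has inner products (1 + a cnj b)/2 and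
  (1 - a cnj b)/2 with columns 1 and 3 of u(b), on which the sign matrix defining \<open>g\<close>
  takes opposite values. Hence \<open>p\<close> and \<open>g\<close> commute exactly when a = b or a
  = -b. In the latter case u(a) is u(b) with two columns exchanged and the subfactors coincide; the
  angle range [0, \<pi>) excludes it.\<close>

definition digit :: "nat \<Rightarrow> nat \<Rightarrow> nat"
  where "digit m i = i div 4 ^ m mod 4"

definition set_digit :: "nat \<Rightarrow> nat \<Rightarrow> nat \<Rightarrow> nat"
  where "set_digit m i r = i div 4 ^ Suc m * 4 ^ Suc m + r * 4 ^ m + i mod 4 ^ m"

definition same_other_digits :: "nat \<Rightarrow> nat \<Rightarrow> nat \<Rightarrow> bool"
  where "same_other_digits m i l \<longleftrightarrow> i mod 4 ^ m = l mod 4 ^ m \<and> i div 4 ^ Suc m = l div 4 ^ Suc m"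

lemma digit_less: "digit m i < 4"
  by (simp add: digit_def)

lemma digits_decompose: "i = i div 4 ^ Suc m * 4 ^ Suc m + digit m i * 4 ^ m + i mod 4 ^ m"
proof -
  have "i = i div 4 ^ m * 4 ^ m + i mod 4 ^ m" by (rule div_mult_mod_eq[symmetric])
  also have "i div 4 ^ m = i div 4 ^ m div 4 * 4 + digit m i"
    unfolding digit_def by (rule div_mult_mod_eq[symmetric])
  also have "i div 4 ^ m div 4 = i div 4 ^ Suc m" by (metis div_mult2_eq mult.commute power_Suc)
  finally show ?thesis by (simp add: algebra_simps)
qed

lemma digits_of_sum:
  assumes "r < 4" "s < 4 ^ m"
  shows "(q * 4 ^ Suc m + r * 4 ^ m + s) div 4 ^ Suc m = q"
    and "(q * 4 ^ Suc m + r * 4 ^ m + s) mod 4 ^ m = s"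
    and "digit m (q * 4 ^ Suc m + r * 4 ^ m + s) = r"
    and "(q * 4 ^ Suc m + r * 4 ^ m + s) div 4 ^ m = q * 4 + r"
proof -
  have e: "q * 4 ^ Suc m + r * 4 ^ m + s = s + (q * 4 + r) * 4 ^ m" by (simp add: algebra_simps)
  show d: "(q * 4 ^ Suc m + r * 4 ^ m + s) div 4 ^ m = q * 4 + r"
    unfolding e using assms by (subst div_mult_self1) auto
  show "(q * 4 ^ Suc m + r * 4 ^ m + s) mod 4 ^ m = s"
    unfolding e using assms by simp
  show "digit m (q * 4 ^ Suc m + r * 4 ^ m + s) = r"
    unfolding digit_def d using assms by simp
  have "(q * 4 ^ Suc m + r * 4 ^ m + s) div 4 ^ Suc m = (q * 4 ^ Suc m + r * 4 ^ m + s) div 4 ^ m div 4"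
    by (metis div_mult2_eq mult.commute power_Suc)
  then show "(q * 4 ^ Suc m + r * 4 ^ m + s) div 4 ^ Suc m = q"
    unfolding d using assms by simp
qed

lemma set_digit_simps:
  assumes "r < 4"
  shows "set_digit m i r div 4 ^ Suc m = i div 4 ^ Suc m"
    and "set_digit m i r mod 4 ^ m = i mod 4 ^ m"
    and "digit m (set_digit m i r) = r"
  using digits_of_sum[OF assms, of "i mod 4 ^ m" m "i div 4 ^ Suc m"]
  by (simp_all add: set_digit_def)

lemma same_other_digits_set_digit: "r < 4 \<Longrightarrow> same_other_digits m i (set_digit m i r)"
  using set_digit_simps[of r m i] by (simp add: same_other_digits_def)

lemma same_other_digitsD: "same_other_digits m i l \<Longrightarrow> l = set_digit m i (digit m l)"
  using digits_decompose[of l m] by (simp add: same_other_digits_def set_digit_def)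

lemma same_other_digits_cong: "r < 4 \<Longrightarrow> same_other_digits m (set_digit m i r) l = same_other_digits m i l"
  using set_digit_simps[of r m i] by (simp add: same_other_digits_def)

lemma same_other_digits_sym: "same_other_digits m i l = same_other_digits m l i"
  by (auto simp: same_other_digits_def)

lemma eq_iff_digits: "i = l \<longleftrightarrow> same_other_digits m i l \<and> digit m i = digit m l"
  by (metis digits_decompose same_other_digits_def)

lemma div_power_mono: "i div 4 ^ m = l div (4 :: nat) ^ m \<Longrightarrow> m \<le> n \<Longrightarrow> i div 4 ^ n = l div 4 ^ n"
  by (metis div_mult2_eq le_add_diff_inverse power_add)

lemma mod_power_div: "(i :: nat) mod 4 ^ Suc m div 4 ^ m = digit m i"
proof -
  have "i mod 4 ^ Suc m = 4 ^ m * (i div 4 ^ m mod 4) + i mod 4 ^ m"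
    unfolding power_Suc2 by (rule mod_mult2_eq)
  then show ?thesis by (simp add: digit_def)
qed

lemma div_eq_iff_digit: "i div 4 ^ m = l div 4 ^ m \<longleftrightarrow> i div 4 ^ Suc m = l div 4 ^ Suc m \<and> digit m i = digit m l"
proof -
  have "i div 4 ^ m = i div 4 ^ Suc m * 4 + digit m i" for i
    by (metis digit_def div_mult2_eq mult.commute power_Suc div_mult_mod_eq)
  then show ?thesis by (metis div_power_mono le_SucI order_refl digit_def)
qed

text \<open>\<open>site m f\<close> is \<open>\<dots> \<otimes> I \<otimes> f \<otimes> I \<otimes> \<dots> \<otimes> I\<close> with \<open>m\<close> factors to the right of \<open>f\<close>; only the values
  \<open>f p q\<close> with \<open>p, q < 4\<close> matter.\<close>

lemma digit_mod_power: "digit m (i mod 4 ^ Suc m) = digit m i"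
  by (metis mod_power_div mod_mod_trivial)

lemma at_level_site:
  "at_level (Suc m) (\<lambda>i l. if same_other_digits m i l then f (digit m i) (digit m l) else 0)"
  unfolding at_level_def
  by (auto simp: same_other_digits_def digit_mod_power[unfolded power_Suc] mod_mod_cancel)

lift_definition site :: "nat \<Rightarrow> (nat \<Rightarrow> nat \<Rightarrow> complex) \<Rightarrow> local_alg"
  is "\<lambda>m f i l. if same_other_digits m i l then f (digit m i) (digit m l) else 0"
  by (rule exI, rule at_level_site)

text \<open>The copy of the m-fold tensor power of the 4x4 matrices, on digits 0 to m - 1. So A_2m
  is \<open>level (Suc m)\<close>, and \<open>site m\<close> acts on its leftmost factor.\<close>

definition level :: "nat \<Rightarrow> local_alg set"
  where "level m = {x. at_level m (entry x)}"

lemma level_iff: "x \<in> level m \<longleftrightarrow> at_level m (entry x)"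
  by (simp add: level_def)

lemma level_mono: "x \<in> level m \<Longrightarrow> m \<le> n \<Longrightarrow> x \<in> level n"
  by (auto simp: level_def intro: at_level_mono)

lemma ex_level: "\<exists>m. x \<in> level m"
  using entry_level by (simp add: level_def)

lemma ex_level_Suc: "\<exists>m. x \<in> level (Suc m)"
  using ex_level level_mono by (metis le_SucI order_refl)

lemma level_closed:
  shows level_add: "x \<in> level m \<Longrightarrow> y \<in> level m \<Longrightarrow> x + y \<in> level m"
    and level_mult: "x \<in> level m \<Longrightarrow> y \<in> level m \<Longrightarrow> x * y \<in> level m"
    and level_scaleC: "x \<in> level m \<Longrightarrow> scaleC c x \<in> level m"
    and level_star: "x \<in> level m \<Longrightarrow> star x \<in> level m"
    and level_0: "0 \<in> level m"
  by (simp_all add: level_def plus_local_alg.rep_eq times_local_alg.rep_eq scaleC_local_alg.rep_eq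
      star.rep_eq zero_local_alg.rep_eq at_level_lin at_level_matmul)

lemma level_sum: "(\<And>p. p \<in> A \<Longrightarrow> x p \<in> level m) \<Longrightarrow> (\<Sum>p\<in>A. x p) \<in> level m"
  by (induction A rule: infinite_finite_induct) (auto intro: level_closed)

lemma entry_sum: "entry (\<Sum>p\<in>A. x p) i l = (\<Sum>p\<in>A. entry (x p) i l)"
  by (induction A rule: infinite_finite_induct) (auto simp: zero_local_alg.rep_eq plus_local_alg.rep_eq)

lemma local_alg_eqI: "(\<And>i l. entry x i l = entry y i l) \<Longrightarrow> x = y"
  by (metis entry_inject ext)

lemma site_in_level: "m < n \<Longrightarrow> site m f \<in> level n"
  by (auto simp: level_def site.rep_eq intro: at_level_mono[OF at_level_site])

lemma site_mult_entry:
  "entry (site m f * y) i l = (\<Sum>r<4. f (digit m i) r * entry y (set_digit m i r) l)"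
proof -
  let ?X = "\<lambda>l'. if same_other_digits m i l' then f (digit m i) (digit m l') else 0"
  have inj: "inj_on (set_digit m i) {..<4}"
    by (rule inj_onI) (metis set_digit_simps(3) lessThan_iff)
  have "entry (site m f * y) i l = (\<Sum>l' | ?X l' \<noteq> 0. ?X l' * entry y l' l)"
    unfolding times_local_alg.rep_eq matmul_def site.rep_eq ..
  also have "\<dots> = (\<Sum>l'\<in>set_digit m i ` {..<4}. ?X l' * entry y l' l)"
  proof (rule sum.mono_neutral_left)
    show "{l'. ?X l' \<noteq> 0} \<subseteq> set_digit m i ` {..<4}"
      using same_other_digitsD[of m i] digit_less[of m] by (auto split: if_splits)
  qed auto
  also have "\<dots> = (\<Sum>r<4. f (digit m i) r * entry y (set_digit m i r) l)"
    unfolding sum.reindex[OF inj] o_def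
    by (rule sum.cong[OF refl]) (simp add: same_other_digits_set_digit set_digit_simps)
  finally show ?thesis .
qed

text \<open>The two factors act on disjoint digits, so the product is an elementary tensor and its
  entries are products of entries. Commutation of \<open>site n\<close> with \<open>level m\<close>
  for m \<le> n is read off from this formula and its mirror image.\<close>

lemma site_mult_level_entry:
  assumes x: "x \<in> level m"
  shows "entry (site m f * x) i l = (if i div 4 ^ Suc m = l div 4 ^ Suc m
    then f (digit m i) (digit m l) * entry x (i mod 4 ^ m) (l mod 4 ^ m) else 0)"
proof -
  have *: "entry x (set_digit m i r) l = (if i div 4 ^ Suc m = l div 4 ^ Suc m \<and> r = digit m l
      then entry x (i mod 4 ^ m) (l mod 4 ^ m) else 0)" if "r < 4" for r
  proof -
    have "entry x (set_digit m i r) l = (if set_digit m i r div 4 ^ m = l div 4 ^ m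
        then entry x (set_digit m i r mod 4 ^ m) (l mod 4 ^ m) else 0)"
      using x unfolding level_iff by (rule at_levelD)
    then show ?thesis
      unfolding div_eq_iff_digit[of _ m l] set_digit_simps[OF that] .
  qed
  have "entry (site m f * x) i l = (\<Sum>r<4. if i div 4 ^ Suc m = l div 4 ^ Suc m \<and> r = digit m l
      then f (digit m i) (digit m l) * entry x (i mod 4 ^ m) (l mod 4 ^ m) else 0)"
    unfolding site_mult_entry by (rule sum.cong[OF refl]) (simp add: *)
  also have "\<dots> = (if i div 4 ^ Suc m = l div 4 ^ Suc m
    then f (digit m i) (digit m l) * entry x (i mod 4 ^ m) (l mod 4 ^ m) else 0)"
    using digit_less[of m l] by (cases "i div 4 ^ Suc m = l div 4 ^ Suc m") (simp_all del: power_Suc)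
  finally show ?thesis .
qed

lemma entry_star: "entry (star x) i l = cnj (entry x l i)"
  by (simp add: star.rep_eq)

lemma star_star: "star (star x) = x"
  by (rule local_alg_eqI) (simp add: entry_star)

lemma star_mult: "star (x * y) = star y * star x"
proof -
  obtain k where k: "x \<in> level k" "y \<in> level k"
    by (meson ex_level level_mono linear)
  note l = k level_star[OF k(1)] level_star[OF k(2)]
  have "entry (star (x * y)) = entry (star y * star x)"
  proof (rule at_level_ext)
    show "at_level k (entry (star (x * y)))" "at_level k (entry (star y * star x))"
      using l level_mult level_star by (auto simp flip: level_iff)
    fix i j :: nat assume "i < 4 ^ k" "j < 4 ^ k"
    then show "entry (star (x * y)) i j = entry (star y * star x) i j"
      using l by (simp add: level_iff times_local_alg.rep_eq matmul_less entry_star mult.commute)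
  qed
  then show ?thesis by (simp add: entry_inject)
qed

lemma star_add: "star (x + y) = star x + star y"
  by (rule local_alg_eqI) (simp add: entry_star plus_local_alg.rep_eq)

lemma star_scaleC: "star (scaleC c x) = scaleC (cnj c) (star x)"
  by (rule local_alg_eqI) (simp add: entry_star scaleC_local_alg.rep_eq)

lemma star_minus: "star (- x) = - star x"
  by (rule local_alg_eqI) (simp add: entry_star uminus_local_alg.rep_eq)

lemma star_diff: "star (x - y) = star x - star y"
  using star_add[of x "- y"] by (simp add: star_minus)

definition adj4 :: "(nat \<Rightarrow> nat \<Rightarrow> complex) \<Rightarrow> nat \<Rightarrow> nat \<Rightarrow> complex"
  where "adj4 f p q = cnj (f q p)"

definition mult4 :: "(nat \<Rightarrow> nat \<Rightarrow> complex) \<Rightarrow> (nat \<Rightarrow> nat \<Rightarrow> complex) \<Rightarrow> nat \<Rightarrow> nat \<Rightarrow> complex"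
  where "mult4 f g p q = (\<Sum>r<4. f p r * g r q)"

definition unit4 :: "nat \<Rightarrow> nat \<Rightarrow> nat \<Rightarrow> nat \<Rightarrow> complex"
  where "unit4 p q i j = (if i = p \<and> j = q then 1 else 0)"

definition diag4 :: "(nat \<Rightarrow> complex) \<Rightarrow> nat \<Rightarrow> nat \<Rightarrow> complex"
  where "diag4 c i j = (if i = j then c i else 0)"

lemma adj4_adj4: "adj4 (adj4 f) = f"
  by (intro ext) (simp add: adj4_def)

lemma star_site: "star (site m f) = site m (adj4 f)"
  by (rule local_alg_eqI) (simp add: entry_star site.rep_eq adj4_def same_other_digits_sym)

lemma site_cong: "(\<And>p q. p < 4 \<Longrightarrow> q < 4 \<Longrightarrow> f p q = g p q) \<Longrightarrow> site m f = site m g"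
  by (rule local_alg_eqI) (simp add: site.rep_eq digit_less)

lemma site_mult: "site m f * site m g = site m (mult4 f g)"
proof (rule local_alg_eqI)
  fix i l
  have "entry (site m f * site m g) i l =
      (\<Sum>r<4. if same_other_digits m i l then f (digit m i) r * g r (digit m l) else 0)"
    unfolding site_mult_entry
    by (rule sum.cong[OF refl]) (simp add: site.rep_eq same_other_digits_cong set_digit_simps)
  then show "entry (site m f * site m g) i l = entry (site m (mult4 f g)) i l"
    by (simp add: site.rep_eq mult4_def)
qed

lemma site_one: "site m (diag4 (\<lambda>_. 1)) = 1"
proof (rule local_alg_eqI)
  fix i l
  show "entry (site m (diag4 (\<lambda>_. 1))) i l = entry 1 i l"
    using eq_iff_digits[of i l m] by (simp add: site.rep_eq diag4_def one_local_alg.rep_eq)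
qed

lemma site_scaleC: "scaleC c (site m f) = site m (\<lambda>p q. c * f p q)"
  by (rule local_alg_eqI) (simp add: site.rep_eq scaleC_local_alg.rep_eq)

lemma site_sum: "(\<Sum>r\<in>A. site m (f r)) = site m (\<lambda>p q. \<Sum>r\<in>A. f r p q)"
  by (rule local_alg_eqI) (simp add: site.rep_eq entry_sum)

lemma site_zero: "site m (\<lambda>p q. 0) = 0"
  by (rule local_alg_eqI) (simp add: site.rep_eq zero_local_alg.rep_eq)

lemma level_mult_site_entry:
  assumes x: "x \<in> level m"
  shows "entry (x * site m f) i l = (if i div 4 ^ Suc m = l div 4 ^ Suc m
    then f (digit m i) (digit m l) * entry x (i mod 4 ^ m) (l mod 4 ^ m) else 0)"
proof -
  have "x * site m f = star (site m (adj4 f) * star x)"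
    by (simp add: star_mult star_star star_site adj4_adj4)
  then show ?thesis
    by (simp add: entry_star site_mult_level_entry level_star x adj4_def del: power_Suc)
qed

lemma site_commute_level: "x \<in> level m \<Longrightarrow> m \<le> n \<Longrightarrow> site n f * x = x * site n f"
  by (rule local_alg_eqI) (simp add: site_mult_level_entry level_mult_site_entry level_mono del: power_Suc)

lemma site_commute:
  assumes "m \<noteq> n" shows "site m f * site n g = site n g * site m f"
proof (cases "m < n")
  case True
  then show ?thesis using site_commute_level[OF site_in_level[OF True] order_refl] by metis
next
  case False
  then have "n < m" using assms by simp
  then show ?thesis using site_commute_level[OF site_in_level[OF \<open>n < m\<close>] order_refl] by metis
qed

text \<open>Block decomposition along the leftmost tensor factor. It drives the inductions over
  levels, since the blocks live one level below and commute with the matrix units.\<close>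

lemma level_Suc_decompose:
  assumes x: "x \<in> level (Suc m)"
  obtains y where "\<And>p q. y p q \<in> level m" "x = (\<Sum>p<4. \<Sum>q<4. site m (unit4 p q) * y p q)"
proof -
  define Y where "Y p q i l = (if i div 4 ^ m = l div 4 ^ m
    then entry x (p * 4 ^ m + i mod 4 ^ m) (q * 4 ^ m + l mod 4 ^ m) else 0)" for p q i l
  have Y: "at_level m (Y p q)" for p q unfolding at_level_def Y_def by simp
  define y where "y p q = Abs_local_alg (Y p q)" for p q
  have ye: "entry (y p q) = Y p q" for p q
    unfolding y_def using Y by (intro Abs_local_alg_inverse) blast
  have yl: "y p q \<in> level m" for p q by (simp add: level_iff ye Y)
  have "x = (\<Sum>p<4. \<Sum>q<4. site m (unit4 p q) * y p q)"
  proof (rule local_alg_eqI)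
    fix i l
    have md: "digit m i * 4 ^ m + i mod 4 ^ m = i mod 4 ^ Suc m" for i
      using mod_mult2_eq[of i "4 ^ m" 4] by (simp add: digit_def mult.commute)
    have "entry (\<Sum>p<4. \<Sum>q<4. site m (unit4 p q) * y p q) i l
      = (\<Sum>p<4. \<Sum>q<4. if digit m i = p \<and> digit m l = q then if i div 4 ^ Suc m = l div 4 ^ Suc m
        then entry x (i mod 4 ^ Suc m) (l mod 4 ^ Suc m) else 0 else 0)"
      unfolding entry_sum site_mult_level_entry[OF yl] ye
      by (intro sum.cong refl) (auto simp add: unit4_def Y_def md simp del: power_Suc)
    also have "\<dots> = (\<Sum>p<4. if digit m i = p then \<Sum>q<4. if digit m l = q then if i div 4 ^ Suc m = l div 4 ^ Suc m
        then entry x (i mod 4 ^ Suc m) (l mod 4 ^ Suc m) else 0 else 0 else 0)"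
      by (intro sum.cong refl) auto
    also have "\<dots> = (if i div 4 ^ Suc m = l div 4 ^ Suc m
        then entry x (i mod 4 ^ Suc m) (l mod 4 ^ Suc m) else 0)"
      by (simp add: digit_less del: power_Suc)
    also have "\<dots> = entry x i l"
      using at_levelD[OF x[unfolded level_iff], of i l] by simp
    finally show "entry x i l = entry (\<Sum>p<4. \<Sum>q<4. site m (unit4 p q) * y p q) i l" by simp
  qed
  with yl show ?thesis by (rule that)
qed

lemma level_0_scalar:
  assumes "x \<in> level 0" obtains c where "x = scaleC c 1"
proof -
  define c where "c = entry x 0 0"
  have "entry x i l = (if i = l then c else 0)" for i l
    unfolding c_def using at_levelD[OF assms[unfolded level_iff], of i l] by simp
  then have "x = scaleC c 1"
    by (intro local_alg_eqI) (simp add: scaleC_local_alg.rep_eq one_local_alg.rep_eq)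
  then show ?thesis by (rule that)
qed

lemma mult_scaleC_left: "scaleC c x * y = scaleC c (x * y)" for x y :: local_alg
proof -
  have "scaleC c x * y = star (star y * scaleC (cnj c) (star x))"
    by (simp add: star_mult star_scaleC star_star)
  also have "\<dots> = scaleC c (x * y)"
    by (simp add: mult_scaleC_right star_mult star_scaleC star_star)
  finally show ?thesis .
qed

section \<open>Diagonal elements on one and on two adjacent factors\<close>

lemma diagonal_mult_entry:
  assumes "\<And>i l. entry x i l = (if i = l then c i else 0)"
  shows "entry (x * y) i l = c i * entry y i l"
proof -
  have "entry (x * y) i l = (\<Sum>k | entry x i k \<noteq> 0. entry x i k * entry y k l)"
    unfolding times_local_alg.rep_eq matmul_def ..
  also have "\<dots> = (\<Sum>k\<in>{i}. entry x i k * entry y k l)"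
    by (rule sum.mono_neutral_left) (auto simp: assms split: if_splits)
  finally show ?thesis by (simp add: assms)
qed

lemma mult_diagonal_entry:
  assumes "\<And>i l. entry x i l = (if i = l then c i else 0)"
  shows "entry (y * x) i l = entry y i l * c l"
proof -
  have "entry (star x) i l = (if i = l then cnj (c i) else 0)" for i l
    by (simp add: entry_star assms)
  from diagonal_mult_entry[OF this, of "star y" l i]
  have "cnj (entry (star (y * x)) l i) = c l * entry y i l" by (simp add: star_mult entry_star)
  then show ?thesis by (simp add: entry_star mult.commute)
qed

lemma site_diag4_entry: "entry (site m (diag4 c)) i l = (if i = l then c (digit m i) else 0)"
  using eq_iff_digits[of i l m] by (auto simp: site.rep_eq diag4_def)

lemma unit4_diag4: "unit4 p p = diag4 (\<lambda>i. if i = p then 1 else 0)"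
  by (auto simp: fun_eq_iff unit4_def diag4_def)

lemma same_other_digits_digit:
  assumes "same_other_digits m i l" "k \<noteq> m" shows "digit k i = digit k l"
proof (cases "k < m")
  case True
  have "digit k i = i mod 4 ^ m div 4 ^ k mod 4" for i
  proof -
    have "i mod 4 ^ m mod 4 ^ Suc k = i mod 4 ^ Suc k"
      using True by (intro mod_mod_cancel le_imp_power_dvd) simp
    then have "digit k (i mod 4 ^ m) = digit k i" by (metis mod_power_div)
    then show ?thesis by (simp add: digit_def)
  qed
  then show ?thesis using assms(1) by (metis same_other_digits_def)
next
  case False
  then obtain d where d: "k = Suc m + d" using assms(2) by (metis less_iff_Suc_add linorder_neqE_nat add_Suc)
  have "digit k i = i div 4 ^ Suc m div 4 ^ d mod 4" for i
    unfolding digit_def d power_add div_mult2_eq ..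
  then show ?thesis using assms(1) by (metis same_other_digits_def)
qed

text \<open>The sum of c p q times E_pp at site m + 1 and E_qq at site m. Both the phase unitaries
  of the conjugation and the Jones projections of odd index have this form.\<close>

lift_definition diag2 :: "nat \<Rightarrow> (nat \<Rightarrow> nat \<Rightarrow> complex) \<Rightarrow> local_alg"
  is "\<lambda>m c i l. if i = l then c (digit (Suc m) i) (digit m i) else 0"
proof (rule exI)
  fix m c
  have d: "digit (Suc m) (i mod 4 ^ Suc (Suc m)) = digit (Suc m) i"
    "digit m (i mod 4 ^ Suc (Suc m)) = digit m i" for i
  proof -
    show "digit (Suc m) (i mod 4 ^ Suc (Suc m)) = digit (Suc m) i" by (rule digit_mod_power)
    have "i mod 4 ^ Suc (Suc m) mod 4 ^ Suc m = i mod 4 ^ Suc m"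
      by (intro mod_mod_cancel le_imp_power_dvd) simp
    then show "digit m (i mod 4 ^ Suc (Suc m)) = digit m i" by (metis mod_power_div)
  qed
  show "at_level (Suc (Suc m)) (\<lambda>i l. if i = l then c (digit (Suc m) i) (digit m i) else 0)"
    unfolding at_level_def
  proof (intro allI)
    fix i l :: nat
    have "i = l \<longleftrightarrow> i div 4 ^ Suc (Suc m) = l div 4 ^ Suc (Suc m) \<and> i mod 4 ^ Suc (Suc m) = l mod 4 ^ Suc (Suc m)"
      by (metis div_mult_mod_eq)
    then show "(if i = l then c (digit (Suc m) i) (digit m i) else 0) =
      (if i div 4 ^ Suc (Suc m) = l div 4 ^ Suc (Suc m)
       then if i mod 4 ^ Suc (Suc m) = l mod 4 ^ Suc (Suc m)
         then c (digit (Suc m) (i mod 4 ^ Suc (Suc m))) (digit m (i mod 4 ^ Suc (Suc m))) else 0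
       else 0)" unfolding d by presburger
  qed
qed

lemma diag2_mult_entry: "entry (diag2 m c * y) i l = c (digit (Suc m) i) (digit m i) * entry y i l"
  by (rule diagonal_mult_entry) (simp add: diag2.rep_eq)

lemma mult_diag2_entry: "entry (y * diag2 m c) i l = entry y i l * c (digit (Suc m) l) (digit m l)"
  by (rule mult_diagonal_entry) (simp add: diag2.rep_eq)

lemma diag4_mult_entry: "entry (site m (diag4 c) * y) i l = c (digit m i) * entry y i l"
  by (rule diagonal_mult_entry) (rule site_diag4_entry)

lemma mult_diag4_entry: "entry (y * site m (diag4 c)) i l = entry y i l * c (digit m l)"
  by (rule mult_diagonal_entry) (rule site_diag4_entry)

lemma star_diag2: "star (diag2 m c) = diag2 m (\<lambda>p q. cnj (c p q))"
  by (rule local_alg_eqI) (auto simp: entry_star diag2.rep_eq)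

lemma diag2_commute_diag4: "diag2 m c * site k (diag4 e) = site k (diag4 e) * diag2 m c"
  by (rule local_alg_eqI) (auto simp: diag2_mult_entry mult_diag2_entry site_diag4_entry)

text \<open>A nonzero entry of x links indices that agree in all digits from m upwards, and
  \<open>diag2 m c\<close> reads only digits m and m + 1.\<close>

lemma diag2_commute_level: "x \<in> level m \<Longrightarrow> diag2 m c * x = x * diag2 m c"
proof (rule local_alg_eqI)
  fix i l assume x: "x \<in> level m"
  have "entry x i l = 0 \<or> i div 4 ^ m = l div 4 ^ m"
    using x at_levelD[of m "entry x" i l] by (auto simp: level_iff)
  moreover have "digit (Suc m) i = digit (Suc m) l \<and> digit m i = digit m l" if "i div 4 ^ m = l div 4 ^ m"
    using that div_power_mono[OF that, of "Suc m"] by (simp add: digit_def del: power_Suc) 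
  ultimately show "entry (diag2 m c * x) i l = entry (x * diag2 m c) i l"
    by (auto simp: diag2_mult_entry mult_diag2_entry mult.commute)
qed

lemma diag2_commute_site:
  assumes "k \<noteq> m" "k \<noteq> Suc m" shows "diag2 m c * site k f = site k f * diag2 m c"
  by (rule local_alg_eqI) (use assms same_other_digits_digit[of k] in
    \<open>auto simp: diag2_mult_entry mult_diag2_entry site.rep_eq\<close>)

lemma diag2_in_level: "Suc m < n \<Longrightarrow> diag2 m c \<in> level n"
proof -
  assume "Suc m < n"
  have "diag2 m c = (\<Sum>p<4. site (Suc m) (unit4 p p) * site m (diag4 (c p)))"
    by (rule local_alg_eqI)
      (simp add: entry_sum unit4_diag4 diag4_mult_entry site_diag4_entry diag2.rep_eq digit_less
        mult_if_delta)
  then show ?thesis using \<open>Suc m < n\<close> by (auto intro!: level_closed level_sum site_in_level)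
qed

lemma sum4: "(\<Sum>r<(4::nat). f r) = f 0 + f 1 + f 2 + (f 3 :: 'a :: comm_monoid_add)"
  by (simp add: numeral_eq_Suc add.assoc)

lemma all4: "(\<forall>p<(4::nat). P p) \<longleftrightarrow> P 0 \<and> P 1 \<and> P 2 \<and> P 3"
  by (simp add: All_less_Suc numeral_eq_Suc) blast

section \<open>Sign matrices and the expectation onto the diagonal\<close>

definition sgn_pair :: "nat \<Rightarrow> complex"
  where "sgn_pair j = (if j < 2 then 1 else - 1)"

definition sgn_alt :: "nat \<Rightarrow> complex"
  where "sgn_alt j = (- 1) ^ j"

definition shift2 :: "nat \<Rightarrow> nat \<Rightarrow> complex"
  where "shift2 p q = (if p = (q + 2) mod 4 then 1 else 0)"

definition J4 :: "nat \<Rightarrow> nat \<Rightarrow> complex"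
  where "J4 p q = 1 / 4"

text \<open>Conjugation by the four sign matrices generated by \<open>sgn_pair\<close> and \<open>sgn_alt\<close> averages to the
  conditional expectation onto the diagonal matrices.\<close>

definition dephase :: "nat \<Rightarrow> local_alg \<Rightarrow> local_alg"
  where "dephase m y = scaleC (1 / 4)
    (y + site m (diag4 sgn_alt) * y * site m (diag4 sgn_alt)
       + site m (diag4 sgn_pair) * y * site m (diag4 sgn_pair)
       + site m (diag4 sgn_alt) * (site m (diag4 sgn_pair) * y * site m (diag4 sgn_pair)) * site m (diag4 sgn_alt))"

definition diag_part :: "(nat \<Rightarrow> nat \<Rightarrow> complex) \<Rightarrow> nat \<Rightarrow> nat \<Rightarrow> complex"
  where "diag_part f = diag4 (\<lambda>p. f p p)"

text \<open>Orthogonality of characters: the signs \<open>sgn_alt p\<close> and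
  \<open>sgn_pair p\<close> together determine p < 4, so the four sign products sum to 4 on the
  diagonal and to 0 off it.\<close>

lemma dephase_entry: "entry (dephase m y) i l = (if digit m i = digit m l then entry y i l else 0)"
proof -
  have *: "\<forall>p<4. \<forall>q<4. 1 + sgn_alt p * sgn_alt q + sgn_pair p * sgn_pair q
      + sgn_alt p * sgn_pair p * (sgn_pair q * sgn_alt q) = (if p = q then 4 else 0)"
    unfolding all4 by (simp add: sgn_alt_def sgn_pair_def)
  have "entry (dephase m y) i l = 1 / 4 * entry y i l * (1 + sgn_alt (digit m i) * sgn_alt (digit m l)
      + sgn_pair (digit m i) * sgn_pair (digit m l)
      + sgn_alt (digit m i) * sgn_pair (digit m i) * (sgn_pair (digit m l) * sgn_alt (digit m l)))"
    by (simp add: dephase_def scaleC_local_alg.rep_eq plus_local_alg.rep_eq diag4_mult_entry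
        mult_diag4_entry) (simp add: algebra_simps)
  also have "\<dots> = (if digit m i = digit m l then entry y i l else 0)"
    using *[rule_format, OF digit_less[of m i] digit_less[of m l]] by simp
  finally show ?thesis .
qed

lemma dephase_site: "dephase m (site m f) = site m (diag_part f)"
  by (rule local_alg_eqI) (auto simp: dephase_entry site.rep_eq diag_part_def diag4_def)

lemma dephase_mult:
  assumes "\<And>c. site m (diag4 c) * y = y * site m (diag4 c)"
  shows "dephase m (x * y) = dephase m x * y"
proof -
  have "y * site m (diag4 c) = site m (diag4 c) * y"
    "y * (site m (diag4 c) * z) = site m (diag4 c) * (y * z)" for c z
    by (metis assms mult.assoc)+
  then show ?thesis
    unfolding dephase_def mult_scaleC_left distrib_right
    by (simp add: mult.assoc)
qed

lemma dephase_sum: "dephase m (\<Sum>p\<in>A. x p) = (\<Sum>p\<in>A. dephase m (x p))"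
  by (rule local_alg_eqI) (simp add: dephase_entry entry_sum)

section \<open>The unitaries that conjugate the tower onto the subfactor\<close>

lemma commute_mult_left: "a * x = x * a \<Longrightarrow> b * x = x * b \<Longrightarrow> a * b * x = x * (a * b)" for a b x :: "'a :: semigroup_mult"
  by (metis mult.assoc)

lemma commute_mult_right: "a * x = x * a \<Longrightarrow> a * y = y * a \<Longrightarrow> a * (x * y) = x * y * a" for a x y :: "'a :: semigroup_mult"
  by (metis mult.assoc)

text \<open>The first three assumptions describe a complex Hadamard matrix. \<open>shift\<close> is
  the extra symmetry of the family: every such u diagonalises the permutation matrix
  \<open>shift2\<close>, with the same eigenvalues \<open>sgn_alt\<close>. This produces the
  involution common to all parameters.\<close>

locale hadamard =
  fixes u :: "nat \<Rightarrow> nat \<Rightarrow> complex"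
  assumes modulus: "i < 4 \<Longrightarrow> j < 4 \<Longrightarrow> u i j * cnj (u i j) = 1 / 4"
    and columns: "j < 4 \<Longrightarrow> l < 4 \<Longrightarrow> (\<Sum>i<4. u i j * cnj (u i l)) = (if j = l then 1 else 0)"
    and rows: "i < 4 \<Longrightarrow> k < 4 \<Longrightarrow> (\<Sum>j<4. u i j * cnj (u k j)) = (if i = k then 1 else 0)"
    and shift: "i < 4 \<Longrightarrow> j < 4 \<Longrightarrow> u ((i + 2) mod 4) j = sgn_alt j * u i j"
begin

text \<open>A phase controlled by the digit to the left; the factor 2 makes the entries unimodular.
  When digit m + 1 is i, it maps the constant unit vector at site m to the conjugate of row i of u,
  which u then sends to the i-th basis vector. This is how J becomes a Jones projection of odd
  index.\<close>

abbreviation D :: "nat \<Rightarrow> local_alg"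
  where "D m \<equiv> diag2 m (\<lambda>p q. 2 * cnj (u p q))"

text \<open>Conjugation by \<open>W m\<close> maps \<open>\<Delta> \<otimes> M\<^bsub>4\<^esub>\<^bsup>\<otimes>m\<^esup>\<close> onto the intersection of \<open>A\<^bsub>2m\<^esub>\<close>
  with the subfactor, and maps \<open>e\<^bsub>j\<^esub>\<close> to \<open>e\<^bsub>j+1\<^esub>\<close>, where \<open>e\<^bsub>0\<^esub> = J\<close>.\<close>

fun W :: "nat \<Rightarrow> local_alg"
  where "W 0 = site 0 u"
  | "W (Suc m) = W m * D m * site (Suc m) u"

lemma star_u_u: "star (site m u) * site m u = 1"
proof -
  have "site m (mult4 (adj4 u) u) = site m (diag4 (\<lambda>_. 1))"
    by (rule site_cong) (use columns in \<open>auto simp: mult4_def adj4_def diag4_def mult.commute\<close>)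
  then show ?thesis by (simp add: star_site site_mult site_one)
qed

lemma u_star_u: "site m u * star (site m u) = 1"
proof -
  have "site m (mult4 u (adj4 u)) = site m (diag4 (\<lambda>_. 1))"
    by (rule site_cong) (use rows in \<open>auto simp: mult4_def adj4_def diag4_def\<close>)
  then show ?thesis by (simp add: star_site site_mult site_one)
qed

lemma modulus4: "i < 4 \<Longrightarrow> j < 4 \<Longrightarrow> u i j * (cnj (u i j) * 4) = 1"
  using modulus[of i j] by (simp flip: mult.assoc)

lemma star_D_D: "star (D m) * D m = 1" "D m * star (D m) = 1"
proof -
  have "2 * u p q * (2 * cnj (u p q)) = 1" "2 * cnj (u p q) * (2 * u p q) = 1" if "p < 4" "q < 4" for p q
    using modulus4[OF that] by (simp_all add: mult_ac)
  then show "star (D m) * D m = 1" "D m * star (D m) = 1"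
    by (auto intro!: local_alg_eqI simp: star_diag2 diag2_mult_entry diag2.rep_eq one_local_alg.rep_eq digit_less)
qed

lemma W_in_level: "m < n \<Longrightarrow> W m \<in> level n"
  by (induction m) (auto intro!: level_mult site_in_level diag2_in_level)

lemma star_W_W: "star (W m) * W m = 1"
proof (induction m)
  case (Suc m)
  have "star (W (Suc m)) * W (Suc m)
    = star (site (Suc m) u) * (star (D m) * (star (W m) * W m) * D m) * site (Suc m) u"
    by (simp add: star_mult mult.assoc)
  then show ?case by (simp add: Suc star_D_D star_u_u)
qed (simp add: star_u_u)

lemma W_star_W: "W m * star (W m) = 1"
proof (induction m)
  case (Suc m)
  have "W (Suc m) * star (W (Suc m))
    = W m * (D m * (site (Suc m) u * star (site (Suc m) u)) * star (D m)) * star (W m)"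
    by (simp add: star_mult mult.assoc)
  then show ?case by (simp add: Suc star_D_D u_star_u)
qed (simp add: u_star_u)

definition conj_diag :: "nat \<Rightarrow> (nat \<Rightarrow> complex) \<Rightarrow> local_alg"
  where "conj_diag m c = W m * site m (diag4 c) * star (W m)"

definition expect :: "nat \<Rightarrow> local_alg \<Rightarrow> local_alg"
  where "expect m a = W m * dephase m (star (W m) * a * W m) * star (W m)"

text \<open>The commuting square. Conjugation by \<open>D m\<close> multiplies a matrix unit E_pq at
  site m by the diagonal matrix with entries 4 u_ip cnj(u_iq) at site m + 1. After conjugation by u
  there, the r-th diagonal entry is the sum over i of u_ip cnj(u_iq) times 4 |u_ir|^2. Flatness
  removes the last factor, and orthogonality of the columns leaves 1 for p = q and 0 otherwise. So
  dephasing at site m + 1 has the effect of dephasing at site m.\<close>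

lemma expect_level_Suc:
  assumes a: "a \<in> level (Suc m)"
  shows "expect (Suc m) a = expect m a"
proof -
  let ?U = "site (Suc m) u"
  have "star (W m) * a * W m \<in> level (Suc m)"
    using a by (intro level_mult level_star W_in_level) auto
  then obtain y where y: "\<And>p q. y p q \<in> level m"
    and c: "star (W m) * a * W m = (\<Sum>p<4. \<Sum>q<4. site m (unit4 p q) * y p q)"
    by (rule level_Suc_decompose) blast
  define z where "z = (\<Sum>p<4. \<Sum>q<4. site m (diag_part (unit4 p q)) * y p q)"
  have comm: "site n f * y p q = y p q * site n f" if "n \<ge> m" for n f p q
    by (rule site_commute_level[OF y that])
  have Dy: "D m * y p q = y p q * D m" for p q by (rule diag2_commute_level[OF y])
  have deph: "dephase m (star (W m) * a * W m) = z"
    unfolding c z_def dephase_sum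
    by (intro sum.cong refl) (subst dephase_mult, simp_all add: comm dephase_site)
  have key: "dephase (Suc m) (star (D m * ?U) * site m (unit4 p q) * (D m * ?U)) = site m (diag_part (unit4 p q))"
    if pq: "p < 4" "q < 4" for p q
  proof -
    define f where "f i = 4 * u i p * cnj (u i q)" for i
    have "star (D m) * site m (unit4 p q) * D m = site (Suc m) (diag4 f) * site m (unit4 p q)"
      by (rule local_alg_eqI) (auto simp: star_diag2 mult_diag2_entry diag2_mult_entry diag4_mult_entry site.rep_eq unit4_def
          f_def dest: same_other_digits_digit[of m _ _ "Suc m"])
    moreover have "star (D m * ?U) * site m (unit4 p q) * (D m * ?U)
      = star ?U * (star (D m) * site m (unit4 p q) * D m) * ?U"
      by (simp add: star_mult mult.assoc)
    ultimately have "star (D m * ?U) * site m (unit4 p q) * (D m * ?U)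
      = star ?U * site (Suc m) (diag4 f) * (site m (unit4 p q) * ?U)"
      by (simp add: mult.assoc)
    also have "\<dots> = site (Suc m) (mult4 (mult4 (adj4 u) (diag4 f)) u) * site m (unit4 p q)"
      by (simp add: site_commute[of m "Suc m"] star_site site_mult flip: mult.assoc)
    finally have "dephase (Suc m) (star (D m * ?U) * site m (unit4 p q) * (D m * ?U))
      = site (Suc m) (diag_part (mult4 (mult4 (adj4 u) (diag4 f)) u)) * site m (unit4 p q)"
      using dephase_mult[OF site_commute[of "Suc m" m]] by (simp only: dephase_site n_not_Suc_n[symmetric] not_False_eq_True)
    also have "site (Suc m) (diag_part (mult4 (mult4 (adj4 u) (diag4 f)) u))
        = site (Suc m) (diag4 (\<lambda>_. if p = q then 1 else 0))"
    proof (rule site_cong)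
      fix r s :: nat assume rs: "r < 4" "s < 4"
      have "mult4 (mult4 (adj4 u) (diag4 f)) u r r = (\<Sum>i<4. u i p * cnj (u i q) * (u i r * (cnj (u i r) * 4)))"
        unfolding mult4_def adj4_def diag4_def f_def
        by (intro sum.cong refl) (simp add: mult_ac if_distrib cong: if_cong)
      also have "\<dots> = (\<Sum>i<4. u i p * cnj (u i q))"
        by (intro sum.cong refl) (use rs modulus4 in simp)
      also have "\<dots> = (if p = q then 1 else 0)" by (rule columns[OF pq])
      finally have "mult4 (mult4 (adj4 u) (diag4 f)) u r r = (if p = q then 1 else 0)" .
      then show "diag_part (mult4 (mult4 (adj4 u) (diag4 f)) u) r s = diag4 (\<lambda>_. if p = q then 1 else 0) r s"
        by (auto simp: diag_part_def diag4_def)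
    qed
    also have "\<dots> * site m (unit4 p q) = site m (diag_part (unit4 p q))"
      by (rule local_alg_eqI)
        (auto simp: diag4_mult_entry site.rep_eq unit4_def diag_part_def diag4_def)
    finally show ?thesis .
  qed
  have "star (W (Suc m)) * a * W (Suc m) = star (D m * ?U) * (star (W m) * a * W m) * (D m * ?U)"
    by (simp add: star_mult mult.assoc)
  also have "\<dots> = (\<Sum>p<4. \<Sum>q<4. star (D m * ?U) * site m (unit4 p q) * (D m * ?U) * y p q)"
    unfolding c sum_distrib_left sum_distrib_right
  proof (intro sum.cong refl)
    fix p q
    have "D m * ?U * y p q = y p q * (D m * ?U)"
      by (rule commute_mult_left[OF Dy comm]) simp
    then show "star (D m * ?U) * (site m (unit4 p q) * y p q) * (D m * ?U)
        = star (D m * ?U) * site m (unit4 p q) * (D m * ?U) * y p q"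
      by (simp only: mult.assoc)
  qed
  finally have "dephase (Suc m) (star (W (Suc m)) * a * W (Suc m)) = z"
    unfolding z_def by (simp add: dephase_sum dephase_mult comm key)
  \<comment> \<open>The surviving terms are diagonal at site m and otherwise live on lower sites, so
    they commute with the two factors that \<open>W (Suc m)\<close> has in addition to
    \<open>W m\<close>, and these cancel.\<close>
  moreover have "D m * ?U * z = z * (D m * ?U)"
  proof -
    have "D m * ?U * (site m (diag_part (unit4 p q)) * y p q)
      = site m (diag_part (unit4 p q)) * y p q * (D m * ?U)" for p q
      unfolding diag_part_def
      by (intro commute_mult_left commute_mult_right Dy comm diag2_commute_diag4 site_commute) simp_all
    then show ?thesis unfolding z_def sum_distrib_left sum_distrib_right by simp
  qed
  ultimately have "expect (Suc m) a = W m * (D m * ?U * z * (star ?U * star (D m))) * star (W m)"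
    unfolding expect_def by (simp add: star_mult mult.assoc)
  also have "D m * ?U * z * (star ?U * star (D m)) = z * (D m * (?U * star ?U) * star (D m))"
    unfolding \<open>D m * ?U * z = z * (D m * ?U)\<close> by (simp only: mult.assoc)
  also have "\<dots> = z" by (simp add: u_star_u star_D_D)
  finally show ?thesis by (simp add: expect_def deph)
qed

lemma expect_stable: "m \<le> n \<Longrightarrow> a \<in> level (Suc m) \<Longrightarrow> expect n a = expect m a"
  by (induction n rule: dec_induct) (auto simp: expect_level_Suc level_mono)

end

section \<open>The two involutions that implement the expectation\<close>

fun shift_all :: "nat \<Rightarrow> local_alg"
  where "shift_all 0 = site 0 shift2"
  | "shift_all (Suc m) = shift_all m * site (Suc m) shift2"

lemma sgn_mult_self: "sgn_alt p * sgn_alt p = 1" "sgn_pair p * sgn_pair p = 1"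
  by (simp_all add: sgn_alt_def sgn_pair_def flip: power_mult_distrib)

lemma cnj_sgn: "cnj (sgn_alt p) = sgn_alt p" "cnj (sgn_pair p) = sgn_pair p"
  by (simp_all add: sgn_alt_def sgn_pair_def)

lemma mult4_diag4: "q < 4 \<Longrightarrow> mult4 f (diag4 c) p q = f p q * c q"
  by (simp add: mult4_def diag4_def if_distrib cong: if_cong)

lemma mult4_shift2: "p < 4 \<Longrightarrow> mult4 shift2 f p q = f ((p + 2) mod 4) q"
proof -
  have "\<forall>p<4. mult4 shift2 f p q = f ((p + 2) mod 4) q"
    unfolding all4 by (simp add: mult4_def shift2_def sum4 del: add_2_eq_Suc add_2_eq_Suc')
  then show "p < 4 \<Longrightarrow> mult4 shift2 f p q = f ((p + 2) mod 4) q" by blast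
qed

lemma site_diag4_mult: "site m (diag4 c) * site m (diag4 e) = site m (diag4 (\<lambda>p. c p * e p))"
  by (rule local_alg_eqI) (simp add: diag4_mult_entry site_diag4_entry)

lemma star_diag4: "star (site m (diag4 c)) = site m (diag4 (\<lambda>p. cnj (c p)))"
  by (rule local_alg_eqI) (auto simp: entry_star site_diag4_entry)

definition commuting_involutions :: "local_alg \<Rightarrow> local_alg \<Rightarrow> bool"
  where "commuting_involutions s g \<longleftrightarrow> s * s = 1 \<and> g * g = 1 \<and> star s = s \<and> star g = g \<and> s * g = g * s"

definition average :: "local_alg \<Rightarrow> local_alg \<Rightarrow> local_alg \<Rightarrow> local_alg"
  where "average s g a = scaleC (1 / 4) (a + s * a * s + g * a * g + s * (g * a * g) * s)"

lemma average_commute: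
  assumes "commuting_involutions s g"
  shows "s * average s g a = average s g a * s" "g * average s g a = average s g a * g"
proof -
  have r: "s * s = 1" "g * g = 1" "g * s = s * g" using assms by (auto simp: commuting_involutions_def)
  then have r': "s * (s * x) = x" "g * (g * x) = x" "g * (s * x) = s * (g * x)" for x
    by (metis mult.assoc mult_1)+
  show "s * average s g a = average s g a * s" "g * average s g a = average s g a * g"
    by (simp_all add: average_def mult_scaleC_left mult_scaleC_right algebra_simps r r')
qed

lemma average_eq:
  assumes "commuting_involutions s g" "s * a = a * s" "g * a = a * g"
  shows "average s g a = a"
proof -
  have "s * a * s = a" "g * a * g = a"
    using assms by (metis commuting_involutions_def mult.assoc mult.right_neutral)+
  then have "average s g a = scaleC (1 / 4) (scaleC 4 a)"
    unfolding average_def using scaleC_add_left[of 2 2 a] scaleC_add_left[of 1 1 a]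
    by (simp add: scaleC_one add.assoc)
  then show ?thesis by (simp add: scaleC_scaleC scaleC_one)
qed

context hadamard
begin

abbreviation reflection :: "nat \<Rightarrow> local_alg"
  where "reflection m \<equiv> conj_diag m sgn_pair"

lemma conj_mult: "W m * x * star (W m) * (W m * y * star (W m)) = W m * (x * y) * star (W m)"
  by (metis mult.assoc mult.right_neutral star_W_W)

lemma shift2_u: "site m shift2 * site m u = site m u * site m (diag4 sgn_alt)"
  unfolding site_mult by (rule site_cong) (simp add: mult4_shift2 mult4_diag4 shift mult.commute del: add_2_eq_Suc add_2_eq_Suc')

text \<open>Moving the shift at site m + 1 past \<open>D m\<close> costs the sign
  \<open>sgn_alt\<close> of digit m. This cancels the sign left over from the induction hypothesis,
  and u at site m + 1 creates the new one.\<close>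

lemma shift_all_W: "shift_all m * W m = W m * site m (diag4 sgn_alt)"
proof (induction m)
  case 0
  show ?case by (simp add: shift2_u)
next
  case (Suc m)
  let ?P = "site (Suc m) shift2" and ?U = "site (Suc m) u"
  \<comment> \<open>Shifting digit m + 1 by 2 moves the phases to another row of u, which by
    \<open>shift\<close> differs only in the signs of the odd columns.\<close>
  have PD: "?P * D m = D m * site m (diag4 sgn_alt) * ?P"
  proof (rule local_alg_eqI)
    fix i l
    let ?a = "digit (Suc m) i" and ?b = "digit (Suc m) l"
    have *: "cnj (u ?b j) = cnj (u ?a j) * sgn_alt j" if "?a = (?b + 2) mod 4" "j < 4" for j
    proof -
      have "u ?a j * sgn_alt j = (sgn_alt j * sgn_alt j) * u ?b j"
        unfolding that(1) shift[OF digit_less that(2)] by (simp add: mult_ac)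
      then have "cnj (u ?b j) = cnj (u ?a j * sgn_alt j)" by (simp only: sgn_mult_self mult_1)
      then show ?thesis by (simp add: cnj_sgn)
    qed
    have "entry (?P * D m) i l = entry ?P i l * (2 * cnj (u ?b (digit m l)))"
      by (simp add: mult_diag2_entry)
    also have "\<dots> = 2 * (cnj (u ?a (digit m i)) * sgn_alt (digit m i)) * entry ?P i l"
    proof (cases "same_other_digits (Suc m) i l \<and> ?a = (?b + 2) mod 4")
      case True
      then have "digit m l = digit m i" by (metis same_other_digits_digit n_not_Suc_n)
      then show ?thesis using *[of "digit m i"] True by (simp add: digit_less)
    next
      case False
      then have "entry ?P i l = 0" by (auto simp: site.rep_eq shift2_def)
      then show ?thesis by simp
    qed
    finally show "entry (?P * D m) i l = entry (D m * site m (diag4 sgn_alt) * ?P) i l"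
      by (simp add: diag2_mult_entry mult.assoc diag4_mult_entry)
  qed
  have PW: "?P * W m = W m * ?P" by (rule site_commute_level[OF W_in_level[of m "Suc m"]]) simp_all
  have zz: "site m (diag4 sgn_alt) * site m (diag4 sgn_alt) = 1"
    by (simp add: site_diag4_mult sgn_mult_self site_one)
  have zD: "D m * site m (diag4 sgn_alt) = site m (diag4 sgn_alt) * D m"
    by (rule diag2_commute_diag4)
  have "shift_all (Suc m) * W (Suc m) = shift_all m * (?P * W m) * D m * ?U"
    by (simp add: mult.assoc)
  also have "\<dots> = (shift_all m * W m) * (?P * D m) * ?U" by (simp add: PW mult.assoc)
  also have "\<dots> = W m * (site m (diag4 sgn_alt) * (site m (diag4 sgn_alt) * D m)) * ?P * ?U"
    unfolding Suc PD zD by (simp add: mult.assoc)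
  also have "\<dots> = W m * D m * (?P * ?U)"
    by (simp add: zz flip: mult.assoc)
  finally show ?case by (simp add: shift2_u mult.assoc)
qed

lemma shift_all_eq: "shift_all m = conj_diag m sgn_alt"
  unfolding conj_diag_def shift_all_W[symmetric] by (simp add: mult.assoc W_star_W)

lemma commuting_involutions: "commuting_involutions (shift_all m) (reflection m)"
  unfolding commuting_involutions_def shift_all_eq conj_diag_def conj_mult
  by (simp add: site_diag4_mult sgn_mult_self site_one W_star_W star_mult star_star star_diag4 cnj_sgn
      mult.commute mult.assoc)

lemma expect_eq_average: "expect m a = average (shift_all m) (reflection m) a"
proof -
  have "x * star (W m) * W m = x" "x * W m * star (W m) = x" for x
    by (simp_all add: mult.assoc star_W_W W_star_W)
  then show ?thesis
    unfolding average_def expect_def dephase_def shift_all_eq conj_diag_def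
    by (simp add: distrib_left distrib_right mult_scaleC_left mult_scaleC_right W_star_W flip: mult.assoc)
qed

text \<open>Commutation is required eventually because both involutions change with n and a local
  element is controlled only from its own level on. This set is the local part of the
  subfactor.\<close>

definition fixed_alg :: "local_alg set"
  where "fixed_alg = {b. \<exists>m. \<forall>n\<ge>m. shift_all n * b = b * shift_all n \<and> reflection n * b = b * reflection n}"

lemma ex_expect_stable: "\<exists>m. \<forall>n\<ge>m. expect n a = expect m a"
  using ex_level_Suc[of a] expect_stable by blast

lemma conj_in_fixed_alg:
  assumes "\<And>n. n \<ge> m \<Longrightarrow> b = W n * x * star (W n)" "x \<in> level m"
  shows "b \<in> fixed_alg"
proof -
  have "shift_all n * b = b * shift_all n \<and> reflection n * b = b * reflection n" if "n \<ge> m" for n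
    unfolding assms(1)[OF that] shift_all_eq conj_diag_def conj_mult
    using site_commute_level[OF assms(2) that] by simp
  then show ?thesis unfolding fixed_alg_def by blast
qed

section \<open>The Jones projections as successive conjugates\<close>

abbreviation diagonal_pair :: "nat \<Rightarrow> local_alg"
  where "diagonal_pair k \<equiv> (\<Sum>i<4. site (Suc k) (unit4 i i) * site k (unit4 i i))"

lemma diagonal_pair_eq: "diagonal_pair k = diag2 k (\<lambda>p q. if p = q then 1 else 0)"
  by (rule local_alg_eqI)
    (simp add: entry_sum unit4_diag4 diag4_mult_entry site_diag4_entry diag2.rep_eq digit_less mult_if_delta)

text \<open>The factors of \<open>W n\<close> beyond \<open>W m\<close> commute with x and cancel
  against their adjoints. The conjugate is thus the same for all n \<ge> m, as
  \<open>conj_in_fixed_alg\<close> requires.\<close>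

lemma W_commute:
  assumes "\<And>k. k \<ge> m \<Longrightarrow> D k * x = x * D k" "\<And>k. k > m \<Longrightarrow> site k u * x = x * site k u"
    and "m \<le> n"
  shows "W n * x * star (W n) = W m * x * star (W m)"
  using assms(3)
proof (induction n rule: dec_induct)
  case (step n)
  have "W (Suc n) * x * star (W (Suc n))
     = W n * (D n * (site (Suc n) u * x) * star (site (Suc n) u) * star (D n)) * star (W n)"
    by (simp add: star_mult mult.assoc)
  also have "D n * (site (Suc n) u * x) * star (site (Suc n) u) * star (D n)
     = (D n * x) * (site (Suc n) u * star (site (Suc n) u)) * star (D n)"
    using assms(2)[of "Suc n"] step by (simp add: mult.assoc)
  also have "\<dots> = x"
    using assms(1)[of n] step by (simp add: u_star_u star_D_D mult.assoc)
  finally show ?case using step by simp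
qed simp

lemma conj_site_0: "W n * site 0 (diag4 d) * star (W n) = site 0 (mult4 (mult4 u (diag4 d)) (adj4 u))"
proof -
  have "W n * site 0 (diag4 d) * star (W n) = W 0 * site 0 (diag4 d) * star (W 0)"
    by (rule W_commute) (auto simp: diag2_commute_diag4 site_commute)
  then show ?thesis by (simp add: star_site site_mult)
qed

text \<open>From e_2k to e_(2k+1), where e_0 is J. \<open>D k\<close> turns the constant vector at
  site k into a conjugate row of u selected by digit k + 1, and u at site k turns that row into a
  basis vector. The remaining factors of \<open>W n\<close> commute with what they meet.\<close>

lemma conj_J4:
  assumes "k < n"
  shows "W n * site k J4 * star (W n) = diagonal_pair k"
proof -
  have inner: "D k * site k J4 * star (D k) = (\<Sum>i<4. site (Suc k) (unit4 i i) * site k (\<lambda>p q. cnj (u i p) * u i q))"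
    by (rule local_alg_eqI)
      (auto simp: star_diag2 diag2_mult_entry mult_diag2_entry site.rep_eq J4_def entry_sum unit4_diag4
        diag4_mult_entry digit_less mult_if_delta dest: same_other_digits_digit[of k _ _ "Suc k"])
  have mid: "site k u * (\<Sum>i<4. site (Suc k) (unit4 i i) * site k (\<lambda>p q. cnj (u i p) * u i q)) * star (site k u)
    = diagonal_pair k"
    unfolding sum_distrib_left sum_distrib_right
  proof (rule sum.cong[OF refl])
    fix i :: nat assume i: "i \<in> {..<4}"
    let ?f = "\<lambda>p q. cnj (u i p) * u i q"
    have "site k (mult4 (mult4 u ?f) (adj4 u)) = site k (unit4 i i)"
    proof (rule site_cong)
      fix p q :: nat assume pq: "p < 4" "q < 4"
      have "mult4 (mult4 u ?f) (adj4 u) p q = (\<Sum>r<4. u p r * cnj (u i r)) * (\<Sum>s<4. u i s * cnj (u q s))"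
      proof -
        have "mult4 (mult4 u ?f) (adj4 u) p q
            = (\<Sum>s<4. (\<Sum>r<4. u p r * cnj (u i r)) * (u i s * cnj (u q s)))"
          unfolding mult4_def adj4_def by (intro sum.cong refl) (simp add: sum_distrib_right mult.assoc)
        then show ?thesis by (simp add: sum_distrib_left)
      qed
      then show "mult4 (mult4 u ?f) (adj4 u) p q = unit4 i i p q"
        using pq i by (simp add: rows unit4_def)
    qed
    moreover have "site k u * (site (Suc k) (unit4 i i) * site k ?f) * star (site k u)
      = site (Suc k) (unit4 i i) * (site k u * site k ?f * site k (adj4 u))"
      by (simp add: site_commute[of k "Suc k" u "unit4 i i"] star_site flip: mult.assoc)
    ultimately show "site k u * (site (Suc k) (unit4 i i) * site k ?f) * star (site k u)
      = site (Suc k) (unit4 i i) * site k (unit4 i i)" by (simp add: site_mult)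
  qed
  have "W n * site k J4 * star (W n) = W (Suc k) * site k J4 * star (W (Suc k))"
    by (rule W_commute) (use assms in \<open>auto simp: diag2_commute_site site_commute\<close>)
  also have "\<dots> = W k * (D k * (site (Suc k) u * site k J4) * star (site (Suc k) u) * star (D k)) * star (W k)"
    by (simp add: star_mult mult.assoc)
  also have "D k * (site (Suc k) u * site k J4) * star (site (Suc k) u) * star (D k)
     = D k * site k J4 * (site (Suc k) u * star (site (Suc k) u)) * star (D k)"
    by (simp add: site_commute[of "Suc k" k] mult.assoc)
  also have "\<dots> = D k * site k J4 * star (D k)" by (simp add: u_star_u)
  also have "W k * (D k * site k J4 * star (D k)) * star (W k) = diagonal_pair k"
  \<comment> \<open>For k = 0 the matrix u at site k is all of \<open>W k\<close>. Otherwise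
    \<open>W k\<close> also contains \<open>W j\<close> and \<open>D j\<close>, which commute with
    the diagonal result.\<close>
  proof (cases k)
    case 0
    show ?thesis using mid unfolding inner unfolding 0 by simp
  next
    case (Suc j)
    let ?x = "D k * site k J4 * star (D k)"
    have "W k * ?x * star (W k) = W j * (D j * (site k u * ?x * star (site k u)) * star (D j)) * star (W j)"
      unfolding Suc by (simp add: star_mult mult.assoc)
    also have "\<dots> = W j * (D j * diag2 k (\<lambda>p q. if p = q then 1 else 0) * star (D j)) * star (W j)"
      unfolding inner mid diagonal_pair_eq ..
    also have "D j * diag2 k (\<lambda>p q. if p = q then 1 else 0) = diag2 k (\<lambda>p q. if p = q then 1 else 0) * D j"
      by (rule local_alg_eqI) (simp add: diag2_mult_entry diag2.rep_eq)
    also have "\<dots> * star (D j) = diag2 k (\<lambda>p q. if p = q then 1 else 0)"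
      by (simp add: mult.assoc star_D_D)
    also have "W j * diag2 k (\<lambda>p q. if p = q then 1 else 0) = diag2 k (\<lambda>p q. if p = q then 1 else 0) * W j"
      by (rule diag2_commute_level[OF W_in_level, symmetric]) (simp add: Suc)
    finally show ?thesis by (simp add: mult.assoc W_star_W diagonal_pair_eq)
  qed
  finally show ?thesis .
qed

text \<open>From e_(2k+1) to e_(2k+2). Conjugation by u at site k + 1 turns E_pp into the projection
  onto column p, and the phases of \<open>D k\<close> for digit k equal to p flatten that column to
  the constant vector, whatever p is.\<close>

lemma conj_diagonal_pair:
  assumes "k < n"
  shows "W n * diagonal_pair k * star (W n) = site (Suc k) J4"
proof -
  let ?U = "site (Suc k) u" and ?g = "\<lambda>p i j. u i p * cnj (u j p)"
  have inner: "?U * diagonal_pair k * star ?U = (\<Sum>p<4. site (Suc k) (?g p) * site k (unit4 p p))"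
    unfolding sum_distrib_left sum_distrib_right
  proof (rule sum.cong[OF refl])
    fix p :: nat assume p: "p \<in> {..<4}"
    have "site (Suc k) (mult4 (mult4 u (unit4 p p)) (adj4 u)) = site (Suc k) (?g p)"
    proof (rule site_cong)
      fix i j :: nat
      have "mult4 (mult4 u (unit4 p p)) (adj4 u) i j = (\<Sum>r<4. if r = p then ?g p i j else 0)"
        by (subst mult4_def, intro sum.cong refl) (simp add: adj4_def unit4_diag4 mult4_diag4)
      then show "mult4 (mult4 u (unit4 p p)) (adj4 u) i j = ?g p i j" using p by simp
    qed
    moreover have "?U * (site (Suc k) (unit4 p p) * site k (unit4 p p)) * star ?U
      = ?U * site (Suc k) (unit4 p p) * site (Suc k) (adj4 u) * site k (unit4 p p)"
      using site_commute[of "Suc k" k "adj4 u" "unit4 p p"] by (simp add: star_site mult.assoc)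
    ultimately show "?U * (site (Suc k) (unit4 p p) * site k (unit4 p p)) * star ?U
      = site (Suc k) (?g p) * site k (unit4 p p)" by (simp add: site_mult)
  qed
  have "D k * (\<Sum>p<4. site (Suc k) (?g p) * site k (unit4 p p)) * star (D k) = site (Suc k) J4"
  proof (rule local_alg_eqI)
    fix i l
    let ?a = "digit (Suc k) i" and ?b = "digit (Suc k) l" and ?q = "digit k l"
    have "u ?a ?q * (cnj (u ?a ?q) * 4) * (u ?b ?q * (cnj (u ?b ?q) * 4)) = 1"
      by (simp add: modulus4 digit_less)
    then have *: "2 * cnj (u ?a ?q) * (u ?a ?q * cnj (u ?b ?q)) * (2 * u ?b ?q) = 1 / 4"
      by (simp add: field_simps)
    have "entry (\<Sum>p<4. site (Suc k) (?g p) * site k (unit4 p p)) i l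
      = (if same_other_digits (Suc k) i l then ?g ?q ?a ?b else 0)"
      by (simp add: entry_sum unit4_diag4 mult_diag4_entry site.rep_eq digit_less if_distrib cong: if_cong)
    then show "entry (D k * (\<Sum>p<4. site (Suc k) (?g p) * site k (unit4 p p)) * star (D k)) i l = entry (site (Suc k) J4) i l"
      using * same_other_digits_digit[of "Suc k" i l k]
      by (auto simp: star_diag2 mult_diag2_entry diag2_mult_entry site.rep_eq J4_def mult.assoc)
  qed
  moreover have "W n * diagonal_pair k * star (W n) = W (Suc k) * diagonal_pair k * star (W (Suc k))"
  proof (rule W_commute)
    fix j assume "Suc k < j"
    then show "site j u * diagonal_pair k = diagonal_pair k * site j u"
      unfolding diagonal_pair_eq by (subst diag2_commute_site) auto
  next
    show "D j * diagonal_pair k = diagonal_pair k * D j" for j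
      unfolding diagonal_pair_eq by (rule local_alg_eqI) (simp add: diag2_mult_entry diag2.rep_eq)
  qed (use assms in simp)
  moreover have "W (Suc k) * diagonal_pair k * star (W (Suc k))
    = W k * (D k * (?U * diagonal_pair k * star ?U) * star (D k)) * star (W k)"
    by (simp add: star_mult mult.assoc)
  moreover have "W k * site (Suc k) J4 * star (W k) = site (Suc k) J4"
  proof -
    have "W k * site (Suc k) J4 = site (Suc k) J4 * W k"
      by (rule site_commute_level[OF W_in_level[of k "Suc k"], symmetric]) simp_all
    then show ?thesis by (simp add: W_star_W mult.assoc)
  qed
  ultimately show ?thesis unfolding inner by simp
qed

end

lemma diag4_mult4: "p < 4 \<Longrightarrow> mult4 (diag4 c) f p q = c p * f p q"
  by (simp add: mult4_def diag4_def if_distribR if_distrib[of "\<lambda>x. x * _"] cong: if_cong)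

context hadamard
begin

text \<open>Conjugating back by \<open>W m\<close> reduces the claim to generating \<Delta>
  \<otimes> M \<otimes> ... \<otimes> M from the diagonal at site 0, the J's and the diagonal pairs.
  \<open>X\<close> is abstract because it will be the preimage under \<open>gns_rep\<close> of an
  arbitrary von Neumann algebra containing the generators.\<close>

lemma generated_superset_fixed_alg:
  assumes add: "\<And>x y. x \<in> X \<Longrightarrow> y \<in> X \<Longrightarrow> x + y \<in> X"
    and mult: "\<And>x y. x \<in> X \<Longrightarrow> y \<in> X \<Longrightarrow> x * y \<in> X"
    and scale: "\<And>c x. x \<in> X \<Longrightarrow> scaleC c x \<in> X"
    and one: "1 \<in> X"
    and diag: "\<And>d. site 0 (mult4 (mult4 u (diag4 d)) (adj4 u)) \<in> X"
    and pair: "\<And>k. diagonal_pair k \<in> X"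
    and J: "\<And>k. site (Suc k) J4 \<in> X"
  shows "fixed_alg \<subseteq> X"
proof
  fix b assume "b \<in> fixed_alg"
  then obtain m0 where m0: "\<And>n. n \<ge> m0 \<Longrightarrow> shift_all n * b = b * shift_all n"
    "\<And>n. n \<ge> m0 \<Longrightarrow> reflection n * b = b * reflection n"
    by (auto simp: fixed_alg_def)
  obtain m1 where m1: "b \<in> level (Suc m1)" using ex_level_Suc by blast
  define m where "m = max m0 m1"
  have b: "b \<in> level (Suc m)" by (rule level_mono[OF m1]) (simp add: m_def)
  have "average (shift_all m) (reflection m) b = b"
    by (rule average_eq[OF commuting_involutions m0]) (simp_all add: m_def)
  then have Eb: "expect m b = b" by (simp add: expect_eq_average)

  define Y where "Y = {x. W m * x * star (W m) \<in> X}"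
  have Y_add: "x + y \<in> Y" if "x \<in> Y" "y \<in> Y" for x y
    using that add by (simp add: Y_def distrib_left distrib_right)
  have Y_mult: "x * y \<in> Y" if "x \<in> Y" "y \<in> Y" for x y
    using that mult unfolding Y_def mem_Collect_eq conj_mult[symmetric] by blast
  have Y_scale: "scaleC c x \<in> Y" if "x \<in> Y" for c x
    using that scale by (simp add: Y_def mult_scaleC_left mult_scaleC_right)
  have Y_one: "1 \<in> Y" using one by (simp add: Y_def W_star_W)
  have Y_0: "0 \<in> Y" using Y_scale[OF Y_one, of 0] by (metis add_cancel_right_right complex_inner_class.scaleC_add_left)
  have Y_sum: "(\<Sum>p\<in>A. x p) \<in> Y" if "\<And>p. p \<in> A \<Longrightarrow> x p \<in> Y" for x :: "nat \<Rightarrow> _" and A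
    using that by (induction A rule: infinite_finite_induct) (auto intro: Y_add Y_0)
  have Y_diag: "site 0 (diag4 d) \<in> Y" for d unfolding Y_def mem_Collect_eq conj_site_0 by (rule diag)
  have Y_J: "site k J4 \<in> Y" if "k < m" for k
    unfolding Y_def mem_Collect_eq conj_J4[OF that] by (rule pair)
  have Y_pair: "diagonal_pair k \<in> Y" if "k < m" for k
    unfolding Y_def mem_Collect_eq conj_diagonal_pair[OF that] by (rule J)

  have unit_mult: "site k (unit4 p q) * site k (unit4 r s) = (if q = r then site k (unit4 p s) else 0)" if "q < 4" for k p q r s
  proof -
    have "site k (unit4 p q) * site k (unit4 r s) = site k (\<lambda>i j. if q = r then unit4 p s i j else 0)"
      unfolding site_mult using that
      by (intro site_cong) (auto simp: mult4_def unit4_def if_distrib cong: if_cong)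
    then show ?thesis by (simp add: site_zero)
  qed
  \<comment> \<open>The diagonal units at site k are carried along: sandwiching J between them
    yields all matrix units at site k, and the diagonal pair then passes the diagonal units on to
    site k + 1.\<close>
  have *: "level k \<subseteq> Y \<and> (\<forall>p<4. site k (unit4 p p) \<in> Y)" if "k \<le> m" for k
    using that
  proof (induction k)
    case 0
    have "x \<in> Y" if "x \<in> level 0" for x using level_0_scalar[OF that] Y_scale[OF Y_one] by metis
    then show ?case using Y_diag by (auto simp: unit4_diag4)
  next
    case (Suc k)
    have units: "site k (unit4 p q) \<in> Y" if "p < 4" "q < 4" for p q
    proof -
      have "site k (unit4 p p) * site k J4 * site k (unit4 q q) = scaleC (1 / 4) (site k (unit4 p q))"
        unfolding site_mult site_scaleC
        by (rule site_cong) (simp add: unit4_diag4 mult4_diag4 diag4_mult4 J4_def, simp add: unit4_def)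
      then have "scaleC 4 (site k (unit4 p p) * site k J4 * site k (unit4 q q)) = site k (unit4 p q)"
        by (simp add: scaleC_scaleC scaleC_one)
      moreover have "scaleC 4 (site k (unit4 p p) * site k J4 * site k (unit4 q q)) \<in> Y"
        using Suc that Y_J by (intro Y_scale Y_mult) auto
      ultimately show ?thesis by simp
    qed
    have "x \<in> Y" if x: "x \<in> level (Suc k)" for x
    proof -
      obtain y where y: "\<And>p q. y p q \<in> level k" "x = (\<Sum>p<4. \<Sum>q<4. site k (unit4 p q) * y p q)"
        by (rule level_Suc_decompose[OF x]) blast
      show ?thesis unfolding y(2) using Suc y(1) by (intro Y_sum Y_mult units) auto
    qed
    moreover have "site (Suc k) (unit4 p p) \<in> Y" if "p < 4" for p
    proof -
      \<comment> \<open>Each sandwich selects the summand i = p and replaces its part at site k by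
        E_ll; the sum over l then removes that part.\<close>
      have "(\<Sum>l<4. site k (unit4 l p) * diagonal_pair k * site k (unit4 p l)) = site (Suc k) (unit4 p p)"
      proof -
        have inner: "site k (unit4 l p) * diagonal_pair k * site k (unit4 p l) = site (Suc k) (unit4 p p) * site k (unit4 l l)" for l
        proof -
          have "site k (unit4 l p) * (site (Suc k) (unit4 i i) * site k (unit4 i i)) * site k (unit4 p l)
            = site (Suc k) (unit4 i i) * (site k (unit4 l p) * site k (unit4 i i) * site k (unit4 p l))" for i
            by (simp add: site_commute[of k "Suc k" "unit4 l p" "unit4 i i"] flip: mult.assoc)
          then have "site k (unit4 l p) * diagonal_pair k * site k (unit4 p l)
            = (\<Sum>i<4. site (Suc k) (unit4 i i) * (site k (unit4 l p) * site k (unit4 i i) * site k (unit4 p l)))"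
            by (simp add: sum_distrib_left sum_distrib_right)
          also have "\<dots> = (\<Sum>i<4. if i = p then site (Suc k) (unit4 p p) * site k (unit4 l l) else 0)"
            by (intro sum.cong refl) (auto simp: unit_mult that)
          finally show ?thesis using that by simp
        qed
        have "(\<Sum>l<4. site k (unit4 l l)) = 1"
          unfolding site_sum site_one[of k, symmetric]
          by (rule site_cong) (auto simp: unit4_def diag4_def)
        then show ?thesis unfolding inner by (simp flip: sum_distrib_left)
      qed
      moreover have "(\<Sum>l<4. site k (unit4 l p) * diagonal_pair k * site k (unit4 p l)) \<in> Y"
        using that Suc.prems by (intro Y_sum Y_mult units Y_pair) auto
      ultimately show ?thesis by simp
    qed
    ultimately show ?case by blast
  qed

  \<comment> \<open>Since b is its own expectation, only the diagonal blocks of the conjugated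
    element survive, and these lie in \<open>Y\<close>.\<close>
  let ?c = "star (W m) * b * W m"
  have "?c \<in> level (Suc m)" by (intro level_mult level_star W_in_level b) simp_all
  then obtain y where y: "\<And>p q. y p q \<in> level m" "?c = (\<Sum>p<4. \<Sum>q<4. site m (unit4 p q) * y p q)"
    by (rule level_Suc_decompose) blast
  have deph: "dephase m (site m (unit4 p q) * y p q) = (if p = q then site m (unit4 p p) else 0) * y p q" for p q
  proof -
    have "site m (diag_part (unit4 p q)) = (if p = q then site m (unit4 p p) else 0)"
      by (rule local_alg_eqI) (auto simp: site.rep_eq diag_part_def diag4_def unit4_def zero_local_alg.rep_eq)
    then show ?thesis
      using dephase_mult[OF site_commute_level[OF y(1)[of p q] order_refl], where x = "site m (unit4 p q)"] by (simp only: dephase_site)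
  qed
  have "dephase m ?c \<in> Y"
    unfolding y(2) dephase_sum deph using *[OF order_refl] y(1) by (intro Y_sum Y_mult) (auto intro: Y_0)
  then show "b \<in> X" using Eb by (simp add: Y_def expect_def)
qed

lemma generators_in_fixed_alg:
  shows "site 0 (mult4 (mult4 u (diag4 d)) (adj4 u)) \<in> fixed_alg"
    and "diagonal_pair k \<in> fixed_alg"
    and "site (Suc k) J4 \<in> fixed_alg"
proof -
  show "site 0 (mult4 (mult4 u (diag4 d)) (adj4 u)) \<in> fixed_alg"
    by (rule conj_in_fixed_alg[of 1, OF conj_site_0[symmetric]]) (simp add: site_in_level)
  show "diagonal_pair k \<in> fixed_alg"
    by (rule conj_in_fixed_alg[of "Suc k", OF conj_J4[symmetric]]) (simp_all add: site_in_level)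
  show "site (Suc k) J4 \<in> fixed_alg"
    by (rule conj_in_fixed_alg[of "Suc (Suc k)", OF conj_diagonal_pair[symmetric]])
      (auto simp: diagonal_pair_eq intro: diag2_in_level)
qed

end

section \<open>The spin model generators\<close>

lemma embed_site:
  assumes "A \<in> carrier_mat 4 4"
  shows "embed (Suc k) (kronecker A (1\<^sub>m (4 ^ k))) = site k (\<lambda>p q. A $$ (p, q))"
proof (rule local_alg_eqI)
  fix i l
  define N :: nat where "N = 4 ^ Suc k"
  have N: "i mod N mod 4 ^ k = i mod 4 ^ k" "i mod N div 4 ^ k = digit k i" "i mod N < 4 * 4 ^ k" for i
    unfolding N_def by (rule mod_mod_cancel, simp, rule mod_power_div, simp)
  show "entry (embed (Suc k) (kronecker A (1\<^sub>m (4 ^ k)))) i l = entry (site k (\<lambda>p q. A $$ (p, q))) i l"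
    unfolding embed.rep_eq site.rep_eq same_other_digits_def N_def[symmetric]
    using assms by (auto simp: kronecker_def N)
qed

lemma embed_1_site:
  assumes "A \<in> carrier_mat 4 4"
  shows "embed 1 A = site 0 (\<lambda>p q. A $$ (p, q))"
  by (rule local_alg_eqI) (auto simp: embed.rep_eq site.rep_eq same_other_digits_def digit_def)

lemma matrix_unit_carrier: "matrix_unit p q \<in> carrier_mat 4 4"
  by (simp add: matrix_unit_def)

lemma site_matrix_unit: "site k (\<lambda>i j. matrix_unit p q $$ (i, j)) = site k (unit4 p q)"
  by (rule site_cong) (simp add: matrix_unit_def unit4_def)

lemma jones_proj_even: "jones_proj (2 * Suc k) = site (Suc k) J4"
proof -
  have "site (Suc k) (\<lambda>p q. J_mat $$ (p, q)) = site (Suc k) J4"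
    by (rule site_cong) (simp add: J_mat_def J4_def)
  then show ?thesis
    unfolding jones_proj_def using embed_site[of J_mat "Suc k"] by (simp add: J_mat_def)
qed

lemma jones_proj_odd: "jones_proj (Suc (2 * k)) = (\<Sum>i<4. site (Suc k) (unit4 i i) * site k (unit4 i i))"
proof -
  have "embed (Suc (Suc k)) (kronecker (matrix_unit p p) (kronecker (matrix_unit p p) (1\<^sub>m (4 ^ k))))
    = site (Suc k) (unit4 p p) * site k (unit4 p p)" for p
  proof (rule local_alg_eqI)
    fix i l
    let ?K = "kronecker (matrix_unit p p) (1\<^sub>m (4 ^ k))"
    have K: "?K \<in> carrier_mat (4 ^ Suc k) (4 ^ Suc k)" by (simp add: kronecker_def matrix_unit_def)
    define M where "M = (4 :: nat) ^ Suc k"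
    define N where "N = (4 :: nat) ^ Suc (Suc k)"
    have "site k (unit4 p p) = embed (Suc k) ?K"
      using embed_site[OF matrix_unit_carrier] site_matrix_unit by simp
    then have e: "entry (site k (unit4 p p)) (i mod 4 ^ Suc k) (l mod 4 ^ Suc k) = ?K $$ (i mod 4 ^ Suc k, l mod 4 ^ Suc k)"
      unfolding M_def[symmetric] by (simp only: embed.rep_eq flip: M_def) simp
    have N: "i mod N mod M = i mod M" "i mod N div M = digit (Suc k) i" "i mod N < 4 * M" for i
      unfolding N_def M_def by (rule mod_mod_cancel, simp, rule mod_power_div, simp)
    have "dim_row ?K = M" "dim_col ?K = M" using K by (auto simp: M_def)
    then have "entry (embed (Suc (Suc k)) (kronecker (matrix_unit p p) ?K)) i l
      = (if i div 4 ^ Suc (Suc k) = l div 4 ^ Suc (Suc k)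
         then unit4 p p (digit (Suc k) i) (digit (Suc k) l) * ?K $$ (i mod 4 ^ Suc k, l mod 4 ^ Suc k) else 0)"
      unfolding embed.rep_eq N_def[symmetric] M_def[symmetric] kronecker_def[of _ ?K]
      by (simp add: N digit_less) (simp add: matrix_unit_def N digit_less unit4_def)
    then show "entry (embed (Suc (Suc k)) (kronecker (matrix_unit p p) ?K)) i l
      = entry (site (Suc k) (unit4 p p) * site k (unit4 p p)) i l"
      by (simp only: site_mult_level_entry[OF site_in_level[OF lessI]] e)
  qed
  then show ?thesis by (simp add: jones_proj_def)
qed

definition hadamard_entry :: "complex \<Rightarrow> nat \<Rightarrow> nat \<Rightarrow> complex"
  where "hadamard_entry z i j = hadamard4 z $$ (i, j)"

lemma hadamard4_carrier: "hadamard4 z \<in> carrier_mat 4 4"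
  by (simp add: hadamard4_def mat_of_rows_list_def numeral_eq_Suc)

lemma hadamard_entry_values:
  "hadamard_entry z 0 0 = 1/2" "hadamard_entry z 0 1 = 1/2" "hadamard_entry z 0 2 = 1/2" "hadamard_entry z 0 3 = 1/2"
  "hadamard_entry z 1 0 = 1/2" "hadamard_entry z 1 1 = \<i> * z / 2" "hadamard_entry z 1 2 = -1/2" "hadamard_entry z 1 3 = - \<i> * z / 2"
  "hadamard_entry z 2 0 = 1/2" "hadamard_entry z 2 1 = -1/2" "hadamard_entry z 2 2 = 1/2" "hadamard_entry z 2 3 = -1/2"
  "hadamard_entry z 3 0 = 1/2" "hadamard_entry z 3 1 = - \<i> * z / 2" "hadamard_entry z 3 2 = -1/2" "hadamard_entry z 3 3 = \<i> * z / 2"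
  by (simp_all add: hadamard_entry_def hadamard4_def mat_of_rows_list_def numeral_eq_Suc)

text \<open>The symmetry \<open>shift\<close> holds for every z because rows 0 and 2, and likewise
  rows 1 and 3, agree in the even columns and are opposite in the odd ones.\<close>

lemma hadamard_hadamard_entry:
  assumes "cmod z = 1"
  shows "hadamard (hadamard_entry z)"
proof -
  have z: "z * cnj z = 1" using assms by (simp add: complex_norm_square[symmetric])
  then have z': "z * (cnj z * c) = c" for c by (simp flip: mult.assoc)
  have "\<forall>i<4. \<forall>j<4. hadamard_entry z i j * cnj (hadamard_entry z i j) = 1 / 4"
    unfolding all4 by (simp add: hadamard_entry_values z z' mult_ac del: One_nat_def)
  moreover have "\<forall>j<4. \<forall>l<4. (\<Sum>i<4. hadamard_entry z i j * cnj (hadamard_entry z i l)) = (if j = l then 1 else 0)"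
    unfolding all4 sum4 by (simp add: hadamard_entry_values z z' mult_ac del: One_nat_def)
  moreover have "\<forall>i<4. \<forall>k<4. (\<Sum>j<4. hadamard_entry z i j * cnj (hadamard_entry z k j)) = (if i = k then 1 else 0)"
    unfolding all4 sum4 by (simp add: hadamard_entry_values z z' mult_ac del: One_nat_def)
  moreover have "\<forall>i<4. \<forall>j<4. hadamard_entry z ((i + 2) mod 4) j = sgn_alt j * hadamard_entry z i j"
    unfolding all4 by (simp add: hadamard_entry_values sgn_alt_def del: One_nat_def add_2_eq_Suc add_2_eq_Suc')
  ultimately show ?thesis unfolding hadamard_def by blast
qed

lemma embed_hadamard_diag:
  assumes d: "d \<in> carrier_mat 4 4" "diagonal_mat d"
  shows "embed 1 (hadamard4 z * d * mat_adjoint (hadamard4 z))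
    = site 0 (mult4 (mult4 (hadamard_entry z) (diag4 (\<lambda>i. d $$ (i, i)))) (adj4 (hadamard_entry z)))"
proof -
  let ?h = "hadamard4 z"
  have adj: "mat_adjoint ?h \<in> carrier_mat 4 4" "\<And>i j. i < 4 \<Longrightarrow> j < 4 \<Longrightarrow> mat_adjoint ?h $$ (i, j) = cnj (?h $$ (j, i))"
    using hadamard4_carrier[of z] by (auto simp: mat_adjoint_def mat_of_rows_def)
  have mm: "(A * B) $$ (i, j) = (\<Sum>r<4. A $$ (i, r) * B $$ (r, j))"
    if "A \<in> carrier_mat 4 4" "B \<in> carrier_mat 4 4" "i < 4" "j < 4" for A B :: "complex mat" and i j
    using that by (auto simp: scalar_prod_def lessThan_atLeast0)
  have hd: "?h * d \<in> carrier_mat 4 4" by (rule mult_carrier_mat[OF hadamard4_carrier d(1)])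
  have dd: "d $$ (r, j) = diag4 (\<lambda>i. d $$ (i, i)) r j" if "r < 4" "j < 4" for r j
    using d that by (auto simp: diagonal_mat_def diag4_def)
  have "(?h * d * mat_adjoint ?h) $$ (i, j) = mult4 (mult4 (hadamard_entry z) (diag4 (\<lambda>i. d $$ (i, i)))) (adj4 (hadamard_entry z)) i j"
    if "i < 4" "j < 4" for i j
    unfolding mm[OF hd adj(1) that] mult4_def adj4_def hadamard_entry_def
    using that by (intro sum.cong refl) (simp add: mm[OF hadamard4_carrier d(1)] adj(2) dd)
  moreover have "?h * d * mat_adjoint ?h \<in> carrier_mat 4 4" using hd adj by simp
  ultimately show ?thesis unfolding embed_1_site[OF \<open>?h * d * mat_adjoint ?h \<in> carrier_mat 4 4\<close>] by (intro site_cong)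
qed

section \<open>Left and right multiplication on the GNS space\<close>

lemma Cauchy_const': "Cauchy (\<lambda>_. x)" for x :: "'a :: real_normed_vector"
  by (simp add: convergent_Cauchy convergent_const)

lemma to_completion_add: "to_completion (x + y) = to_completion x + to_completion y"
  unfolding to_completion.abs_eq
  by (rule plus_completion.abs_eq[OF Cauchy_self[OF Cauchy_const'] Cauchy_self[OF Cauchy_const'], symmetric])

lemma to_completion_scaleC: "to_completion (scaleC c x) = scaleC c (to_completion x)"
  unfolding to_completion.abs_eq
  by (rule scaleC_completion.abs_eq[OF Cauchy_self[OF Cauchy_const'], symmetric])

lemma to_completion_diff: "to_completion (x - y) = to_completion x - to_completion y"
  unfolding to_completion.abs_eq by (simp add: abs_completion_diff Cauchy_const')

lemma cinner_to_completion: "cinner (to_completion x) (to_completion y) = cinner x y"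
  unfolding to_completion.abs_eq
  by (simp add: cinner_completion.abs_eq[OF Cauchy_self[OF Cauchy_const'] Cauchy_self[OF Cauchy_const']])

lemma norm_to_completion: "norm (to_completion x) = norm x"
  using norm_to_completion_diff[of x 0] to_completion_diff[of x x] by (simp add: to_completion_diff[of 0 0, simplified])

lemma to_completion_approx:
  obtains X where "(\<lambda>n. to_completion (X n)) \<longlonglongrightarrow> z"
  by (metis obtain_Cauchy to_completion_LIMSEQ)

lemma blinfun_eq_on_dense:
  fixes S T :: gns_op
  assumes "\<And>x. blinfun_apply S (to_completion x) = blinfun_apply T (to_completion x)"
  shows "S = T"
proof (rule blinfun_eqI)
  fix z
  obtain X :: "nat \<Rightarrow> local_alg" where X: "(\<lambda>n. to_completion (X n)) \<longlonglongrightarrow> z" by (rule to_completion_approx)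
  have "(\<lambda>n. S (to_completion (X n))) \<longlonglongrightarrow> S z" "(\<lambda>n. T (to_completion (X n))) \<longlonglongrightarrow> T z"
    by (intro tendsto_intros X)+
  then show "S z = T z" unfolding assms by (rule LIMSEQ_unique)
qed

lemma tendsto_cinner:
  assumes "X \<longlonglongrightarrow> x" "Y \<longlonglongrightarrow> y"
  shows "(\<lambda>n. cinner (X n) (Y n)) \<longlonglongrightarrow> cinner x (y :: 'a :: complex_inner)"
  unfolding cinner_eq
  by (intro tendsto_Complex tendsto_inner tendsto_minus assms bounded_linear.tendsto[OF bounded_linear_scaleC])

lemma cinner_scaleC_right: "cinner x (scaleC c y) = cnj c * cinner x y" for x y :: "'a :: complex_inner"
  by (metis cinner_commute cinner_scaleC_left complex_cnj_mult)

lemma cinner_eq_on_dense: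
  fixes S T :: gns_op
  assumes "\<And>x y. cinner (S (to_completion x)) (to_completion y) = cinner (to_completion x) (T (to_completion y))"
  shows "cinner (S z) w = cinner z (T w)"
proof -
  obtain X :: "nat \<Rightarrow> local_alg" where X: "(\<lambda>n. to_completion (X n)) \<longlonglongrightarrow> z" by (rule to_completion_approx)
  obtain Y :: "nat \<Rightarrow> local_alg" where Y: "(\<lambda>n. to_completion (Y n)) \<longlonglongrightarrow> w" by (rule to_completion_approx)
  have "(\<lambda>n. cinner (S (to_completion (X n))) (to_completion (Y n))) \<longlonglongrightarrow> cinner (S z) w"
    "(\<lambda>n. cinner (to_completion (X n)) (T (to_completion (Y n)))) \<longlonglongrightarrow> cinner z (T w)"
    by (intro tendsto_cinner tendsto_intros X Y)+
  then show ?thesis unfolding assms by (rule LIMSEQ_unique)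
qed

lemma ntrace_commute: "ntrace (x * y) = ntrace (y * x)"
proof -
  obtain k where k: "at_level k (entry x)" "at_level k (entry y)"
    by (rule at_level2[OF entry_level entry_level])
  have l: "at_level k (entry (x * y))" "at_level k (entry (y * x))"
    using at_level_matmul k by (simp_all add: times_local_alg.rep_eq)
  have "(\<Sum>i<4 ^ k. \<Sum>r<4 ^ k. entry x i r * entry y r i) = (\<Sum>i<4 ^ k. \<Sum>r<4 ^ k. entry y i r * entry x r i)"
    by (subst sum.swap) (simp add: mult.commute)
  then show ?thesis
    unfolding ntrace_eq[OF l(1)] ntrace_eq[OF l(2)]
    by (simp add: level_trace_def times_local_alg.rep_eq matmul_less[OF k] matmul_less[OF k(2,1)])
qed

lemma cinner_mult_left: "cinner (a * x) y = cinner x (star a * y)" for x y :: local_alg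
  by (simp add: cinner_local_alg_def star_mult star_star mult.assoc)

lemma cinner_mult_right: "cinner (x * a) y = cinner x (y * star a)" for x y :: local_alg
  unfolding cinner_local_alg_def star_mult star_star mult.assoc
  by (metis ntrace_commute mult.assoc)

lemma norm_star: "norm (star x) = norm x"
proof -
  have "cinner (star x) (star x) = cinner x x"
    by (simp add: cinner_local_alg_def star_star ntrace_commute)
  then show ?thesis by (simp add: norm_local_alg_def inner_local_alg_def)
qed

text \<open>Traciality makes \<open>star\<close> isometric, which transfers the bound from left to
  right multiplication.\<close>

lemma bounded_linear_mult_right: "bounded_linear (\<lambda>x. x * a)" for a :: local_alg
proof -
  obtain K where K: "\<And>x. norm (star a * x) \<le> norm x * K" using norm_mult_local_alg by blast
  have "norm (x * a) \<le> norm x * K" for x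
    using K[of "star x"] by (metis norm_star star_mult)
  then show ?thesis
    by (rule bounded_linear_intro[rotated 2])
      (simp_all add: distrib_right mult_scaleC_left flip: scaleC_of_real)
qed

definition right_mult :: "local_alg \<Rightarrow> gns_op"
  where "right_mult a = Blinfun (completion_map (\<lambda>x. x * a))"

lemma right_mult_apply: "blinfun_apply (right_mult a) = completion_map (\<lambda>x. x * a)"
  unfolding right_mult_def
  by (rule bounded_linear_Blinfun_apply)
    (rule bounded_linear_completion_map[OF bounded_linear_mult_right mult_scaleC_left])

lemma right_mult_to_completion: "right_mult a (to_completion x) = to_completion (x * a)"
  unfolding right_mult_apply by (rule completion_map_to_completion[OF bounded_linear_mult_right])

lemma right_mult_vacuum: "right_mult a gns_vacuum = to_completion a"
  by (simp add: right_mult_to_completion)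

lemma gns_rep_vacuum: "gns_rep a gns_vacuum = to_completion a"
  by (simp add: gns_rep_to_completion)

lemma gns_rep_mult: "gns_rep (a * b) = gns_rep a o\<^sub>L gns_rep b"
  by (rule blinfun_eq_on_dense) (simp add: gns_rep_to_completion mult.assoc)

lemma gns_rep_one: "gns_rep 1 = id_blinfun"
  by (rule blinfun_eq_on_dense) (simp add: gns_rep_to_completion)

lemma gns_rep_add: "gns_rep (a + b) = gns_rep a + gns_rep b"
  by (rule blinfun_eq_on_dense) (simp add: gns_rep_to_completion distrib_right to_completion_add blinfun.add_left)

lemma op_scale_apply: "op_scale c T x = scaleC c (T x)"
  by (simp add: op_scale_def scaleC_op.rep_eq)

lemma gns_rep_scaleC': "gns_rep (scaleC c a) = op_scale c (gns_rep a)"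
  by (rule blinfun_eq_on_dense) (simp add: gns_rep_to_completion op_scale_apply mult_scaleC_left to_completion_scaleC)

lemma gns_rep_right_mult: "gns_rep a (right_mult b x) = right_mult b (gns_rep a x)"
proof -
  have "gns_rep a o\<^sub>L right_mult b = right_mult b o\<^sub>L gns_rep a"
    by (rule blinfun_eq_on_dense) (simp add: gns_rep_to_completion right_mult_to_completion mult.assoc)
  then show ?thesis by (metis blinfun_apply_blinfun_compose)
qed

lemma right_mult_mult: "right_mult (a * b) x = right_mult b (right_mult a x)"
proof -
  have "right_mult (a * b) = right_mult b o\<^sub>L right_mult a"
    by (rule blinfun_eq_on_dense) (simp add: right_mult_to_completion mult.assoc)
  then show ?thesis by simp
qed

lemma right_mult_one: "right_mult 1 = id_blinfun"
  by (rule blinfun_eq_on_dense) (simp add: right_mult_to_completion)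

text \<open>Scalars act as right multiplications, so an operator that commutes with all right
  multiplications is automatically complex linear, although its type gives only real
  linearity.\<close>

lemma right_mult_scalar: "right_mult (scaleC c 1) x = scaleC c x"
proof -
  have "right_mult (scaleC c 1) = scaleC_op c"
    by (rule blinfun_eq_on_dense) (simp add: right_mult_to_completion mult_scaleC_right scaleC_op.rep_eq to_completion_scaleC)
  then show ?thesis by (simp add: scaleC_op.rep_eq)
qed

lemma right_mult_scaleC: "right_mult a (scaleC c x) = scaleC c (right_mult a x)"
  unfolding right_mult_apply by (rule completion_map_scaleC[OF bounded_linear_mult_right mult_scaleC_left])

lemma cinner_gns_rep: "cinner (gns_rep a x) y = cinner x (gns_rep (star a) y)"
  by (rule cinner_eq_on_dense) (simp add: gns_rep_to_completion cinner_to_completion cinner_mult_left)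

lemma cinner_right_mult: "cinner (right_mult a x) y = cinner x (right_mult (star a) y)"
  by (rule cinner_eq_on_dense) (simp add: right_mult_to_completion cinner_to_completion cinner_mult_right)

section \<open>Bounded sequences and strong limits\<close>

lemma Cauchy_if_approx:
  fixes z :: "nat \<Rightarrow> 'a :: real_normed_vector"
  assumes "\<And>e. e > 0 \<Longrightarrow> \<exists>y. convergent y \<and> (\<forall>n. norm (z n - y n) \<le> e)"
  shows "Cauchy z"
  unfolding Cauchy_iff
proof (intro allI impI)
  fix e :: real assume "e > 0"
  then obtain y where y: "convergent y" "\<And>n. norm (z n - y n) \<le> e / 4" using assms[of "e / 4"] by auto
  obtain M where M: "\<And>m n. m \<ge> M \<Longrightarrow> n \<ge> M \<Longrightarrow> norm (y m - y n) < e / 4"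
    using convergent_Cauchy[OF y(1)] \<open>e > 0\<close> unfolding Cauchy_iff by (meson divide_pos_pos zero_less_numeral)
  have "norm (z m - z n) < e" if "m \<ge> M" "n \<ge> M" for m n
  proof -
    have "z m - z n = (z m - y m) + (y m - y n) - (z n - y n)" by simp
    also have "norm \<dots> \<le> norm (z m - y m) + norm (y m - y n) + norm (z n - y n)"
      by (meson add_right_mono norm_triangle_ineq norm_triangle_ineq4 order_trans)
    finally show ?thesis using y(2)[of m] y(2)[of n] M[OF that] \<open>e > 0\<close> by linarith
  qed
  then show "\<exists>M. \<forall>m\<ge>M. \<forall>n\<ge>M. norm (z m - z n) < e" by blast
qed

lemma strong_limit_exists:
  fixes T :: "nat \<Rightarrow> gns_op"
  assumes bound: "\<And>n. norm (T n) \<le> C"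
    and conv: "\<And>a. convergent (\<lambda>n. T n (to_completion a))"
  obtains S :: gns_op where "\<And>x. (\<lambda>n. T n x) \<longlonglongrightarrow> S x" "norm S \<le> C"
proof -
  have C: "0 \<le> C" using bound[of 0] norm_ge_zero order_trans by blast
  have "convergent (\<lambda>n. T n z)" for z
    unfolding Cauchy_convergent_iff[symmetric]
  proof (rule Cauchy_if_approx)
    fix e :: real assume "e > 0"
    then obtain a where a: "norm (z - to_completion a) < e / (C + 1)"
      using to_completion_dense[of "e / (C + 1)" z] C by auto
    have "norm (T n z - T n (to_completion a)) \<le> e" for n
    proof -
      have "norm (T n z - T n (to_completion a)) \<le> norm (T n) * norm (z - to_completion a)"
        by (metis blinfun.diff_right norm_blinfun)
      also have "\<dots> \<le> (C + 1) * (e / (C + 1))"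
        using a bound[of n] C by (intro mult_mono) auto
      finally show ?thesis using C by simp
    qed
    then show "\<exists>y. convergent y \<and> (\<forall>n. norm (T n z - y n) \<le> e)" using conv by blast
  qed
  then have lim: "(\<lambda>n. T n z) \<longlonglongrightarrow> lim (\<lambda>n. T n z)" for z by (simp add: convergent_LIMSEQ_iff)
  have nb: "norm (lim (\<lambda>n. T n z)) \<le> norm z * C" for z
  proof (rule LIMSEQ_le_const2[OF tendsto_norm[OF lim]])
    have "norm (T n z) \<le> norm z * C" for n
      using norm_blinfun[of "T n" z] mult_right_mono[OF bound[of n] norm_ge_zero[of z]] by (simp add: mult.commute)
    then show "\<exists>N. \<forall>n\<ge>N. norm (T n z) \<le> norm z * C" by blast
  qed
  have bl: "bounded_linear (\<lambda>z. lim (\<lambda>n. T n z))"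
  proof (rule bounded_linear_intro)
    fix x y r
    show "lim (\<lambda>n. T n (x + y)) = lim (\<lambda>n. T n x) + lim (\<lambda>n. T n y)"
      using tendsto_add[OF lim[of x] lim[of y]] by (intro limI) (simp add: blinfun.add_right)
    show "lim (\<lambda>n. T n (r *\<^sub>R x)) = r *\<^sub>R lim (\<lambda>n. T n x)"
      using tendsto_scaleR[OF tendsto_const lim[of x]] by (intro limI) (simp add: blinfun.scaleR_right)
  qed (rule nb)
  define S where "S = Blinfun (\<lambda>z. lim (\<lambda>n. T n z))"
  have S: "blinfun_apply S = (\<lambda>z. lim (\<lambda>n. T n z))"
    unfolding S_def by (rule bounded_linear_Blinfun_apply[OF bl])
  show ?thesis
  proof (rule that[of S])
    show "norm S \<le> C" using nb C by (intro norm_blinfun_bound) (simp_all add: S mult.commute)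
  qed (simp add: S lim)
qed

lemma sot_closed_limit:
  fixes T :: "nat \<Rightarrow> gns_op" and S :: gns_op
  assumes N: "closedin strong_operator_topology N" and T: "\<And>n. T n \<in> N"
    and lim: "\<And>x. (\<lambda>n. T n x) \<longlonglongrightarrow> S x"
  shows "S \<in> N"
proof (rule ccontr)
  assume "S \<notin> N"
  have "openin strong_operator_topology (UNIV - N)"
    using N by (simp add: closedin_def strong_operator_topology_topspace)
  then obtain V where V: "open V" "UNIV - N = blinfun_apply -` V"
    unfolding strong_operator_topology_def openin_pullback_topology by auto
  have "limitin (product_topology (\<lambda>_. euclidean) UNIV) (\<lambda>n. blinfun_apply (T n)) (blinfun_apply S) sequentially"
    unfolding limitin_componentwise using lim by simp
  then have "(\<lambda>n. blinfun_apply (T n)) \<longlonglongrightarrow> blinfun_apply S"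
    by (simp add: euclidean_product_topology)
  then have "eventually (\<lambda>n. blinfun_apply (T n) \<in> V) sequentially"
    using V \<open>S \<notin> N\<close> by (auto intro: topological_tendstoD)
  then obtain n where "blinfun_apply (T n) \<in> V" by (auto simp: eventually_sequentially)
  then show False using V(2) T[of n] by blast
qed

text \<open>Commutation relations with given operators are intersections of such sets; this yields
  closedness of both \<open>right_commutant\<close> and the later \<open>subfactor\<close>.\<close>

lemma sot_closed_eq_set:
  "closedin strong_operator_topology {T :: gns_op. S\<^sub>1 (T x) = S\<^sub>2 (T y)}"
  for S\<^sub>1 S\<^sub>2 :: gns_op
proof -
  have cont: "continuous_map strong_operator_topology euclidean (\<lambda>T :: gns_op. S\<^sub>1 (T x) - S\<^sub>2 (T y))"
    (is "continuous_map _ _ ?f")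
  proof -
    have "continuous_map strong_operator_topology euclidean (\<lambda>T :: gns_op. S (T z))" for S :: gns_op and z
    proof -
      have "continuous_map euclidean euclidean (blinfun_apply S)"
        by (simp add: linear_continuous_on blinfun.bounded_linear_right)
      from continuous_map_compose[OF strong_operator_topology_continuous_evaluation this]
      show ?thesis by (simp add: o_def)
    qed
    then show ?thesis by (intro continuous_map_diff)
  qed
  have "closedin strong_operator_topology {T \<in> topspace strong_operator_topology. ?f T \<in> {0}}"
    by (rule closedin_continuous_map_preimage[OF cont]) simp
  then show ?thesis by (simp add: strong_operator_topology_topspace)
qed

section \<open>The commutant of right multiplication\<close>

text \<open>This is the hyperfinite factor itself, as \<open>hyperfinite_factor_eq\<close> shows. As
  a family of equations, membership passes to strong limits.\<close>

definition right_commutant :: "gns_op set"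
  where "right_commutant = {T :: gns_op. \<forall>a x. T (right_mult a x) = right_mult a (T x)}"

lemma right_commutantD: "T \<in> right_commutant \<Longrightarrow> T (right_mult a x) = right_mult a (T x)"
  by (simp add: right_commutant_def)

lemma right_commutant_to_completion:
  "T \<in> right_commutant \<Longrightarrow> T (to_completion a) = right_mult a (T gns_vacuum)"
  by (metis right_commutantD right_mult_vacuum)

text \<open>T sends the vector of a local element a to \<open>right_mult a\<close> applied to its
  vacuum value, so this one value determines T on a dense set.\<close>

lemma vacuum_separating:
  assumes "S \<in> right_commutant" "T \<in> right_commutant" "S gns_vacuum = T gns_vacuum"
  shows "S = T"
  by (rule blinfun_eq_on_dense) (metis right_commutant_to_completion assms)

lemma right_commutant_scaleC: "T \<in> right_commutant \<Longrightarrow> T (scaleC c x) = scaleC c (T x)"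
  by (metis right_commutantD right_mult_scalar)

lemma complex_linear_op_right_commutant: "T \<in> right_commutant \<Longrightarrow> complex_linear_op T"
  by (simp add: complex_linear_op_def right_commutant_scaleC)

lemma right_commutant_closed:
  shows right_commutant_gns_rep: "gns_rep a \<in> right_commutant"
    and right_commutant_id: "id_blinfun \<in> right_commutant"
    and right_commutant_add: "S \<in> right_commutant \<Longrightarrow> T \<in> right_commutant \<Longrightarrow> S + T \<in> right_commutant"
    and right_commutant_op_scale: "S \<in> right_commutant \<Longrightarrow> op_scale c S \<in> right_commutant"
    and right_commutant_compose: "S \<in> right_commutant \<Longrightarrow> T \<in> right_commutant \<Longrightarrow> S o\<^sub>L T \<in> right_commutant"
  by (simp_all add: right_commutant_def gns_rep_right_mult blinfun.add_left blinfun.add_right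
      op_scale_apply right_mult_scaleC)

lemma closedin_right_commutant: "closedin strong_operator_topology right_commutant"
proof -
  have "right_commutant = (\<Inter>p. {T :: gns_op. id_blinfun (T (right_mult (fst p) (snd p))) = right_mult (fst p) (T (snd p))})"
    by (auto simp: right_commutant_def)
  also have "closedin strong_operator_topology \<dots>"
    by (intro closedin_INT sot_closed_eq_set) simp
  finally show ?thesis .
qed

text \<open>Right multiplications carry convergence from the vacuum to a dense set of vectors, and
  the norm bound extends it to all vectors.\<close>

lemma right_commutant_limit:
  assumes T: "\<And>n. T n \<in> right_commutant" and bound: "\<And>n. norm (T n) \<le> C"
    and conv: "(\<lambda>n. T n gns_vacuum) \<longlonglongrightarrow> z"
  obtains S where "S \<in> right_commutant" "\<And>x. (\<lambda>n. T n x) \<longlonglongrightarrow> S x" "norm S \<le> C" "S gns_vacuum = z"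
proof -
  have "convergent (\<lambda>n. T n (to_completion a))" for a
  proof -
    have "(\<lambda>n. T n (to_completion a)) = (\<lambda>n. right_mult a (T n gns_vacuum))"
      by (intro ext right_commutant_to_completion T)
    then show ?thesis
      using blinfun.tendsto[OF tendsto_const conv, of "right_mult a"] by (auto intro: convergentI)
  qed
  then obtain S :: gns_op where S: "\<And>x. (\<lambda>n. T n x) \<longlonglongrightarrow> S x" "norm S \<le> C"
    by (rule strong_limit_exists[OF bound]) blast
  show ?thesis
  proof (rule that)
    show "S \<in> right_commutant" by (rule sot_closed_limit[OF closedin_right_commutant T S(1)])
    show "S gns_vacuum = z" by (rule LIMSEQ_unique[OF S(1) conv])
  qed (rule S)+
qed

section \<open>Approximation by local elements without increase of the norm\<close>

lemma sum_digits: "(\<Sum>i<4 ^ Suc m. f i) = (\<Sum>p<4. \<Sum>i<4 ^ m. f (p * 4 ^ m + i :: nat))" for f :: "nat \<Rightarrow> 'a :: comm_monoid_add"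
proof -
  have "(\<Sum>i<4 ^ Suc m. f i) = (\<Sum>p<4. sum f {p * 4 ^ m..<p * 4 ^ m + 4 ^ m})"
    by (simp add: sum.nat_group)
  also have "\<dots> = (\<Sum>p<4. \<Sum>i<4 ^ m. f (p * 4 ^ m + i))"
  proof (rule sum.cong[OF refl])
    fix p
    show "sum f {p * 4 ^ m..<p * 4 ^ m + 4 ^ m} = (\<Sum>i<4 ^ m. f (p * 4 ^ m + i))"
      using sum.shift_bounds_nat_ivl[of f 0 "p * 4 ^ m" "4 ^ m"] by (simp add: lessThan_atLeast0 add.commute)
  qed
  finally show ?thesis .
qed

text \<open>Distinct blocks are orthogonal; the factor 1/4 is the normalisation of the trace on the
  added tensor factor.\<close>

lemma norm_level_Suc:
  assumes y: "\<And>p q. y p q \<in> level m"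
  shows "(norm (\<Sum>p<4. \<Sum>q<4. site m (unit4 p q) * y p q))\<^sup>2 = (\<Sum>p<4. \<Sum>q<4. (norm (y p q))\<^sup>2) / 4"
proof -
  let ?x = "\<Sum>p<4. \<Sum>q<4. site m (unit4 p q) * y p q"
  have lvl: "?x \<in> level (Suc m)"
    by (intro level_sum level_mult site_in_level level_mono[OF y]) simp_all
  have e: "entry ?x (p * 4 ^ m + i) (q * 4 ^ m + l) = entry (y p q) i l"
    if "p < 4" "q < 4" "i < 4 ^ m" "l < 4 ^ m" for p q i l
  proof -
    have d: "(p * 4 ^ m + i) div 4 ^ Suc m = 0" "(p * 4 ^ m + i) mod 4 ^ m = i" "digit m (p * 4 ^ m + i) = p"
      if "p < 4" "i < 4 ^ m" for p i
      using digits_of_sum[OF that, of 0] by simp_all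
    have "entry ?x (p * 4 ^ m + i) (q * 4 ^ m + l)
      = (\<Sum>p'<4. \<Sum>q'<4. if p = p' \<and> q = q' then entry (y p' q') i l else 0)"
      unfolding entry_sum site_mult_level_entry[OF y] d[OF that(1,3)] d[OF that(2,4)]
      by (intro sum.cong refl) (auto simp: unit4_def)
    also have "\<dots> = (\<Sum>p'<4. if p = p' then \<Sum>q'<4. if q = q' then entry (y p' q') i l else 0 else 0)"
      by (intro sum.cong refl) auto
    also have "\<dots> = entry (y p q) i l" using that by simp
    finally show ?thesis .
  qed
  have "(norm ?x)\<^sup>2 = (\<Sum>q<4. \<Sum>l<4 ^ m. \<Sum>p<4. \<Sum>i<4 ^ m. (cmod (entry (y p q) i l))\<^sup>2) / 4 ^ Suc m"
    unfolding norm_local_alg_eq[OF lvl[unfolded level_iff]] sum_digits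
    by (intro arg_cong[of _ _ "\<lambda>x. x / 4 ^ Suc m"] sum.cong refl) (simp only: lessThan_iff e)
  also have "(\<Sum>q<4. \<Sum>l<4 ^ m. \<Sum>p<4. \<Sum>i<4 ^ m. (cmod (entry (y p q) i l))\<^sup>2)
     = (\<Sum>q<4. \<Sum>p<4. \<Sum>l<4 ^ m. \<Sum>i<4 ^ m. (cmod (entry (y p q) i l))\<^sup>2)"
    by (rule sum.cong[OF refl]) (rule sum.swap)
  also have "\<dots> = (\<Sum>p<4. \<Sum>q<4. \<Sum>l<4 ^ m. \<Sum>i<4 ^ m. (cmod (entry (y p q) i l))\<^sup>2)"
    by (rule sum.swap)
  also have "\<dots> / 4 ^ Suc m = (\<Sum>p<4. \<Sum>q<4. (norm (y p q))\<^sup>2) / 4"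
    unfolding norm_local_alg_eq[OF y[unfolded level_iff]] by (simp flip: sum_divide_distrib)
  finally show ?thesis .
qed

text \<open>Tensoring with an identity does not change the operator norm: a acts on each block
  separately, so the bound climbs from level to level.\<close>

lemma mult_bound_from_level:
  assumes a: "a \<in> level k" and C: "0 \<le> C" and bound: "\<And>x. x \<in> level k \<Longrightarrow> norm (a * x) \<le> C * norm x"
  shows "norm (a * x) \<le> C * norm x"
proof -
  have "\<forall>x\<in>level m. norm (a * x) \<le> C * norm x" if "k \<le> m" for m
    using that
  proof (induction m rule: dec_induct)
    case base
    then show ?case using bound by blast
  next
    case (step m)
    show ?case
    proof
      fix x assume "x \<in> level (Suc m)"
      then obtain y where y: "\<And>p q. y p q \<in> level m" "x = (\<Sum>p<4. \<Sum>q<4. site m (unit4 p q) * y p q)"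
        by (rule level_Suc_decompose) blast
      have am: "a \<in> level m" by (rule level_mono[OF a step(1)])
      have "a * (site m (unit4 p q) * y p q) = site m (unit4 p q) * (a * y p q)" for p q
        by (simp add: site_commute_level[OF am order_refl, symmetric] flip: mult.assoc)
      then have ax: "a * x = (\<Sum>p<4. \<Sum>q<4. site m (unit4 p q) * (a * y p q))"
        unfolding y(2) sum_distrib_left by simp
      have "(norm (a * x))\<^sup>2 = (\<Sum>p<4. \<Sum>q<4. (norm (a * y p q))\<^sup>2) / 4"
        unfolding ax by (rule norm_level_Suc) (rule level_mult[OF am y(1)])
      also have "\<dots> \<le> (\<Sum>p<4. \<Sum>q<4. (C * norm (y p q))\<^sup>2) / 4"
        using step.IH y(1) by (intro divide_right_mono sum_mono power_mono) auto
      also have "\<dots> = C\<^sup>2 * ((\<Sum>p<4. \<Sum>q<4. (norm (y p q))\<^sup>2) / 4)"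
        by (simp add: power_mult_distrib flip: sum_distrib_left)
      also have "\<dots> = (C * norm x)\<^sup>2"
        unfolding y(2) power_mult_distrib by (simp only: norm_level_Suc[OF y(1)])
      finally show "norm (a * x) \<le> C * norm x"
        by (rule power2_le_imp_le) (simp add: C)
    qed
  qed
  moreover obtain m where "x \<in> level m" using ex_level by blast
  ultimately show ?thesis using level_mono[of x m "max k m"] by (metis max.cobounded1 max.cobounded2)
qed

lemma norm_gns_rep_le:
  assumes "0 \<le> C" "\<And>x. norm (a * x) \<le> C * norm x"
  shows "norm (gns_rep a) \<le> C"
proof (rule norm_blinfun_bound[OF assms(1)])
  fix z
  obtain X :: "nat \<Rightarrow> local_alg" where X: "(\<lambda>n. to_completion (X n)) \<longlonglongrightarrow> z" by (rule to_completion_approx)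
  show "norm (gns_rep a z) \<le> C * norm z"
  proof (rule LIMSEQ_le)
    show "(\<lambda>n. norm (gns_rep a (to_completion (X n)))) \<longlonglongrightarrow> norm (gns_rep a z)" by (intro tendsto_intros X)
    show "(\<lambda>n. C * norm (to_completion (X n))) \<longlonglongrightarrow> C * norm z" by (intro tendsto_intros X)
  qed (auto simp: gns_rep_to_completion norm_to_completion assms(2))
qed

lemma cinner_sum_right: "cinner x (\<Sum>p\<in>A. y p) = (\<Sum>p\<in>A. cinner x (y p))" for x :: "'a :: complex_inner"
proof -
  have "cinner x 0 = 0" using cinner_add_right[of x 0 0] by simp
  then show ?thesis by (induction A rule: infinite_finite_induct) (auto simp: cinner_add_right)
qed

lemma to_completion_zero: "to_completion 0 = 0"
  using to_completion_add[of 0 0] by simp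

lemma to_completion_sum: "to_completion (\<Sum>p\<in>A. y p) = (\<Sum>p\<in>A. to_completion (y p))"
  by (induction A rule: infinite_finite_induct) (auto simp: to_completion_add to_completion_zero)

lemma level_projection:
  obtains a where "a \<in> level k" "\<And>y. y \<in> level k \<Longrightarrow> cinner (to_completion a) (to_completion y) = cinner z (to_completion y)"
proof -
  define N :: nat where "N = 4 ^ k"
  define E where "E p q = embed k (mat N N (\<lambda>(i, j). if i = p \<and> j = q then 1 else 0))" for p q
  \<comment> \<open>The matrix units have squared norm 1/N in the normalised trace, hence the factor
    N.\<close>
  define a where "a = embed k (mat N N (\<lambda>(i, j). of_nat N * cinner z (to_completion (E i j))))"
  have emb: "embed k X \<in> level k" for X
    unfolding level_iff at_level_def by (simp add: embed.rep_eq)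
  have "cinner (to_completion a) (to_completion y) = cinner z (to_completion y)" if y: "y \<in> level k" for y
  proof -
    have "y = (\<Sum>p<N. \<Sum>q<N. scaleC (entry y p q) (E p q))" (is "_ = ?s")
    proof -
      have "entry y = entry ?s"
      proof (rule at_level_ext)
        show "at_level k (entry y)" using y by (simp add: level_iff)
        show "at_level k (entry ?s)" unfolding level_iff[symmetric] E_def by (intro level_sum level_scaleC emb)
        fix i j :: nat assume "i < 4 ^ k" "j < 4 ^ k"
        then have ij: "i < N" "j < N" by (simp_all add: N_def)
        have "entry ?s i j = (\<Sum>p<N. \<Sum>q<N. if i = p \<and> j = q then entry y p q else 0)"
          unfolding entry_sum scaleC_local_alg.rep_eq E_def embed.rep_eq N_def[symmetric]
          using ij by (intro sum.cong refl) simp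
        also have "\<dots> = (\<Sum>p<N. if i = p then \<Sum>q<N. if j = q then entry y p q else 0 else 0)"
          by (intro sum.cong refl) auto
        also have "\<dots> = entry y i j" using ij by simp
        finally show "entry y i j = entry ?s i j" by simp
      qed
      then show ?thesis by (simp only: entry_inject)
    qed
    then have "to_completion y = (\<Sum>p<N. \<Sum>q<N. scaleC (entry y p q) (to_completion (E p q)))"
      by (metis (no_types, lifting) sum.cong to_completion_sum to_completion_scaleC)
    then have "cinner z (to_completion y) = (\<Sum>p<N. \<Sum>q<N. cnj (entry y p q) * cinner z (to_completion (E p q)))"
      by (simp only: cinner_sum_right cinner_scaleC_right)
    also have "\<dots> = (\<Sum>q<N. \<Sum>p<N. cnj (entry y p q) * cinner z (to_completion (E p q)))"
      by (rule sum.swap)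
    also have "\<dots> = (\<Sum>q<N. \<Sum>p<N. entry a p q * cnj (entry y p q)) / of_nat N"
      unfolding sum_divide_distrib by (intro sum.cong refl) (simp add: a_def embed.rep_eq N_def)
    also have "\<dots> = cinner a y"
      using ntrace_star_times[of k a y] emb y by (simp add: cinner_local_alg_def a_def level_iff N_def)
    finally show ?thesis by (simp add: cinner_to_completion)
  qed
  then show ?thesis using emb by (intro that[of a]) (auto simp: a_def)
qed

lemma level_diff: "x \<in> level m \<Longrightarrow> y \<in> level m \<Longrightarrow> x - y \<in> level m"
  unfolding minus_local_alg_def
  by (rule level_add) (simp_all add: level_iff uminus_local_alg.rep_eq at_level_lin)

lemma norm_cinner_le: "cmod (cinner x y) \<le> norm x * norm y" for x y :: "'a :: complex_inner"
proof -
  have "cinner (scaleC (cnj (cinner x y)) x) y = of_real ((cmod (cinner x y))\<^sup>2)"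
    by (simp only: cinner_scaleC_left complex_norm_square mult.commute)
  then have "(cmod (cinner x y))\<^sup>2 = inner (scaleC (cnj (cinner x y)) x) y"
    by (metis Re_cinner Re_complex_of_real)
  also have "\<dots> \<le> norm (scaleC (cnj (cinner x y)) x) * norm y" by (rule norm_cauchy_schwarz)
  also have "\<dots> = cmod (cinner x y) * (norm x * norm y)" by (simp add: norm_scaleC)
  finally show ?thesis by (cases "cinner x y = 0") (auto simp: power2_eq_square)
qed

text \<open>The approximants a_k are the orthogonal projections of the vacuum value of T onto the
  levels. For x in level k, the product a_k x x* is again in level k, so |a_k x|^2 = <a_k, a_k x x*>
  = <T x, a_k x>. This bounds a_k by the norm of T on level k, hence everywhere. Density of the
  local elements gives convergence at the vacuum.\<close>

lemma right_commutant_approx: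
  assumes T: "T \<in> right_commutant"
  obtains a where "\<And>n. norm (gns_rep (a n)) \<le> norm T" "\<And>x. (\<lambda>n. gns_rep (a n) x) \<longlonglongrightarrow> T x"
proof -
  let ?z = "T gns_vacuum"
  have "\<forall>k. \<exists>a. a \<in> level k \<and> (\<forall>y\<in>level k. cinner (to_completion a) (to_completion y) = cinner ?z (to_completion y))"
    using level_projection by metis
  then obtain a where a: "\<And>k. a k \<in> level k"
    "\<And>k y. y \<in> level k \<Longrightarrow> cinner (to_completion (a k)) (to_completion y) = cinner ?z (to_completion y)"
    by metis
  have bnd: "norm (gns_rep (a k)) \<le> norm T" for k
  proof (rule norm_gns_rep_le[OF norm_ge_zero mult_bound_from_level[OF a(1) norm_ge_zero]])
    fix x assume x: "x \<in> level k"
    let ?y = "a k * x"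
    have y: "?y \<in> level k" by (rule level_mult[OF a(1) x])
    have "cinner (to_completion ?y) (to_completion ?y) = cinner (to_completion (a k)) (to_completion (?y * star x))"
      by (simp only: cinner_to_completion cinner_mult_right)
    also have "\<dots> = cinner ?z (to_completion (?y * star x))"
      by (rule a(2)) (intro level_mult level_star x y)
    also have "\<dots> = cinner (right_mult x ?z) (to_completion ?y)"
      by (simp only: cinner_right_mult right_mult_to_completion)
    also have "right_mult x ?z = T (to_completion x)"
      by (rule right_commutant_to_completion[OF T, symmetric])
    finally have "(norm ?y)\<^sup>2 = cmod (cinner (T (to_completion x)) (to_completion ?y))"
      by (metis cinner_self norm_of_real norm_to_completion abs_of_nonneg zero_le_power2)
    also have "\<dots> \<le> norm (T (to_completion x)) * norm ?y"
      using norm_cinner_le norm_to_completion by metis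
    also have "\<dots> \<le> (norm T * norm x) * norm ?y"
      using norm_blinfun[of T "to_completion x"] by (intro mult_right_mono) (simp_all add: norm_to_completion)
    finally show "norm ?y \<le> norm T * norm x"
      by (cases "norm ?y = 0") (auto simp: power2_eq_square)
  qed
  have "(\<lambda>k. to_completion (a k)) \<longlonglongrightarrow> ?z"
  proof (rule LIMSEQ_I)
    fix e :: real assume "0 < e"
    then obtain y where y: "norm (?z - to_completion y) < e" using to_completion_dense by blast
    obtain m where m: "y \<in> level m" using ex_level by blast
    have "norm (to_completion (a k) - ?z) < e" if "k \<ge> m" for k
    proof -
      have yk: "y \<in> level k" by (rule level_mono[OF m that])
      let ?d = "?z - to_completion (a k)" and ?w = "to_completion (a k - y)"
      have "a k - y \<in> level k" by (rule level_diff[OF a(1) yk])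
      then have "cinner ?d ?w = 0" using a(2) by (simp add: cinner_diff_left)
      then have orth: "inner ?d ?w = 0" by (metis Re_cinner zero_complex.simps(1))
      have eq: "?z - to_completion y = ?d + ?w" by (simp add: to_completion_diff)
      have "(norm (?z - to_completion y))\<^sup>2 = (norm ?d)\<^sup>2 + (norm ?w)\<^sup>2"
        unfolding eq using orth by (simp only: power2_norm_eq_inner inner_add_left inner_add_right inner_commute)
      then have "(norm ?d)\<^sup>2 \<le> (norm (?z - to_completion y))\<^sup>2" by simp
      then have "norm ?d \<le> norm (?z - to_completion y)" by (rule power2_le_imp_le) simp
      then show ?thesis using y by (simp add: norm_minus_commute)
    qed
    then show "\<exists>m. \<forall>k\<ge>m. norm (to_completion (a k) - ?z) < e" by blast
  qed
  then have "(\<lambda>k. gns_rep (a k) gns_vacuum) \<longlonglongrightarrow> ?z" by (simp add: gns_rep_vacuum)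
  then obtain S where S: "S \<in> right_commutant" "\<And>x. (\<lambda>k. gns_rep (a k) x) \<longlonglongrightarrow> S x" "S gns_vacuum = ?z"
    by (rule right_commutant_limit[OF right_commutant_gns_rep bnd]) blast
  have "S = T" by (rule vacuum_separating[OF S(1) T S(3)])
  with S(2) bnd show ?thesis by (intro that[of a]) simp_all
qed

lemma gns_rep_norm_star: "norm (gns_rep (star a)) \<le> norm (gns_rep a)"
proof (rule norm_blinfun_bound[OF norm_ge_zero])
  fix x
  let ?y = "gns_rep (star a) x"
  have "cinner ?y ?y = cinner x (gns_rep a ?y)" by (simp add: cinner_gns_rep star_star)
  then have "(norm ?y)\<^sup>2 = cmod (cinner x (gns_rep a ?y))"
    by (metis cinner_self norm_of_real abs_of_nonneg zero_le_power2)
  also have "\<dots> \<le> norm x * (norm (gns_rep a) * norm ?y)"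
    by (rule order_trans[OF norm_cinner_le mult_left_mono[OF norm_blinfun norm_ge_zero]])
  finally show "norm ?y \<le> norm (gns_rep a) * norm x"
    by (cases "norm ?y = 0") (auto simp: power2_eq_square mult.commute)
qed

text \<open>The adjoints of the approximants converge as well: \<open>star\<close> preserves the GNS
  norm, so their vacuum vectors are Cauchy, and their operator norms stay bounded.\<close>

lemma right_commutant_adjoint:
  assumes T: "T \<in> right_commutant"
  shows "op_adjoint T \<in> right_commutant" and "cinner (T x) y = cinner x (op_adjoint T y)"
proof -
  obtain a where a: "\<And>n. norm (gns_rep (a n)) \<le> norm T" "\<And>x. (\<lambda>n. gns_rep (a n) x) \<longlonglongrightarrow> T x"
    by (rule right_commutant_approx[OF T]) blast
  have "(\<lambda>n. to_completion (a n)) \<longlonglongrightarrow> T gns_vacuum" using a(2)[of gns_vacuum] by (simp add: gns_rep_vacuum)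
  then have "Cauchy (\<lambda>n. to_completion (a n))" by (rule LIMSEQ_imp_Cauchy)
  then have "Cauchy (\<lambda>n. to_completion (star (a n)))"
    by (simp add: Cauchy_iff norm_to_completion_diff norm_star flip: star_diff)
  then obtain z where z: "(\<lambda>n. gns_rep (star (a n)) gns_vacuum) \<longlonglongrightarrow> z"
    by (auto simp: Cauchy_convergent_iff convergent_def gns_rep_vacuum)
  have bnd: "norm (gns_rep (star (a n))) \<le> norm T" for n
    by (rule order_trans[OF gns_rep_norm_star a(1)])
  obtain S where S: "S \<in> right_commutant" "\<And>x. (\<lambda>n. gns_rep (star (a n)) x) \<longlonglongrightarrow> S x"
    by (rule right_commutant_limit[OF right_commutant_gns_rep bnd z]) blast
  have adj: "cinner (T x) y = cinner x (S y)" for x y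
  proof (rule LIMSEQ_unique)
    show "(\<lambda>n. cinner (gns_rep (a n) x) y) \<longlonglongrightarrow> cinner (T x) y"
      by (rule tendsto_cinner[OF a(2) tendsto_const])
    show "(\<lambda>n. cinner (gns_rep (a n) x) y) \<longlonglongrightarrow> cinner x (S y)"
      unfolding cinner_gns_rep by (rule tendsto_cinner[OF tendsto_const S(2)])
  qed
  have "op_adjoint T = S"
    unfolding op_adjoint_def
  proof (rule the_equality)
    fix S' :: gns_op assume S': "\<forall>x y. cinner (T x) y = cinner x (S' y)"
    show "S' = S"
    proof (rule blinfun_eqI)
      fix y
      have "cinner (S' y - S y) (S' y - S y) = 0"
        using S' adj by (simp add: cinner_diff_right)
      then show "S' y = S y" unfolding cinner_self by simp
    qed
  qed (use adj in blast)
  then show "op_adjoint T \<in> right_commutant" "cinner (T x) y = cinner x (op_adjoint T y)"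
    using S(1) adj by simp_all
qed

lemma tower_union: "(\<Union>k. tower_odd k \<union> tower_even k) = UNIV"
proof -
  have "x \<in> (\<Union>k. tower_even k)" for x
  proof -
    obtain k where k: "x \<in> level (Suc k)" using ex_level_Suc by blast
    have "x = embed (Suc k) (mat (4 ^ Suc k) (4 ^ Suc k) (\<lambda>(i, j). entry x i j))"
      by (rule local_alg_eqI) (subst at_levelD[OF k[unfolded level_iff]], simp add: embed.rep_eq del: power_Suc)
    then have "x \<in> tower_even k" by (auto simp: tower_even_def)
    then show ?thesis by blast
  qed
  then show ?thesis by blast
qed

lemma hyperfinite_factor_eq: "hyperfinite_factor = right_commutant"
proof
  have "range gns_rep \<subseteq> right_commutant" using right_commutant_gns_rep by blast
  then show "hyperfinite_factor \<subseteq> right_commutant"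
    unfolding hyperfinite_factor_def tower_union by (rule closure_of_minimal[OF _ closedin_right_commutant])
  show "right_commutant \<subseteq> hyperfinite_factor"
  proof
    fix T assume "T \<in> right_commutant"
    then obtain a where a: "\<And>x. (\<lambda>n. gns_rep (a n) x) \<longlonglongrightarrow> T x" by (rule right_commutant_approx) blast
    note closure_of_subset[of "range gns_rep" strong_operator_topology,
        unfolded strong_operator_topology_topspace, OF subset_UNIV]
    then show "T \<in> hyperfinite_factor"
      unfolding hyperfinite_factor_def tower_union
      by (intro sot_closed_limit[OF closedin_closure_of _ a]) blast
  qed
qed

section \<open>Subfactors cut out by a tower of commuting involutions\<close>

lemma norm_gns_rep_unitary: "star v * v = 1 \<Longrightarrow> norm (gns_rep v x) = norm x"
proof -
  assume v: "star v * v = 1"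
  have "cinner (gns_rep v x) (gns_rep v x) = cinner x (gns_rep (star v * v) x)"
    by (simp add: cinner_gns_rep gns_rep_mult)
  then have "(norm (gns_rep v x))\<^sup>2 = (norm x)\<^sup>2"
    unfolding v gns_rep_one by (simp only: cinner_self of_real_eq_iff id_blinfun.rep_eq id_apply)
  then show ?thesis by simp
qed

lemma norm_right_mult_unitary: "v * star v = 1 \<Longrightarrow> norm (right_mult v x) = norm x"
proof -
  assume v: "v * star v = 1"
  have "cinner (right_mult v x) (right_mult v x) = cinner x (right_mult (v * star v) x)"
    by (simp add: cinner_right_mult right_mult_mult)
  then have "(norm (right_mult v x))\<^sup>2 = (norm x)\<^sup>2"
    unfolding v right_mult_one by (simp only: cinner_self of_real_eq_iff id_blinfun.rep_eq id_apply)
  then show ?thesis by simp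
qed

lemma norm_four_average_le:
  fixes x1 :: "'a :: real_normed_vector"
  assumes "norm x1 \<le> C" "norm x2 \<le> C" "norm x3 \<le> C" "norm x4 \<le> C"
  shows "norm ((1 / 4 :: real) *\<^sub>R (x1 + x2 + x3 + x4)) \<le> C"
proof -
  have "norm (x1 + x2 + x3 + x4) \<le> norm x1 + norm x2 + norm x3 + norm x4"
    by (meson add_right_mono norm_triangle_ineq order_trans)
  then show ?thesis using assms by simp
qed

text \<open>Isolates what the expectation onto the subfactor rests on. \<open>stable\<close> is the
  consistency supplied by the commuting squares.\<close>

locale involution_tower =
  fixes s g :: "nat \<Rightarrow> local_alg"
  assumes involutions: "commuting_involutions (s n) (g n)"
    and stable: "\<exists>m. \<forall>n\<ge>m. average (s n) (g n) a = average (s m) (g m) a"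
begin

lemma relations:
  "s n * s n = 1" "g n * g n = 1" "star (s n) = s n" "star (g n) = g n" "g n * s n = s n * g n"
  using involutions[of n] by (simp_all add: commuting_involutions_def)

lemma eventually_constant_average:
  obtains m c where "\<And>n. n \<ge> m \<Longrightarrow> average (s n) (g n) a = c"
  using stable by blast

lemma unitaries: "star (s n * g n) * (s n * g n) = 1" "(s n * g n) * star (s n * g n) = 1"
proof -
  have "g n * (s n * s n) * g n = 1" "s n * (g n * g n) * s n = 1" by (simp_all add: relations)
  then show "star (s n * g n) * (s n * g n) = 1" "(s n * g n) * star (s n * g n) = 1"
    by (simp_all add: star_mult relations(3,4) mult.assoc)
qed

text \<open>The projections \<open>proj n\<close> converge strongly to the projection \<open>proj_lim\<close> onto the closure
  of the vectors coming from the fixed algebra.\<close>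

definition proj :: "nat \<Rightarrow> gns_op"
  where "proj n = (1 / 4 :: real) *\<^sub>R (id_blinfun + (gns_rep (s n) o\<^sub>L right_mult (s n))
    + (gns_rep (g n) o\<^sub>L right_mult (g n)) + (gns_rep (s n * g n) o\<^sub>L right_mult (g n * s n)))"

text \<open>The counterpart of \<open>proj n\<close> on operators. The two agree at the vacuum
  because an operator commuting with right multiplications trades a left factor at the vacuum for a
  right one.\<close>

definition conj_average :: "nat \<Rightarrow> gns_op \<Rightarrow> gns_op"
  where "conj_average n T = (1 / 4 :: real) *\<^sub>R (T + (gns_rep (s n) o\<^sub>L T o\<^sub>L gns_rep (s n))
    + (gns_rep (g n) o\<^sub>L T o\<^sub>L gns_rep (g n)) + (gns_rep (s n * g n) o\<^sub>L T o\<^sub>L gns_rep (g n * s n)))"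

definition fixed :: "local_alg set"
  where "fixed = {b. \<exists>m. \<forall>n\<ge>m. s n * b = b * s n \<and> g n * b = b * g n}"

lemma to_completion_scaleR: "to_completion (scaleC (complex_of_real r) x) = r *\<^sub>R to_completion x"
  unfolding to_completion_scaleC by (rule scaleC_of_real)

lemma proj_to_completion: "proj n (to_completion a) = to_completion (average (s n) (g n) a)"
proof -
  have "average (s n) (g n) a = scaleC (complex_of_real (1 / 4))
    (a + s n * a * s n + g n * a * g n + s n * g n * a * (g n * s n))"
    by (simp add: average_def mult.assoc)
  then show ?thesis
    by (simp only: to_completion_scaleR) (simp add: proj_def blinfun.add_left blinfun.scaleR_left
      gns_rep_to_completion right_mult_to_completion to_completion_add mult.assoc)
qed

lemma norm_proj_apply: "norm (proj n x) \<le> norm x"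
  unfolding proj_def blinfun.add_left blinfun.scaleR_left
proof (rule norm_four_average_le)
  have "(g n * s n) * star (g n * s n) = 1"
    using unitaries(2)[of n] by (simp add: relations)
  then show "norm ((gns_rep (s n * g n) o\<^sub>L right_mult (g n * s n)) x) \<le> norm x"
    by (simp add: norm_gns_rep_unitary[OF unitaries(1)] norm_right_mult_unitary)
qed (simp_all add: norm_gns_rep_unitary norm_right_mult_unitary relations)

lemma proj_converges: "\<exists>P :: gns_op. \<forall>x. (\<lambda>n. proj n x) \<longlonglongrightarrow> P x"
proof -
  have bnd: "norm (proj n) \<le> 1" for n
    using norm_proj_apply by (intro norm_blinfun_bound) auto
  have conv: "convergent (\<lambda>n. proj n (to_completion a))" for a
  proof -
    obtain m c where "\<And>n. n \<ge> m \<Longrightarrow> average (s n) (g n) a = c" by (rule eventually_constant_average) blast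
    then show ?thesis unfolding proj_to_completion
      by (intro convergentI[of _ "to_completion c"] tendsto_eventually) (auto simp: eventually_sequentially)
  qed
  show ?thesis by (rule strong_limit_exists[OF bnd conv]) blast
qed

definition proj_lim :: gns_op
  where "proj_lim = (SOME P. \<forall>x. (\<lambda>n. proj n x) \<longlonglongrightarrow> blinfun_apply P x)"

lemma proj_tendsto: "(\<lambda>n. proj n x) \<longlonglongrightarrow> proj_lim x"
  unfolding proj_lim_def using someI_ex[OF proj_converges] by blast

lemma proj_lim_to_completion:
  "\<exists>m. \<forall>n\<ge>m. proj_lim (to_completion a) = to_completion (average (s n) (g n) a)"
proof -
  obtain m c where m: "\<And>n. n \<ge> m \<Longrightarrow> average (s n) (g n) a = c" by (rule eventually_constant_average) blast
  have "(\<lambda>n. proj n (to_completion a)) \<longlonglongrightarrow> to_completion c"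
    unfolding proj_to_completion
    by (intro tendsto_eventually) (use m in \<open>auto simp: eventually_sequentially\<close>)
  then have "proj_lim (to_completion a) = to_completion c"
    using proj_tendsto LIMSEQ_unique by blast
  then show ?thesis using m by auto
qed

text \<open>Each summand is conjugation by a unitary, with adjoint the conjugation by its inverse;
  the four unitaries here are their own inverses.\<close>

lemma cinner_proj: "cinner (proj n x) y = cinner x (proj n y)"
proof (rule cinner_eq_on_dense)
  fix x y
  have L: "cinner (c * x * star c) y = cinner x (star c * y * c)" for c and x y :: local_alg
    using cinner_mult_right[of "c * x" "star c" y] cinner_mult_left[of c x "y * c"]
    by (simp add: star_star mult.assoc)
  have cr: "cinner (scaleC (1 / 4) x) y = cinner x (scaleC (1 / 4) y)" for x y :: local_alg
    by (simp add: cinner_scaleC_left cinner_scaleC_right)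
  have *: "average (s n) (g n) z = scaleC (1 / 4)
    (z + s n * z * star (s n) + g n * z * star (g n) + (s n * g n) * z * star (s n * g n))"
    "average (s n) (g n) z = scaleC (1 / 4)
    (z + star (s n) * z * s n + star (g n) * z * g n + star (s n * g n) * z * (s n * g n))" for z
    by (simp_all add: average_def star_mult relations mult.assoc)
  show "cinner (proj n (to_completion x)) (to_completion y) = cinner (to_completion x) (proj n (to_completion y))"
    unfolding proj_to_completion cinner_to_completion *(1)[of x] *(2)[of y]
    by (simp only: cr cinner_add_left cinner_add_right L) (simp only: scaleC_add_right cinner_add_right mult_scaleC_left mult_scaleC_right)
qed

lemma cinner_proj_lim: "cinner (proj_lim x) y = cinner x (proj_lim y)"
proof (rule LIMSEQ_unique)
  show "(\<lambda>n. cinner (proj n x) y) \<longlonglongrightarrow> cinner (proj_lim x) y"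
    by (rule tendsto_cinner[OF proj_tendsto tendsto_const])
  show "(\<lambda>n. cinner (proj n x) y) \<longlonglongrightarrow> cinner x (proj_lim y)"
    unfolding cinner_proj by (rule tendsto_cinner[OF tendsto_const proj_tendsto])
qed

lemma proj_lim_fixed: "b \<in> fixed \<Longrightarrow> proj_lim (to_completion b) = to_completion b"
proof -
  assume "b \<in> fixed"
  then obtain m where m: "\<forall>n\<ge>m. s n * b = b * s n \<and> g n * b = b * g n" by (auto simp: fixed_def)
  obtain m' where m': "\<forall>n\<ge>m'. proj_lim (to_completion b) = to_completion (average (s n) (g n) b)"
    using proj_lim_to_completion by blast
  show ?thesis
  proof -
    let ?n = "max m m'"
    have "average (s ?n) (g ?n) b = b" by (rule average_eq[OF involutions]) (use m in auto)
    then show ?thesis using m'[rule_format, of ?n] by simp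
  qed
qed

lemma one_fixed: "1 \<in> fixed"
  by (simp add: fixed_def)

lemma proj_lim_vacuum: "proj_lim gns_vacuum = gns_vacuum"
  by (rule proj_lim_fixed[OF one_fixed])

lemma proj_lim_scaleC: "proj_lim (scaleC c x) = scaleC c (proj_lim x)"
proof (rule LIMSEQ_unique[OF proj_tendsto])
  have "proj n (scaleC c x) = scaleC c (proj n x)" for n
    by (simp add: proj_def blinfun.add_left blinfun.scaleR_left right_mult_scaleC gns_rep_scaleC scaleC_add_right
        scaleC_scaleC mult.commute flip: scaleC_of_real)
  then show "(\<lambda>n. proj n (scaleC c x)) \<longlonglongrightarrow> scaleC c (proj_lim x)"
    using bounded_linear.tendsto[OF bounded_linear_scaleC proj_tendsto] by simp
qed

text \<open>Averaging is a bimodule map over whatever commutes with both involutions, and b does so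
  for all large n.\<close>

lemma fixed_commute_proj_lim:
  assumes "b \<in> fixed"
  shows "gns_rep b (proj_lim x) = proj_lim (gns_rep b x)"
    and "right_mult b (proj_lim x) = proj_lim (right_mult b x)"
proof -
  obtain m where m: "\<And>n. n \<ge> m \<Longrightarrow> s n * b = b * s n \<and> g n * b = b * g n" using assms by (auto simp: fixed_def)
  have avg: "average (s n) (g n) (b * a) = b * average (s n) (g n) a"
    "average (s n) (g n) (a * b) = average (s n) (g n) a * b" if "n \<ge> m" for n a
  proof -
    have c: "s n * b = b * s n" "g n * b = b * g n" using m[OF that] by auto
    then have c': "s n * (b * z) = b * (s n * z)" "g n * (b * z) = b * (g n * z)" for z
      by (simp_all flip: mult.assoc)
    show "average (s n) (g n) (b * a) = b * average (s n) (g n) a"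
      "average (s n) (g n) (a * b) = average (s n) (g n) a * b"
      by (simp_all add: average_def mult_scaleC_right mult_scaleC_left distrib_left distrib_right mult.assoc c c')
  qed
  have "gns_rep b o\<^sub>L proj_lim = proj_lim o\<^sub>L gns_rep b" "right_mult b o\<^sub>L proj_lim = proj_lim o\<^sub>L right_mult b"
  proof -
    show "gns_rep b o\<^sub>L proj_lim = proj_lim o\<^sub>L gns_rep b"
    proof (rule blinfun_eq_on_dense)
      fix a
      obtain m1 where m1: "\<forall>n\<ge>m1. proj_lim (to_completion a) = to_completion (average (s n) (g n) a)"
        using proj_lim_to_completion by blast
      obtain m2 where m2: "\<forall>n\<ge>m2. proj_lim (to_completion (b * a)) = to_completion (average (s n) (g n) (b * a))"
        using proj_lim_to_completion by blast
      let ?n = "max m (max m1 m2)"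
      show "(gns_rep b o\<^sub>L proj_lim) (to_completion a) = (proj_lim o\<^sub>L gns_rep b) (to_completion a)"
        using m1[rule_format, of ?n] m2[rule_format, of ?n] avg(1)[of ?n a]
        by (simp add: gns_rep_to_completion)
    qed
    show "right_mult b o\<^sub>L proj_lim = proj_lim o\<^sub>L right_mult b"
    proof (rule blinfun_eq_on_dense)
      fix a
      obtain m1 where m1: "\<forall>n\<ge>m1. proj_lim (to_completion a) = to_completion (average (s n) (g n) a)"
        using proj_lim_to_completion by blast
      obtain m2 where m2: "\<forall>n\<ge>m2. proj_lim (to_completion (a * b)) = to_completion (average (s n) (g n) (a * b))"
        using proj_lim_to_completion by blast
      let ?n = "max m (max m1 m2)"
      show "(right_mult b o\<^sub>L proj_lim) (to_completion a) = (proj_lim o\<^sub>L right_mult b) (to_completion a)"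
        using m1[rule_format, of ?n] m2[rule_format, of ?n] avg(2)[of ?n a]
        by (simp add: right_mult_to_completion)
    qed
  qed
  then show "gns_rep b (proj_lim x) = proj_lim (gns_rep b x)" "right_mult b (proj_lim x) = proj_lim (right_mult b x)"
    by (metis blinfun_apply_blinfun_compose)+
qed

text \<open>\<open>proj_lim\<close> plays the role of the Jones projection of the subfactor. In a
  finite von Neumann algebra an element lies in a subalgebra exactly when it commutes with that
  projection, and this form makes closure under sums, products and strong limits immediate.\<close>

definition subfactor :: "gns_op set"
  where "subfactor = {T \<in> right_commutant. \<forall>x. T (proj_lim x) = proj_lim (T x)}"

lemma gns_rep_fixed_subfactor: "b \<in> fixed \<Longrightarrow> gns_rep b \<in> subfactor"
  by (simp add: subfactor_def right_commutant_gns_rep fixed_commute_proj_lim)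

lemma von_neumann_algebra_subfactor: "von_neumann_algebra subfactor"
  unfolding von_neumann_algebra_def
proof (intro conjI ballI allI)
  fix S assume S: "S \<in> subfactor"
  then have S': "S \<in> right_commutant" "\<And>x. S (proj_lim x) = proj_lim (S x)" by (auto simp: subfactor_def)
  show "complex_linear_op S" by (rule complex_linear_op_right_commutant[OF S'(1)])
  show "op_adjoint S \<in> subfactor"
    unfolding subfactor_def
  proof (intro CollectI conjI allI)
    show "op_adjoint S \<in> right_commutant" by (rule right_commutant_adjoint[OF S'(1)])
    note adj = right_commutant_adjoint(2)[OF S'(1)]
    fix y
    let ?d = "op_adjoint S (proj_lim y) - proj_lim (op_adjoint S y)"
    have "cinner x (op_adjoint S (proj_lim y)) = cinner x (proj_lim (op_adjoint S y))" for x
    proof -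
      have "cinner x (op_adjoint S (proj_lim y)) = cinner (proj_lim (S x)) y"
        by (simp only: adj[symmetric] cinner_proj_lim)
      also have "\<dots> = cinner (proj_lim x) (op_adjoint S y)" by (simp only: S'(2)[symmetric] adj)
      finally show ?thesis by (simp only: cinner_proj_lim)
    qed
    then have "cinner ?d ?d = 0" by (simp add: cinner_diff_right)
    then show "op_adjoint S (proj_lim y) = proj_lim (op_adjoint S y)" unfolding cinner_self by simp
  qed
  show "op_scale c S \<in> subfactor" for c
    using S by (simp add: subfactor_def right_commutant_op_scale op_scale_apply proj_lim_scaleC)
  show "S + T \<in> subfactor" "S o\<^sub>L T \<in> subfactor" if "T \<in> subfactor" for T
    using S that by (simp_all add: subfactor_def right_commutant_add right_commutant_compose blinfun.add_left blinfun.add_right)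
next
  show "id_blinfun \<in> subfactor" by (simp add: subfactor_def right_commutant_id)
  have "subfactor = right_commutant \<inter> (\<Inter>x. {T :: gns_op. id_blinfun (T (proj_lim x)) = proj_lim (T x)})"
    by (auto simp: subfactor_def)
  also have "closedin strong_operator_topology \<dots>"
    by (intro closedin_Int closedin_right_commutant closedin_INT sot_closed_eq_set) simp
  finally show "closedin strong_operator_topology subfactor" .
qed

lemma subfactor_vacuum: "T \<in> subfactor \<Longrightarrow> proj_lim (T gns_vacuum) = T gns_vacuum"
  using proj_lim_vacuum by (simp add: subfactor_def) metis

section \<open>The trace-preserving expectation onto the subfactor\<close>

lemma conj_average_vacuum:
  assumes "T \<in> right_commutant"
  shows "conj_average n T gns_vacuum = proj n (T gns_vacuum)"
proof -
  have "T (gns_rep v gns_vacuum) = right_mult v (T gns_vacuum)" for v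
    using assms by (metis gns_rep_vacuum right_commutant_to_completion)
  then show ?thesis by (simp add: conj_average_def proj_def blinfun.add_left blinfun.scaleR_left)
qed

lemma norm_conj_average: "norm (conj_average n T) \<le> norm T"
proof (rule norm_blinfun_bound)
  fix x
  have u: "star (g n * s n) * (g n * s n) = 1" using unitaries(1)[of n] by (simp add: relations)
  have b: "norm (gns_rep v (T (gns_rep w x))) \<le> norm T * norm x" if "star v * v = 1" "star w * w = 1" for v w
    using norm_blinfun[of T "gns_rep w x"] by (simp add: norm_gns_rep_unitary that)
  show "norm (conj_average n T x) \<le> norm T * norm x"
    unfolding conj_average_def blinfun.add_left blinfun.scaleR_left
    by (rule norm_four_average_le) (simp_all add: norm_blinfun b unitaries u relations)
qed simp

lemma conj_average_right_commutant: "T \<in> right_commutant \<Longrightarrow> conj_average n T \<in> right_commutant"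
proof -
  assume T: "T \<in> right_commutant"
  have "r *\<^sub>R S \<in> right_commutant" if "S \<in> right_commutant" for r :: real and S
    using that by (simp add: right_commutant_def blinfun.scaleR_left blinfun.scaleR_right)
  then show ?thesis
    unfolding conj_average_def by (simp add: right_commutant_closed T)
qed

lemma cinner_conj_average:
  "cinner (conj_average n T x) x = (cinner (T x) x + cinner (T (gns_rep (s n) x)) (gns_rep (s n) x)
    + cinner (T (gns_rep (g n) x)) (gns_rep (g n) x)
    + cinner (T (gns_rep (g n * s n) x)) (gns_rep (g n * s n) x)) / 4"
proof -
  have "star (s n * g n) = g n * s n" by (simp add: star_mult relations)
  moreover have "cinner (r *\<^sub>R y) z = of_real r * cinner y z" for r and y z :: gns
    by (simp only: scaleC_of_real[symmetric] cinner_scaleC_left)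
  ultimately show ?thesis
    by (simp add: conj_average_def blinfun.add_left blinfun.scaleR_left cinner_add_left cinner_gns_rep relations)
qed

lemma expectation_exists:
  assumes T: "T \<in> right_commutant"
  obtains S where "S \<in> right_commutant" "S gns_vacuum = proj_lim (T gns_vacuum)"
    "\<And>x. (\<lambda>n. conj_average n T x) \<longlonglongrightarrow> S x"
proof -
  have "(\<lambda>n. conj_average n T gns_vacuum) \<longlonglongrightarrow> proj_lim (T gns_vacuum)"
    unfolding conj_average_vacuum[OF T] by (rule proj_tendsto)
  then show ?thesis
    by (rule right_commutant_limit[OF conj_average_right_commutant[OF T] norm_conj_average]) (blast intro: that)
qed

definition expectation :: "gns_op \<Rightarrow> gns_op"
  where "expectation T = (THE S. S \<in> right_commutant \<and> S gns_vacuum = proj_lim (T gns_vacuum))"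

lemma expectation:
  assumes T: "T \<in> right_commutant"
  shows expectation_right_commutant: "expectation T \<in> right_commutant"
    and expectation_vacuum: "expectation T gns_vacuum = proj_lim (T gns_vacuum)"
    and conj_average_tendsto: "(\<lambda>n. conj_average n T x) \<longlonglongrightarrow> expectation T x"
proof -
  obtain S where S: "S \<in> right_commutant" "S gns_vacuum = proj_lim (T gns_vacuum)"
    "\<And>x. (\<lambda>n. conj_average n T x) \<longlonglongrightarrow> S x"
    by (rule expectation_exists[OF T]) blast
  have "expectation T = S"
    unfolding expectation_def using S(1,2) vacuum_separating by (intro the_equality) auto
  then show "expectation T \<in> right_commutant" "expectation T gns_vacuum = proj_lim (T gns_vacuum)"
    "(\<lambda>n. conj_average n T x) \<longlonglongrightarrow> expectation T x" using S by simp_all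
qed

lemma average_fixed: "\<exists>m. \<forall>n\<ge>m. average (s n) (g n) a \<in> fixed"
proof -
  obtain m c where m: "\<And>n. n \<ge> m \<Longrightarrow> average (s n) (g n) a = c" by (rule eventually_constant_average) blast
  have "s n * c = c * s n \<and> g n * c = c * g n" if "n \<ge> m" for n
    using average_commute[OF involutions, of n a] unfolding m[OF that] by blast
  then have "c \<in> fixed" by (auto simp: fixed_def)
  then show ?thesis using m by auto
qed

text \<open>Each approximant of T is averaged at a level where its average has become constant. The
  results are fixed, bounded in norm, and converge at the vacuum. Consequently the expectation lies
  in every strongly closed set that contains the fixed local elements.\<close>

lemma expectation_approx:
  assumes T: "T \<in> right_commutant"
  obtains b where "\<And>n. b n \<in> fixed" "\<And>x. (\<lambda>n. gns_rep (b n) x) \<longlonglongrightarrow> expectation T x"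
proof -
  obtain a where a: "\<And>n. norm (gns_rep (a n)) \<le> norm T" "\<And>x. (\<lambda>n. gns_rep (a n) x) \<longlonglongrightarrow> T x"
    by (rule right_commutant_approx[OF T]) blast
  have "\<forall>n. \<exists>k. average (s k) (g k) (a n) \<in> fixed \<and> proj_lim (to_completion (a n)) = to_completion (average (s k) (g k) (a n))"
    using average_fixed proj_lim_to_completion by (metis le_cases)
  then obtain k where k: "\<And>n. average (s (k n)) (g (k n)) (a n) \<in> fixed"
    "\<And>n. proj_lim (to_completion (a n)) = to_completion (average (s (k n)) (g (k n)) (a n))"
    by metis
  let ?b = "\<lambda>n. average (s (k n)) (g (k n)) (a n)"
  have rep: "gns_rep (?b n) = conj_average (k n) (gns_rep (a n))" for n
    by (rule vacuum_separating)
      (simp_all add: right_commutant_gns_rep conj_average_right_commutant conj_average_vacuum gns_rep_to_completion proj_to_completion)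
  have l: "(\<lambda>n. gns_rep (?b n) gns_vacuum) \<longlonglongrightarrow> proj_lim (T gns_vacuum)"
    unfolding gns_rep_vacuum k(2)[symmetric]
    using a(2)[of gns_vacuum] unfolding gns_rep_vacuum by (intro tendsto_intros)
  have bnd: "norm (gns_rep (?b n)) \<le> norm T" for n
    unfolding rep by (rule order_trans[OF norm_conj_average a(1)])
  obtain S where S: "S \<in> right_commutant" "\<And>x. (\<lambda>n. gns_rep (?b n) x) \<longlonglongrightarrow> S x"
    "S gns_vacuum = proj_lim (T gns_vacuum)"
    by (rule right_commutant_limit[OF right_commutant_gns_rep bnd l]) blast
  have "S = expectation T"
    by (rule vacuum_separating[OF S(1)]) (simp_all add: expectation T S(3))
  then show ?thesis using k(1) S(2) by (intro that[of ?b]) simp_all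
qed

lemma expectation_subfactor: "T \<in> subfactor \<Longrightarrow> expectation T = T"
  by (rule vacuum_separating)
    (simp_all add: subfactor_def expectation subfactor_vacuum[unfolded subfactor_def])

lemma expectation_in_von_neumann_algebra:
  assumes "closedin strong_operator_topology N" "gns_rep ` fixed \<subseteq> N" "T \<in> right_commutant"
  shows "expectation T \<in> N"
proof -
  obtain b where "\<And>n. b n \<in> fixed" "\<And>x. (\<lambda>n. gns_rep (b n) x) \<longlonglongrightarrow> expectation T x"
    by (rule expectation_approx[OF assms(3)]) blast
  then show ?thesis
    using assms(2) by (intro sot_closed_limit[OF assms(1), of "\<lambda>n. gns_rep (b n)" "expectation T"]) blast+
qed

text \<open>The left factor p commutes with \<open>proj_lim\<close> by definition. The right factor
  q is approximated by fixed local elements b; right multiplication by b commutes with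
  \<open>proj_lim\<close>, and the limit carries this over to q.\<close>

lemma expectation_bimodule:
  assumes p: "p \<in> subfactor" and q: "q \<in> subfactor" and x: "x \<in> right_commutant"
  shows "expectation (p o\<^sub>L x o\<^sub>L q) = p o\<^sub>L expectation x o\<^sub>L q"
proof (rule vacuum_separating)
  have p': "p \<in> right_commutant" "\<And>x. p (proj_lim x) = proj_lim (p x)" and q': "q \<in> right_commutant"
    using p q by (auto simp: subfactor_def)
  show r: "expectation (p o\<^sub>L x o\<^sub>L q) \<in> right_commutant" "p o\<^sub>L expectation x o\<^sub>L q \<in> right_commutant"
    by (intro expectation right_commutant_compose p' q' x)+
  obtain b where b: "\<And>n. b n \<in> fixed" "\<And>z. (\<lambda>n. gns_rep (b n) z) \<longlonglongrightarrow> expectation q z"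
    by (rule expectation_approx[OF q']) blast
  have bq: "(\<lambda>n. to_completion (b n)) \<longlonglongrightarrow> q gns_vacuum"
    using b(2)[of gns_vacuum] by (simp add: expectation_subfactor[OF q] gns_rep_vacuum)
  have "proj_lim (x (to_completion (b n))) = expectation x (to_completion (b n))" for n
    unfolding right_commutant_to_completion[OF x, of "b n"] right_commutant_to_completion[OF expectation_right_commutant[OF x], of "b n"]
      expectation_vacuum[OF x] fixed_commute_proj_lim(2)[OF b(1)] ..
  then have "(\<lambda>n. proj_lim (x (to_completion (b n)))) \<longlonglongrightarrow> expectation x (q gns_vacuum)"
    using blinfun.tendsto[OF tendsto_const bq, of "expectation x"] by simp
  moreover have "(\<lambda>n. proj_lim (x (to_completion (b n)))) \<longlonglongrightarrow> proj_lim (x (q gns_vacuum))"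
    by (intro tendsto_intros bq)
  ultimately have "proj_lim (x (q gns_vacuum)) = expectation x (q gns_vacuum)"
    using LIMSEQ_unique by blast
  then show "expectation (p o\<^sub>L x o\<^sub>L q) gns_vacuum = (p o\<^sub>L expectation x o\<^sub>L q) gns_vacuum"
    by (simp add: expectation_vacuum right_commutant_compose p'(1) q' x flip: p'(2))
qed

lemma positive_expectation:
  assumes "T \<in> right_commutant" "positive_op T"
  shows "positive_op (expectation T)"
  unfolding positive_op_def
proof (intro allI)
  fix x
  have lim: "(\<lambda>n. cinner (conj_average n T x) x) \<longlonglongrightarrow> cinner (expectation T x) x"
    by (rule tendsto_cinner[OF conj_average_tendsto[OF assms(1)] tendsto_const])
  have pos: "cinner (T y) y \<in> \<real>" "0 \<le> Re (cinner (T y) y)" for y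
    using assms(2) by (auto simp: positive_op_def)
  have "(\<lambda>n. Im (cinner (conj_average n T x) x)) = (\<lambda>_. 0)"
    using pos(1) by (simp add: cinner_conj_average complex_is_Real_iff)
  with tendsto_Im[OF lim] have "(\<lambda>_ :: nat. 0) \<longlonglongrightarrow> Im (cinner (expectation T x) x)" by simp
  then have "cinner (expectation T x) x \<in> \<real>"
    by (simp add: complex_is_Real_iff LIMSEQ_const_iff)
  moreover have "0 \<le> Re (cinner (expectation T x) x)"
    by (rule LIMSEQ_le_const[OF tendsto_Re[OF lim]]) (simp add: cinner_conj_average pos)
  ultimately show "cinner (expectation T x) x \<in> \<real> \<and> 0 \<le> Re (cinner (expectation T x) x)" ..
qed

lemma is_cond_exp_expectation:
  assumes Q: "Q \<subseteq> subfactor" and E: "\<And>T. T \<in> right_commutant \<Longrightarrow> expectation T \<in> Q"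
  shows "is_cond_exp right_commutant gns_trace Q expectation"
  unfolding is_cond_exp_def
proof (intro conjI ballI allI impI)
  fix x assume x: "x \<in> right_commutant"
  show "expectation x \<in> Q" by (rule E[OF x])
  show "expectation (x + y) = expectation x + expectation y" if y: "y \<in> right_commutant" for y
    by (rule vacuum_separating) (simp_all add: expectation right_commutant_add x y blinfun.add_left blinfun.add_right)
  show "expectation (op_scale c x) = op_scale c (expectation x)" for c
    by (rule vacuum_separating) (simp_all add: expectation right_commutant_op_scale x op_scale_apply proj_lim_scaleC)
  show "positive_op (expectation x)" if "positive_op x" by (rule positive_expectation[OF x that])
  show "gns_trace (expectation x) = gns_trace x"
    by (simp add: gns_trace_def expectation x cinner_proj_lim proj_lim_vacuum)
qed (use Q expectation_subfactor expectation_bimodule in blast)+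

text \<open>\<open>cond_exp\<close> is an arbitrary choice, so uniqueness has to be shown. The
  bimodule and trace properties determine the inner products of F(T) at the vacuum with all vectors
  q at the vacuum, q in \<open>Q\<close>, and the projected vector has the same ones.\<close>

lemma cond_exp_eq_expectation:
  assumes Q: "von_neumann_algebra Q" "Q \<subseteq> subfactor" and E: "\<And>T. T \<in> right_commutant \<Longrightarrow> expectation T \<in> Q"
    and T: "T \<in> right_commutant"
  shows "cond_exp right_commutant gns_trace Q T = expectation T"
proof -
  have "is_cond_exp right_commutant gns_trace Q (cond_exp right_commutant gns_trace Q)"
    unfolding cond_exp_def
    by (rule someI[of "is_cond_exp right_commutant gns_trace Q" expectation]) (rule is_cond_exp_expectation[OF Q(2) E])
  moreover note is_cond_exp_expectation[OF Q(2) E]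
  moreover have "F T gns_vacuum = proj_lim (T gns_vacuum)" if F: "is_cond_exp right_commutant gns_trace Q F" for F
  proof -
    have FT: "F T \<in> Q" using F T by (auto simp: is_cond_exp_def)
    have Qr: "q \<in> right_commutant" if "q \<in> Q" for q using that Q(2) by (auto simp: subfactor_def)
    have inner: "cinner (F T gns_vacuum) (q gns_vacuum) = cinner (T gns_vacuum) (q gns_vacuum)" if q: "q \<in> Q" for q
    proof -
      have q': "op_adjoint q \<in> Q" and one: "id_blinfun \<in> Q" using Q(1) q by (auto simp: von_neumann_algebra_def)
      have "F (op_adjoint q o\<^sub>L T o\<^sub>L id_blinfun) = op_adjoint q o\<^sub>L F T o\<^sub>L id_blinfun"
        using F q' one T unfolding is_cond_exp_def by blast
      moreover have "gns_trace (F (op_adjoint q o\<^sub>L T o\<^sub>L id_blinfun)) = gns_trace (op_adjoint q o\<^sub>L T o\<^sub>L id_blinfun)"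
        using F Qr[OF q'] T unfolding is_cond_exp_def by (meson right_commutant_compose right_commutant_id)
      ultimately have "cinner (op_adjoint q (F T gns_vacuum)) gns_vacuum = cinner (op_adjoint q (T gns_vacuum)) gns_vacuum"
        by (simp add: gns_trace_def)
      then show ?thesis
        using right_commutant_adjoint(2)[OF Qr[OF q], symmetric] by (metis cinner_commute)
    qed
    \<comment> \<open>Both candidates lie in \<open>Q\<close>, so their difference can be tested
      against itself.\<close>
    let ?d = "F T + op_scale (- 1) (expectation T)"
    have d: "?d \<in> Q" using Q(1) FT E[OF T] by (auto simp: von_neumann_algebra_def)
    have "cinner (proj_lim (T gns_vacuum)) (q gns_vacuum) = cinner (T gns_vacuum) (q gns_vacuum)" if "q \<in> Q" for q
      using that Q(2) subfactor_vacuum by (metis cinner_proj_lim subsetD)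
    then have "cinner (F T gns_vacuum - proj_lim (T gns_vacuum)) (?d gns_vacuum) = 0"
      using inner d by (simp add: cinner_diff_left)
    moreover have "?d gns_vacuum = F T gns_vacuum - proj_lim (T gns_vacuum)"
    proof -
      have "scaleC (- 1) z = - z" for z :: gns using scaleC_of_real[of "- 1" z] by simp
      then show ?thesis by (simp add: blinfun.add_left op_scale_apply expectation T)
    qed
    ultimately show ?thesis by (simp add: cinner_self)
  qed
  ultimately show ?thesis
    using T E Q(2) by (intro vacuum_separating) (auto simp: is_cond_exp_def subfactor_def)
qed

text \<open>No commutation of T with an individual s_n is available. The fixed elements
  approximating T commute with s_n eventually, and conjugation by s_n is isometric on vectors for
  every n, so the approximation error at the vacuum is uniform in n.\<close>

lemma conj_s_tendsto:
  assumes T: "T \<in> subfactor"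
  shows "(\<lambda>n. gns_rep (s n) (T (gns_rep (s n) x))) \<longlonglongrightarrow> T x"
proof -
  have T': "T \<in> right_commutant" using T by (simp add: subfactor_def)
  let ?C = "\<lambda>n. gns_rep (s n) o\<^sub>L T o\<^sub>L gns_rep (s n)"
  have C: "?C n \<in> right_commutant" for n by (intro right_commutant_closed T')
  have bnd: "norm (?C n) \<le> norm T" for n
  proof (rule norm_blinfun_bound[OF norm_ge_zero])
    show "norm (?C n x) \<le> norm T * norm x" for x
      using norm_blinfun[of T "gns_rep (s n) x"] by (simp add: norm_gns_rep_unitary relations)
  qed
  have Cv: "?C n gns_vacuum = gns_rep (s n) (right_mult (s n) (T gns_vacuum))" for n
    by (simp add: gns_rep_vacuum right_commutant_to_completion[OF T', of "s n"])
  obtain b where b: "\<And>n. b n \<in> fixed" "\<And>z. (\<lambda>n. gns_rep (b n) z) \<longlonglongrightarrow> expectation T z"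
    by (rule expectation_approx[OF T']) blast
  have bT: "(\<lambda>n. to_completion (b n)) \<longlonglongrightarrow> T gns_vacuum"
    using b(2)[of gns_vacuum] by (simp add: expectation_subfactor[OF T] gns_rep_vacuum)
  have "(\<lambda>n. ?C n gns_vacuum) \<longlonglongrightarrow> T gns_vacuum"
  proof (rule LIMSEQ_I)
    fix e :: real assume "0 < e"
    then obtain k where k: "norm (to_completion (b k) - T gns_vacuum) < e / 2"
      using LIMSEQ_D[OF bT, of "e / 2"] by auto
    obtain m where m: "\<And>n. n \<ge> m \<Longrightarrow> s n * b k = b k * s n" using b(1)[of k] by (auto simp: fixed_def)
    have "norm (?C n gns_vacuum - T gns_vacuum) < e" if "n \<ge> m" for n
    proof -
      let ?A = "\<lambda>z. gns_rep (s n) (right_mult (s n) z)"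
      have "s n * (b k * s n) = b k" using m[OF that] by (metis mult.assoc mult.right_neutral relations(1))
      then have A: "?A (to_completion (b k)) = to_completion (b k)"
        by (simp add: gns_rep_to_completion right_mult_to_completion)
      have "?A (T gns_vacuum) - T gns_vacuum = ?A (T gns_vacuum - to_completion (b k)) + (to_completion (b k) - T gns_vacuum)"
        by (simp add: blinfun.diff_right A)
      also have "norm \<dots> \<le> norm (T gns_vacuum - to_completion (b k)) + norm (to_completion (b k) - T gns_vacuum)"
        by (rule order_trans[OF norm_triangle_ineq]) (simp add: norm_gns_rep_unitary norm_right_mult_unitary relations)
      also have "\<dots> < e" using k by (simp add: norm_minus_commute)
      finally show ?thesis unfolding Cv .
    qed
    then show "\<exists>m. \<forall>n\<ge>m. norm (?C n gns_vacuum - T gns_vacuum) < e" by blast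
  qed
  then obtain S where S: "S \<in> right_commutant" "\<And>x. (\<lambda>n. ?C n x) \<longlonglongrightarrow> S x" "S gns_vacuum = T gns_vacuum"
    by (rule right_commutant_limit[OF C bnd]) blast
  then show ?thesis using vacuum_separating[OF S(1) T' S(3)] S(2)[of x] by simp
qed

end

section \<open>The Pimsner-Popa constant\<close>

sublocale hadamard \<subseteq> tower: involution_tower shift_all reflection
proof
  show "commuting_involutions (shift_all n) (reflection n)" for n by (rule commuting_involutions)
  show "\<exists>m. \<forall>n\<ge>m. average (shift_all n) (reflection n) a = average (shift_all m) (reflection m) a" for a
    unfolding expect_eq_average[symmetric] by (rule ex_expect_stable)
qed

lemma (in hadamard) tower_fixed: "tower.fixed = fixed_alg"
  by (simp add: tower.fixed_def fixed_alg_def)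

text \<open>The given algebra \<open>N\<close> keeps the intersection from running over an empty
  family, which would yield all real linear operators.\<close>

lemma von_neumann_algebra_vn_generated:
  fixes G :: "('a :: complex_hilbert \<Rightarrow>\<^sub>L 'a) set"
  assumes "von_neumann_algebra N" "G \<subseteq> N"
  shows "von_neumann_algebra (vn_generated G)"
proof -
  have clo: "id_blinfun \<in> N" "S \<in> N \<Longrightarrow> T \<in> N \<Longrightarrow> S + T \<in> N" "S \<in> N \<Longrightarrow> op_scale c S \<in> N"
    "S \<in> N \<Longrightarrow> T \<in> N \<Longrightarrow> S o\<^sub>L T \<in> N" "S \<in> N \<Longrightarrow> op_adjoint S \<in> N"
    if "von_neumann_algebra N" for N :: "('a \<Rightarrow>\<^sub>L 'a) set" and S T c
    using that by (simp_all add: von_neumann_algebra_def)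
  have memI: "S \<in> vn_generated G" if "\<And>N. von_neumann_algebra N \<Longrightarrow> G \<subseteq> N \<Longrightarrow> S \<in> N" for S
    using that by (auto simp: vn_generated_def)
  have memD: "S \<in> N" if "S \<in> vn_generated G" "von_neumann_algebra N" "G \<subseteq> N" for S N
    using that by (auto simp: vn_generated_def)
  show ?thesis
    unfolding von_neumann_algebra_def[of "vn_generated G"]
  proof (intro conjI ballI allI)
    show "closedin strong_operator_topology (vn_generated G)"
      unfolding vn_generated_def
      by (rule closedin_Inter) (use assms in \<open>auto simp: von_neumann_algebra_def\<close>)
    show "complex_linear_op S" if "S \<in> vn_generated G" for S
      using memD[OF that assms] assms(1) by (simp add: von_neumann_algebra_def)
    show "id_blinfun \<in> vn_generated G" by (intro memI clo)
    show "S + T \<in> vn_generated G" "S o\<^sub>L T \<in> vn_generated G"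
      if "S \<in> vn_generated G" "T \<in> vn_generated G" for S T
      by (intro memI clo; simp add: memD that)+
    show "op_scale c S \<in> vn_generated G" "op_adjoint S \<in> vn_generated G" if "S \<in> vn_generated G" for c S
      by (intro memI clo; simp add: memD that)+
  qed
qed

section \<open>Spin model subfactors and fixed algebras\<close>

definition spin_generators :: "complex \<Rightarrow> local_alg set"
  where "spin_generators z =
    {embed 1 (hadamard4 z * d * mat_adjoint (hadamard4 z)) | d. d \<in> carrier_mat 4 4 \<and> diagonal_mat d}
      \<union> {jones_proj j | j. j \<ge> 1}"

lemma spin_subfactor_eq: "spin_subfactor (hadamard4 z) = vn_generated (gns_rep ` spin_generators z)"
  by (simp add: spin_subfactor_def spin_generators_def)

lemma spin_generators_simps:
  shows "site 0 (mult4 (mult4 (hadamard_entry z) (diag4 c)) (adj4 (hadamard_entry z))) \<in> spin_generators z"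
    and "(\<Sum>i<4. site (Suc k) (unit4 i i) * site k (unit4 i i)) \<in> spin_generators z"
    and "site (Suc k) J4 \<in> spin_generators z"
proof -
  let ?h = "hadamard_entry z"
  define d where "d = mat 4 4 (\<lambda>(i, j). if i = j then c i else 0)"
  have d: "d \<in> carrier_mat 4 4" "diagonal_mat d" by (simp_all add: d_def diagonal_mat_def)
  have "site 0 (mult4 (mult4 ?h (diag4 (\<lambda>i. d $$ (i, i)))) (adj4 ?h)) = site 0 (mult4 (mult4 ?h (diag4 c)) (adj4 ?h))"
  proof (rule site_cong)
    fix p q :: nat
    show "mult4 (mult4 ?h (diag4 (\<lambda>i. d $$ (i, i)))) (adj4 ?h) p q = mult4 (mult4 ?h (diag4 c)) (adj4 ?h) p q"
      unfolding mult4_def[of "mult4 ?h (diag4 _)"]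
      by (intro sum.cong refl) (simp add: mult4_diag4 d_def)
  qed
  then show "site 0 (mult4 (mult4 ?h (diag4 c)) (adj4 ?h)) \<in> spin_generators z"
    using embed_hadamard_diag[OF d, of z] d unfolding spin_generators_def by force
  show "(\<Sum>i<4. site (Suc k) (unit4 i i) * site k (unit4 i i)) \<in> spin_generators z"
    unfolding jones_proj_odd[symmetric] spin_generators_def by auto
  show "site (Suc k) J4 \<in> spin_generators z"
    unfolding jones_proj_even[symmetric] spin_generators_def by auto
qed

lemma spin_generators_cases:
  assumes "x \<in> spin_generators z"
  obtains (diag) c where "x = site 0 (mult4 (mult4 (hadamard_entry z) (diag4 c)) (adj4 (hadamard_entry z)))"
    | (pair) k where "x = (\<Sum>i<4. site (Suc k) (unit4 i i) * site k (unit4 i i))"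
    | (J) k where "x = site (Suc k) J4"
proof -
  from assms consider d where "d \<in> carrier_mat 4 4" "diagonal_mat d" "x = embed 1 (hadamard4 z * d * mat_adjoint (hadamard4 z))"
    | j where "j \<ge> 1" "x = jones_proj j"
    unfolding spin_generators_def by blast
  then show thesis
  proof cases
    case 1
    then show ?thesis using embed_hadamard_diag diag by metis
  next
    case (2 j)
    show ?thesis
    proof (cases "even j")
      case True
      then obtain k where "j = 2 * Suc k" using 2(1) by (metis evenE not0_implies_Suc mult_0_right not_one_le_zero)
      then show ?thesis using 2(2) jones_proj_even J by simp
    next
      case False
      then obtain k where "j = Suc (2 * k)" by (metis oddE Suc_eq_plus1)
      then show ?thesis using 2(2) jones_proj_odd pair by simp
    qed
  qed
qed

text \<open>The generators are fixed, which gives the upper inclusion. Every von Neumann algebra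
  containing them contains all fixed local elements, hence all expectations, which gives the lower
  one. Together with \<open>expectation_subfactor\<close> this amounts to equality.\<close>

lemma spin_subfactor_props:
  assumes z: "cmod z = 1"
  defines "Q \<equiv> spin_subfactor (hadamard4 z)"
  shows "von_neumann_algebra Q" and "Q \<subseteq> involution_tower.subfactor shift_all (hadamard.reflection (hadamard_entry z))"
    and "T \<in> right_commutant \<Longrightarrow> involution_tower.expectation shift_all (hadamard.reflection (hadamard_entry z)) T \<in> Q"
proof -
  interpret H: hadamard "hadamard_entry z" by (rule hadamard_hadamard_entry[OF z])
  have "x \<in> H.fixed_alg" if "x \<in> spin_generators z" for x
    using that by (cases rule: spin_generators_cases) (simp_all add: H.generators_in_fixed_alg)
  then have gens: "gns_rep ` spin_generators z \<subseteq> H.tower.subfactor"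
    using H.tower.gns_rep_fixed_subfactor by (auto simp: H.tower_fixed)
  show "von_neumann_algebra Q"
    unfolding Q_def spin_subfactor_eq
    by (rule von_neumann_algebra_vn_generated[OF H.tower.von_neumann_algebra_subfactor gens])
  show "Q \<subseteq> H.tower.subfactor"
    unfolding Q_def spin_subfactor_eq vn_generated_def
    using H.tower.von_neumann_algebra_subfactor gens by blast
  show "H.tower.expectation T \<in> Q" if T: "T \<in> right_commutant"
    unfolding Q_def spin_subfactor_eq vn_generated_def
  proof (rule InterI, clarify)
    fix N assume N: "von_neumann_algebra N" "gns_rep ` spin_generators z \<subseteq> N"
    have "H.fixed_alg \<subseteq> {a. gns_rep a \<in> N}"
      using N spin_generators_simps[where z = z]
      by (intro H.generated_superset_fixed_alg)
        (auto simp: von_neumann_algebra_def gns_rep_add gns_rep_mult gns_rep_scaleC' gns_rep_one)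
    then show "H.tower.expectation T \<in> N"
      using N(1) by (intro H.tower.expectation_in_von_neumann_algebra T) (auto simp: H.tower_fixed von_neumann_algebra_def)
  qed
qed

section \<open>The lower and the upper bound for the constant\<close>

lemma cinner_scaleR_left: "cinner (r *\<^sub>R x) y = of_real r * cinner x y" for x y :: "'a :: complex_inner"
  by (simp only: scaleC_of_real[symmetric] cinner_scaleC_left)

lemma half_le_expectation:
  assumes "hadamard u" "hadamard v" and x: "x \<in> involution_tower.subfactor shift_all (hadamard.reflection u)" "positive_op x"
  shows "positive_op (involution_tower.expectation shift_all (hadamard.reflection v) x - (1 / 2 :: real) *\<^sub>R x)"
proof -
  interpret A: hadamard u by fact
  interpret B: hadamard v by fact
  have xr: "x \<in> right_commutant" using x(1) by (simp add: A.tower.subfactor_def)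
  have pos: "cinner (x y) y \<in> \<real>" "0 \<le> Re (cinner (x y) y)" for y
    using x(2) by (auto simp: positive_op_def)
  show ?thesis
    unfolding positive_op_def
  proof (intro allI conjI)
    fix y
    have split: "cinner ((B.tower.expectation x - (1 / 2 :: real) *\<^sub>R x) y) y
        = cinner (B.tower.expectation x y) y - of_real (1 / 2) * cinner (x y) y"
      by (simp only: blinfun.diff_left blinfun.scaleR_left cinner_diff_left cinner_scaleR_left)
    have "cinner (B.tower.expectation x y) y \<in> \<real>"
      using B.tower.positive_expectation[OF xr x(2)] by (simp add: positive_op_def)
    then show "cinner ((B.tower.expectation x - (1 / 2 :: real) *\<^sub>R x) y) y \<in> \<real>"
      unfolding split by (intro Reals_diff Reals_mult pos Reals_of_real)
    \<comment> \<open>The summands of the average for 1 and s are kept; the two involving the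
      reflection of v are nonnegative. The limit uses that both towers share
      \<open>shift_all\<close>.\<close>
    let ?f = "\<lambda>n. (Re (cinner (x y) y) + Re (cinner (gns_rep (shift_all n) (x (gns_rep (shift_all n) y))) y)) / 4"
    have "Re (cinner (x y) y) / 2 \<le> Re (cinner (B.tower.expectation x y) y)"
    proof (rule LIMSEQ_le)
      have "?f \<longlonglongrightarrow> (Re (cinner (x y) y) + Re (cinner (x y) y)) / 4"
        by (intro tendsto_intros tendsto_Re tendsto_cinner A.tower.conj_s_tendsto[OF x(1)]) simp
      then show "?f \<longlonglongrightarrow> Re (cinner (x y) y) / 2" by simp
      show "(\<lambda>n. Re (cinner (B.tower.conj_average n x y) y)) \<longlonglongrightarrow> Re (cinner (B.tower.expectation x y) y)"
        by (intro tendsto_Re tendsto_cinner B.tower.conj_average_tendsto xr tendsto_const)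
      have "?f n \<le> Re (cinner (B.tower.conj_average n x y) y)" for n
        using pos(2) by (simp add: B.tower.cinner_conj_average cinner_gns_rep A.tower.relations)
      then show "\<exists>N. \<forall>n\<ge>N. ?f n \<le> Re (cinner (B.tower.conj_average n x y) y)" by blast
    qed
    then show "0 \<le> Re (cinner ((B.tower.expectation x - (1 / 2 :: real) *\<^sub>R x) y) y)"
      unfolding split by simp
  qed
qed

text \<open>A rank one projection \<open>p\<close> and its reflection \<open>p'\<close> average to the expectation of \<open>p\<close>; the
  vector \<open>1 - p'\<close> is killed by \<open>p'\<close> but not by \<open>p\<close>.\<close>

lemma expectation_upper_bound:
  assumes "hadamard v" and p: "p * p = p" "star p = p" "p \<in> level (Suc 0)"
    and s: "shift_all 0 * p = p * shift_all 0"
    and g: "hadamard.conj_diag v 0 sgn_pair * p \<noteq> p * hadamard.conj_diag v 0 sgn_pair"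
    and pos: "positive_op (involution_tower.expectation shift_all (hadamard.reflection v) (gns_rep p) - t *\<^sub>R gns_rep p)"
  shows "t \<le> 1 / 2"
proof -
  interpret B: hadamard v by fact
  let ?g = "B.reflection 0" and ?s = "shift_all 0"
  define p' where "p' = ?g * p * ?g"
  note rel = B.tower.relations[of 0]
  have gg: "?g * (?g * x) = x" for x using rel(2) by (simp flip: mult.assoc)
  have ss: "?s * (?s * x) = x" for x using rel(1) by (simp flip: mult.assoc)
  have p'p': "p' * p' = p'" by (simp add: p'_def mult.assoc gg) (simp add: p(1) flip: mult.assoc)
  have sp': "star p' = p'" by (simp add: p'_def star_mult rel p mult.assoc)
  have gp'g: "?g * p' * ?g = p" by (simp add: p'_def mult.assoc gg rel)
  have sps: "?s * p * ?s = p" unfolding s mult.assoc rel(1) by simp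
  have sp's: "?s * p' * ?s = p'"
  proof -
    have "?s * p' * ?s = (?s * ?g) * p * (?g * ?s)" by (simp add: p'_def mult.assoc)
    also have "\<dots> = (?g * ?s) * p * (?s * ?g)" by (simp only: rel(5))
    also have "\<dots> = ?g * (?s * p * ?s) * ?g" by (simp add: mult.assoc)
    also have "\<dots> = p'" by (simp only: sps p'_def)
    finally show ?thesis .
  qed
  \<comment> \<open>Conjugation by s fixes both p and p', so the four summands coincide in
    pairs.\<close>
  have avg: "average ?s ?g p = scaleC (1 / 2) (p + p')"
  proof -
    have "scaleC 2 z = z + z" for z :: local_alg
      using scaleC_add_left[of 1 1 z] by (simp add: scaleC_one)
    then have "average ?s ?g p = scaleC (1 / 4) (scaleC 2 (p + p'))"
      unfolding average_def sps p'_def[symmetric] sp's by (simp add: algebra_simps)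
    then show ?thesis by (simp add: scaleC_scaleC)
  qed
  have E: "B.tower.expectation (gns_rep p) = gns_rep (scaleC (1 / 2) (p + p'))"
  proof (rule vacuum_separating)
    obtain m where m: "\<forall>n\<ge>m. B.tower.proj_lim (to_completion p) = to_completion (average (shift_all n) (B.reflection n) p)"
      using B.tower.proj_lim_to_completion by blast
    have "average (shift_all m) (B.reflection m) p = scaleC (1 / 2) (p + p')"
      using B.expect_stable[OF le0 p(3), of m] by (simp only: B.expect_eq_average avg)
    then show "B.tower.expectation (gns_rep p) gns_vacuum = gns_rep (scaleC (1 / 2) (p + p')) gns_vacuum"
      using m[rule_format, of m] by (simp add: B.tower.expectation right_commutant_gns_rep gns_rep_vacuum)
  qed (simp_all add: B.tower.expectation right_commutant_gns_rep)
  define w where "w = 1 - p'"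
  have p'w: "p' * w = 0" by (simp add: w_def right_diff_distrib p'p')
  have pw: "cinner (p * w) w = of_real ((norm (p * w))\<^sup>2)"
  proof -
    have "cinner (p * w) w = cinner (p * (p * w)) w" by (simp add: p(1) flip: mult.assoc)
    also have "\<dots> = cinner (p * w) (p * w)" by (simp add: cinner_mult_left p(2))
    finally show ?thesis by (simp only: cinner_self)
  qed
  have "cinner ((B.tower.expectation (gns_rep p) - t *\<^sub>R gns_rep p) (to_completion w)) (to_completion w)
    = of_real ((1 / 2 - t) * (norm (p * w))\<^sup>2)"
    unfolding E blinfun.diff_left blinfun.scaleR_left cinner_diff_left cinner_scaleR_left gns_rep_to_completion cinner_to_completion
    by (simp add: mult_scaleC_left distrib_right p'w cinner_scaleC_left pw left_diff_distrib del: of_real_power)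
  moreover have "0 \<le> Re (cinner ((B.tower.expectation (gns_rep p) - t *\<^sub>R gns_rep p) (to_completion w)) (to_completion w))"
    using pos by (simp add: positive_op_def)
  ultimately have "0 \<le> (1 / 2 - t) * (norm (p * w))\<^sup>2"
    by (simp only: Re_complex_of_real)
  \<comment> \<open>If p w vanished, then p = p p'. Taking adjoints gives p = p' p, and conjugating
    p = p p' by g gives p' = p' p. So p = p', which means that g commutes with p.\<close>
  moreover have "norm (p * w) \<noteq> 0"
  proof
    assume "norm (p * w) = 0"
    then have e1: "p = p * p'" by (simp add: w_def right_diff_distrib)
    then have e2: "p = p' * p" using p(2) sp' by (metis star_mult)
    have "p' = ?g * (p * p') * ?g" unfolding p'_def using e1 p'_def by simp
    also have "\<dots> = (?g * p * ?g) * (?g * p' * ?g)" by (simp add: mult.assoc gg)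
    also have "\<dots> = p" using e2 gp'g p'_def by simp
    finally have "p = ?g * p * ?g" by (simp only: p'_def)
    then have "?g * p = ?g * (?g * p * ?g)" by simp
    then have "?g * p = p * ?g" by (simp add: mult.assoc gg)
    with g show False by simp
  qed
  ultimately show ?thesis by (simp add: zero_le_mult_iff)
qed

text \<open>The entry (0, 0) decides: it agrees for both products only if \<open>a * cnj b\<close>
  is real. The unit at index 1 selects the first column in which the parameter occurs.\<close>

lemma hadamard_reflection_commutator:
  assumes "cmod b = 1" "Im (a * cnj b) \<noteq> 0"
  shows "site 0 (mult4 (mult4 (hadamard_entry b) (diag4 sgn_pair)) (adj4 (hadamard_entry b)))
      * site 0 (mult4 (mult4 (hadamard_entry a) (unit4 1 1)) (adj4 (hadamard_entry a)))
    \<noteq> site 0 (mult4 (mult4 (hadamard_entry a) (unit4 1 1)) (adj4 (hadamard_entry a)))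
      * site 0 (mult4 (mult4 (hadamard_entry b) (diag4 sgn_pair)) (adj4 (hadamard_entry b)))"
  (is "?L \<noteq> ?R")
proof
  assume "?L = ?R"
  then have "entry ?L 0 0 = entry ?R 0 0" by simp
  then have "a * cnj b = b * cnj a"
    by (simp add: site_mult site.rep_eq same_other_digits_def digit_def mult4_def adj4_def diag4_def unit4_def
        sum4 sgn_pair_def hadamard_entry_values algebra_simps del: One_nat_def)
  then have "cnj (a * cnj b) = a * cnj b" by (simp add: mult.commute)
  then show False using assms(2) by (simp add: complex_eq_iff mult.commute)
qed

text \<open>The imaginary part is sin (x - y) with 0 < |x - y| < \<pi>; on the full circle the
  difference \<pi> would be a zero.\<close>

lemma Im_cis_mult_cnj_cis:
  assumes "x \<in> {0..<pi}" "y \<in> {0..<pi}" "cis x \<noteq> cis y"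
  shows "Im (cis x * cnj (cis y)) \<noteq> 0"
proof -
  have "Im (cis x * cnj (cis y)) = sin (x - y)" by (simp add: cis_cnj cis_mult)
  moreover have "x \<noteq> y" using assms(3) by auto
  moreover have "0 < sin (x - y)" if "y < x" using that assms by (intro sin_gt_zero) auto
  moreover have "0 < sin (y - x)" if "x < y" using that assms by (intro sin_gt_zero) auto
  moreover have "sin (y - x) = - sin (x - y)" by (metis minus_diff_eq sin_minus)
  ultimately show ?thesis by (metis less_irrefl linorder_neqE_linordered_idom neg_0_less_iff_less)
qed

theorem theorem1p10:
  fixes a b :: complex
  assumes "a \<in> cis ` {0..<pi}" and "b \<in> cis ` {0..<pi}" and "a \<noteq> b"
  shows "pimsner_popa hyperfinite_factor gns_trace
    (spin_subfactor (hadamard4 a)) (spin_subfactor (hadamard4 b)) = 1 / 2"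
proof -
  have ab: "cmod a = 1" "cmod b = 1" using assms by auto
  interpret A: hadamard "hadamard_entry a" by (rule hadamard_hadamard_entry[OF ab(1)])
  interpret B: hadamard "hadamard_entry b" by (rule hadamard_hadamard_entry[OF ab(2)])
  let ?P = "spin_subfactor (hadamard4 a)" and ?Q = "spin_subfactor (hadamard4 b)"
  note P = spin_subfactor_props[OF ab(1)] and Q = spin_subfactor_props[OF ab(2)]
  have PA: "x \<in> A.tower.subfactor" "x \<in> right_commutant" if "x \<in> ?P" for x
    using that P(2) by (auto simp: A.tower.subfactor_def)
  have cond: "cond_exp hyperfinite_factor gns_trace ?Q x = B.tower.expectation x" if "x \<in> ?P" for x
    unfolding hyperfinite_factor_eq
    by (rule B.tower.cond_exp_eq_expectation[OF Q]) (use PA that in auto)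
  let ?u = "hadamard_entry a"
  define p where "p = site 0 (mult4 (mult4 ?u (unit4 1 1)) (adj4 ?u))"
  have p_conj: "p = A.W 0 * site 0 (unit4 1 1) * star (A.W 0)"
    unfolding p_def unit4_diag4 by (rule A.conj_site_0[symmetric])
  have unit: "site 0 (unit4 1 1) * site 0 (unit4 1 1) = site 0 (unit4 1 1)"
    unfolding unit4_diag4 site_diag4_mult by (rule arg_cong[of _ _ "\<lambda>c. site 0 (diag4 c)"]) auto
  have pp: "p * p = p" unfolding p_conj A.conj_mult unit ..
  have sp: "star p = p"
    unfolding p_conj by (simp add: star_mult star_star mult.assoc unit4_diag4 star_diag4 if_distrib cong: if_cong)
  have pl: "p \<in> level (Suc 0)" unfolding p_def by (rule site_in_level) simp
  \<comment> \<open>Both elements are conjugates of diagonal matrices by the same unitary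
    \<open>A.W 0\<close>.\<close>
  have ps: "shift_all 0 * p = p * shift_all 0"
    unfolding A.shift_all_eq p_conj A.conj_diag_def A.conj_mult unit4_diag4 site_diag4_mult by (simp add: mult.commute)
  have pP: "gns_rep p \<in> ?P"
    using spin_generators_simps(1)[of a] unfolding p_def unit4_diag4 spin_subfactor_eq vn_generated_def by blast
  have p_pos: "positive_op (gns_rep p)"
    unfolding positive_op_def
  proof
    fix x
    have "cinner (gns_rep p x) x = cinner (gns_rep (p * p) x) x" by (simp add: pp)
    also have "\<dots> = cinner (gns_rep p x) (gns_rep p x)" by (simp add: gns_rep_mult cinner_gns_rep sp)
    finally show "cinner (gns_rep p x) x \<in> \<real> \<and> 0 \<le> Re (cinner (gns_rep p x) x)"
      by (simp add: cinner_self)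
  qed
  have "Im (a * cnj b) \<noteq> 0" using assms Im_cis_mult_cnj_cis by auto
  then have pg: "B.reflection 0 * p \<noteq> p * B.reflection 0"
    unfolding p_def B.conj_diag_def B.conj_site_0 by (rule hadamard_reflection_commutator[OF ab(2)])
  show ?thesis
    unfolding pimsner_popa_def
  proof (rule cSup_eq_maximum)
    show "1 / 2 \<in> {t. 0 \<le> t \<and> (\<forall>x\<in>?P. positive_op x \<longrightarrow>
        positive_op (cond_exp hyperfinite_factor gns_trace ?Q x - t *\<^sub>R x))}"
      using half_le_expectation[OF A.hadamard_axioms B.hadamard_axioms] PA cond by simp
    fix t assume "t \<in> {t. 0 \<le> t \<and> (\<forall>x\<in>?P. positive_op x \<longrightarrow>
        positive_op (cond_exp hyperfinite_factor gns_trace ?Q x - t *\<^sub>R x))}"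
    then have "positive_op (B.tower.expectation (gns_rep p) - t *\<^sub>R gns_rep p)"
      using pP p_pos cond by fastforce
    then show "t \<le> 1 / 2"
      by (rule expectation_upper_bound[OF B.hadamard_axioms pp sp pl ps pg])
  qed
qed

end
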